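(* Let $d,s_1,\ldots,s_d,t_1,\ldots,t_d$ be positive integers, let $\{\boldsymbol n_1=\boldsymbol n_1(n)\}_n,\ldots,\{\boldsymbol n_d=\boldsymbol n_d(n)\}_n$ be sequences of positive multi-indices tending to $\infty$, and denote by $|\boldsymbol n_i|$ the common length of all multi-indices in the $i$th sequence $\{\boldsymbol n_i(n)\}_n$. For every $i=1,\ldots,d$, let $\{A_{n,i}\}_n\sim_{\rm GLT}\kappa_i$ (with respect to the multi-index sequence $\{\boldsymbol n_i(n)\}_n$), where $A_{n,i}\in\mathbb C^{N(\boldsymbol n_i)s_i\times N(\boldsymbol n_i)t_i}$ and $\kappa_i:[0,1]^{|\boldsymbol n_i|}\times[-\pi,\pi]^{|\boldsymbol n_i|}\to\mathbb C^{s_i\times t_i}$ is measurable. Then, with respect to the multi-index sequence $\{\boldsymbol n=\boldsymbol n(n)=(\boldsymbol n_1(n),\ldots,\boldsymbol n_d(n))\}_n$ and with block size $(s_1\cdots s_d)\times(t_1\cdots t_d)$, $$\Bigl\{\bigl(\Pi_{N(\boldsymbol n_1),\ldots,N(\boldsymbol n_d)}^{s_1,\ldots,s_d}\bigr)^T(A_{n,1}\otimes\cdots\otimes A_{n,d})\,\Pi_{N(\boldsymbol n_1),\ldots,N(\boldsymbol n_d)}^{t_1,\ldots,t_d}\Bigr\}_n\sim_{\rm GLT}\kappa(\boldsymbol x,\boldsymbol\theta)=\kappa_1(\boldsymbol x_1,\boldsymbol\theta_1)\otimes\cdots\otimes\kappa_d(\boldsymbol x_d,\boldsymbol\theta_d),$$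 where every $\boldsymbol x=(\boldsymbol x_1,\ldots,\boldsymbol x_d)\in[0,1]^{|\boldsymbol n_1|+\cdots+|\boldsymbol n_d|}$ is decomposed so that $\boldsymbol x_i\in[0,1]^{|\boldsymbol n_i|}$ for each $i$, and every $\boldsymbol\theta=(\boldsymbol\theta_1,\ldots,\boldsymbol\theta_d)\in[-\pi,\pi]^{|\boldsymbol n_1|+\cdots+|\boldsymbol n_d|}$ is decomposed so that $\boldsymbol\theta_i\in[-\pi,\pi]^{|\boldsymbol n_i|}$ for each $i$. In particular, if $s_1=\cdots=s_d=t_1=\cdots=t_d=1$ (i.e., the symbols $\kappa_1,\ldots,\kappa_d$ are scalar), then $$\{A_{n,1}\otimes\cdots\otimes A_{n,d}\}_n\sim_{\rm GLT}\kappa(\boldsymbol x,\boldsymbol\theta)=\kappa_1(\boldsymbol x_1,\boldsymbol\theta_1)\otimes\cdots\otimes\kappa_d(\boldsymbol x_d,\boldsymbol\theta_d).$$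
   Context: **Multi-indices.** A multi-index of length $q$ (a $q$-index) is a vector $\boldsymbol i=(i_1,\ldots,i_q)\in\mathbb Z^q$, and $|\boldsymbol i|=q$ denotes its length. It is positive if all its components are positive. $\boldsymbol 0,\boldsymbol 1$ are the vectors of all zeros and all ones. $N(\boldsymbol m)=m_1\cdots m_q$. A sequence of multi-indices $\{\boldsymbol m=\boldsymbol m(n)\}_n$ has all its terms of the same length; for positive multi-indices, $\boldsymbol m\to\infty$ means $\min(\boldsymbol m(n))\to\infty$ as $n\to\infty$. Inequalities and operations such as $\boldsymbol i/\boldsymbol n$ are componentwise. Index ranges $\{\boldsymbol h,\ldots,\boldsymbol k\}=\{\boldsymbol i:\boldsymbol h\le\boldsymbol i\le\boldsymbol k\}$ are ordered lexicographically (last component varying fastest), and matrices (or block matrices) with entries (blocks) indexed by multi-indices $\boldsymbol i,\boldsymbol j=\boldsymbol 1,\ldots,\boldsymbol n$ use this ordering. $(\boldsymbol v_1,\ldots,\boldsymbol v_d)$ denotes concatenation of vectors. **Sequences of matrices.** A sequence of matrices is $\{A_n\}_n$ where $n$ varies in some infinite subset of $\mathbb N=\{1,2,\ldots\}$ and $A_n$ has size $d_n\times e_n$ with $d_n,e_n\to\infty$. $x\wedge y=\min(x,y)$. $\|\cdot\|$ is the spectral (operator 2-) norm. $\otimes$ is the Kronecker product, $X\otimes Y=[x_{ij}Y]_{i,j}$. Measure-theoretic terms refer to Lebesgue measure; matrix-valued functions are measurable/in $L^1$/continuous a.e. if all their components are, and integrals are computed componentwise. **a.c.s.** Let $\{A_n\}_n$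 be a sequence of matrices with $A_n$ of size $d_n\times e_n$ and $\{\{B_{n,m}\}_n\}_m$ a sequence of sequences of matrices with $B_{n,m}$ of size $d_n\times e_n$. One writes $\{B_{n,m}\}_n\xrightarrow{\rm a.c.s.}\{A_n\}_n$ (it is an approximating class of sequences for $\{A_n\}_n$) if for every $m$ there exists $n_m$ such that, for $n\ge n_m$, $A_n=B_{n,m}+R_{n,m}+N_{n,m}$ with ${\rm rank}(R_{n,m})\le c(m)(d_n\wedge e_n)$ and $\|N_{n,m}\|\le\omega(m)$, where $n_m,c(m),\omega(m)$ depend only on $m$ and $\lim_{m\to\infty}c(m)=\lim_{m\to\infty}\omega(m)=0$. **Toeplitz and diagonal sampling matrices.** For $\boldsymbol n\in\mathbb N^q$ and $f:[-\pi,\pi]^q\to\mathbb C^{s\times t}$ in $L^1$, with Fourier coefficients $f_{\boldsymbol k}=\frac1{(2\pi)^q}\int_{[-\pi,\pi]^q}f(\boldsymbol\theta){\rm e}^{-{\rm i}\boldsymbol k\cdot\boldsymbol\theta}{\rm d}\boldsymbol\theta\in\mathbb C^{s\times t}$, $\boldsymbol k\in\mathbb Z^q$, let $T_{\boldsymbol n}(f)=[f_{\boldsymbol i-\boldsymbol j}]_{\boldsymbol i,\boldsymbol j=\boldsymbol 1}^{\boldsymbol n}$, of size $N(\boldsymbol n)s\times N(\boldsymbol n)t$. For $a:[0,1]^q\to\mathbb C^{s\times t}$ let $D_{\boldsymbol n}(a)={\rm diag}_{\boldsymbol i=\boldsymbol 1,\ldots,\boldsymbol n}\,a(\boldsymbol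 i/\boldsymbol n)$, block diagonal of size $N(\boldsymbol n)s\times N(\boldsymbol n)t$. **GLT sequences.** Let $\{\boldsymbol n=\boldsymbol n(n)\}_n$ be a sequence of positive $q$-indices tending to $\infty$, $s,t$ fixed positive integers, $\{X_n\}_n$ a sequence of matrices with $X_n$ of size $N(\boldsymbol n)s\times N(\boldsymbol n)t$, and $\kappa:[0,1]^q\times[-\pi,\pi]^q\to\mathbb C^{s\times t}$ measurable. $\{X_n\}_n$ is a ($q$-level block) GLT sequence with symbol $\kappa$, written $\{X_n\}_n\sim_{\rm GLT}\kappa$, if for every $m$ there exist functions $a_{i,m},f_{i,m}$, $i=1,\ldots,N_m$, such that: (i) $a_{i,m}:[0,1]^q\to\mathbb C$ is continuous a.e. and $f_{i,m}:[-\pi,\pi]^q\to\mathbb C^{s\times t}$ is in $L^1([-\pi,\pi]^q)$; (ii) $\sum_{i=1}^{N_m}a_{i,m}(\boldsymbol x)f_{i,m}(\boldsymbol\theta)\to\kappa(\boldsymbol x,\boldsymbol\theta)$ a.e. on $[0,1]^q\times[-\pi,\pi]^q$ as $m\to\infty$; (iii) $\bigl\{\sum_{i=1}^{N_m}D_{\boldsymbol n}(a_{i,m}I_s)T_{\boldsymbol n}(f_{i,m})\bigr\}_n\xrightarrow{\rm a.c.s.}\{X_n\}_n$. **Permutation matrices.** $\mathbf e^{(n)}_1,\ldots,\mathbf e^{(n)}_n$ is the canonical basis of $\mathbb C^n$. For positive integers $n_1,n_2$, $P_{n_1,n_2}=\sum_{i=1}^{n_2}\mathbf e_i^{(n_2)}\otimes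 I_{n_1}\otimes(\mathbf e_i^{(n_2)})^T$, the $n_1n_2\times n_1n_2$ permutation matrix whose $i$th row is $(\mathbf e^{(n_1n_2)}_{\zeta(i)})^T$ with $\zeta(i)=((i-1)\bmod n_1)n_2+\lfloor(i-1)/n_1\rfloor+1$. A permutation $\sigma$ of $\{1,\ldots,d\}$ is written $[\sigma(1),\ldots,\sigma(d)]$. For positive integers $n_1,\ldots,n_d$, the permutation matrix $\Gamma_{n_1,\ldots,n_d}(\sigma)$ of size $n_1\cdots n_d$ is defined recursively: $\Gamma_{n_1}([1])=I_{n_1}$; $\Gamma_{n_1,n_2}([1,2])=I_{n_1n_2}$, $\Gamma_{n_1,n_2}([2,1])=P_{n_1,n_2}$; for $d\ge3$, $$\Gamma_{n_1,\ldots,n_d}(\sigma)=\bigl(I_{n_{\sigma(1)}\cdots n_{\sigma(i-1)}}\otimes P_{n_{\sigma(i+1)}\cdots n_{\sigma(d)},\,n_d}\bigr)\bigl(\Gamma_{n_1,\ldots,n_{d-1}}(\tau)\otimes I_{n_d}\bigr),$$ where $i$ is the index with $\sigma(i)=d$, $\tau=[\sigma(1),\ldots,\sigma(i-1),\sigma(i+1),\ldots,\sigma(d)]$, and empty products equal $1$. Finally, for positive integers $p_1,\ldots,p_d,q_1,\ldots,q_d$, $$\Pi_{p_1,\ldots,p_d}^{q_1,\ldots,q_d}=\Gamma_{p_1,\ldots,p_d,q_1,\ldots,q_d}([1,d+1,2,d+2,\ldots,d,2d]).$$ *)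

theory Defs
  imports "HOL-Analysis.Analysis" "Jordan_Normal_Form.DL_Rank"
begin

no_notation Finite_Cartesian_Product.vec_nth (infixl \<open>$\<close> 90)


section \<open>Matrices\<close>

text \<open>Matrices of varying size are those of \<^theory>\<open>Jordan_Normal_Form.Matrix\<close>; their rows and columns
  are numbered from 0.\<close>

definition vec_norm2 :: "complex vec \<Rightarrow> real" where
  "vec_norm2 v = L2_set (\<lambda>i. cmod (v $ i)) {..<dim_vec v}"

definition spectral_norm :: "complex mat \<Rightarrow> real" where
  "spectral_norm A =
     (SUP v\<in>{v \<in> carrier_vec (dim_col A). vec_norm2 v \<le> 1}. vec_norm2 (A *\<^sub>v v))"

definition mat_rank :: "complex mat \<Rightarrow> nat" where
  "mat_rank A = vec_space.rank (dim_row A) A"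

definition mat_sum :: "nat \<Rightarrow> nat \<Rightarrow> ('k \<Rightarrow> complex mat) \<Rightarrow> 'k set \<Rightarrow> complex mat" where
  "mat_sum nr nc F K = mat nr nc (\<lambda>ij. \<Sum>k\<in>K. F k $$ ij)"

definition kron :: "complex mat \<Rightarrow> complex mat \<Rightarrow> complex mat" where
  "kron X Y = mat (dim_row X * dim_row Y) (dim_col X * dim_col Y)
     (\<lambda>(i, j). X $$ (i div dim_row Y, j div dim_col Y) * Y $$ (i mod dim_row Y, j mod dim_col Y))"

definition kron_list :: "complex mat list \<Rightarrow> complex mat" where
  "kron_list As = foldr kron As (1\<^sub>m 1)"


section \<open>Permutation matrices\<close>

definition unit_col :: "nat \<Rightarrow> nat \<Rightarrow> complex mat" where
  "unit_col n i = mat_of_cols n [unit_vec n i]"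

definition perm_P :: "nat \<Rightarrow> nat \<Rightarrow> complex mat" where
  "perm_P n1 n2 = mat_sum (n1 * n2) (n1 * n2)
     (\<lambda>i. kron (kron (unit_col n2 i) (1\<^sub>m n1)) (transpose_mat (unit_col n2 i))) {..<n2}"

text \<open>In \<open>perm_Gamma_aux d ns \<sigma>\<close> the sizes \<open>n\<^sub>1, \<dots>, n\<^sub>d\<close> are the first \<open>d\<close> entries of \<open>ns\<close>, and the
  permutation \<open>\<sigma>\<close> of \<open>{1, \<dots>, d}\<close> is the list \<open>[\<sigma>(1), \<dots>, \<sigma>(d)]\<close>, whence the index shift in
  \<open>ns ! (k - 1)\<close>. The lists \<open>l\<close> and \<open>r\<close> are the parts of \<open>\<sigma>\<close> to the left and right of the entry \<open>d\<close>.\<close>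

fun perm_Gamma_aux :: "nat \<Rightarrow> nat list \<Rightarrow> nat list \<Rightarrow> complex mat" where
  "perm_Gamma_aux 0 ns \<sigma> = 1\<^sub>m 1"
| "perm_Gamma_aux (Suc 0) ns \<sigma> = 1\<^sub>m (ns ! 0)"
| "perm_Gamma_aux (Suc (Suc 0)) ns \<sigma> =
     (if \<sigma> = [2, 1] then perm_P (ns ! 0) (ns ! 1) else 1\<^sub>m (ns ! 0 * ns ! 1))"
| "perm_Gamma_aux (Suc (Suc (Suc k))) ns \<sigma> =
     (let d = Suc (Suc (Suc k));
          l = takeWhile (\<lambda>j. j \<noteq> d) \<sigma>;
          r = tl (dropWhile (\<lambda>j. j \<noteq> d) \<sigma>)
      in kron (1\<^sub>m (\<Prod>j\<leftarrow>l. ns ! (j - 1))) (perm_P (\<Prod>j\<leftarrow>r. ns ! (j - 1)) (ns ! (d - 1)))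
         * kron (perm_Gamma_aux (Suc (Suc k)) ns (l @ r)) (1\<^sub>m (ns ! (d - 1))))"

definition perm_Gamma :: "nat list \<Rightarrow> nat list \<Rightarrow> complex mat" where
  "perm_Gamma ns \<sigma> = perm_Gamma_aux (length ns) ns \<sigma>"

definition perm_Pi :: "nat list \<Rightarrow> nat list \<Rightarrow> complex mat" where
  "perm_Pi ps qs =
     perm_Gamma (ps @ qs) (concat (map (\<lambda>i. [i, length ps + i]) [1..<Suc (length ps)]))"


section \<open>Multi-indices and block matrices indexed by them\<close>

text \<open>Positive multi-indices are lists of naturals. The function \<^const>\<open>product_lists\<close> enumerates
  \<open>\<one>, \<dots>, m\<close> lexicographically, with the last component varying fastest.\<close>

definition multi_range :: "nat list \<Rightarrow> nat list list" where
  "multi_range m = product_lists (map (\<lambda>k. [1..<Suc k]) m)"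

definition multi_block_mat ::
    "nat list \<Rightarrow> nat \<Rightarrow> nat \<Rightarrow> (nat list \<Rightarrow> nat list \<Rightarrow> complex mat) \<Rightarrow> complex mat" where
  "multi_block_mat m s t B = mat (prod_list m * s) (prod_list m * t)
     (\<lambda>(i, j). B (multi_range m ! (i div s)) (multi_range m ! (j div t)) $$ (i mod s, j mod t))"

definition along :: "nat set \<Rightarrow> nat filter" where
  "along I = inf sequentially (principal I)"

definition multi_index_seq :: "nat set \<Rightarrow> nat \<Rightarrow> (nat \<Rightarrow> nat list) \<Rightarrow> bool" where
  "multi_index_seq I q m \<longleftrightarrow>
     0 < q \<and> (\<forall>n\<in>I. length (m n) = q \<and> (\<forall>k\<in>set (m n). 0 < k)) \<and>
     filterlim (\<lambda>n. Min (set (m n))) at_top (along I)"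


section \<open>The domains of the symbols\<close>

text \<open>A point of \<open>\<real>\<^sup>q\<close> is a function in \<open>{..<q} \<rightarrow>\<^sub>E UNIV\<close>. On this set the topology of the type
  \<^typ>\<open>nat \<Rightarrow> real\<close> is the Euclidean one, and the completion of the product of the Borel-Lebesgue
  measures is Lebesgue measure.\<close>

type_synonym point = "nat \<Rightarrow> real"

definition unit_cube :: "nat \<Rightarrow> point set" where
  "unit_cube q = {..<q} \<rightarrow>\<^sub>E {0..1}"

definition pi_cube :: "nat \<Rightarrow> point set" where
  "pi_cube q = {..<q} \<rightarrow>\<^sub>E {- pi..pi}"

definition borel_lebesgue :: "nat \<Rightarrow> point measure" where
  "borel_lebesgue q = PiM {..<q} (\<lambda>_. lborel)"

definition unit_measure :: "nat \<Rightarrow> point measure" where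
  "unit_measure q = restrict_space (completion (borel_lebesgue q)) (unit_cube q)"

definition pi_measure :: "nat \<Rightarrow> point measure" where
  "pi_measure q = restrict_space (completion (borel_lebesgue q)) (pi_cube q)"

definition symbol_measure :: "nat \<Rightarrow> (point \<times> point) measure" where
  "symbol_measure q =
     restrict_space (completion (borel_lebesgue q \<Otimes>\<^sub>M borel_lebesgue q)) (unit_cube q \<times> pi_cube q)"


section \<open>Toeplitz and diagonal sampling matrices\<close>

definition fourier_coeff ::
    "nat \<Rightarrow> nat \<Rightarrow> nat \<Rightarrow> (point \<Rightarrow> complex mat) \<Rightarrow> int list \<Rightarrow> complex mat" where
  "fourier_coeff q s t f k = mat s t (\<lambda>ij.
     1 / complex_of_real ((2 * pi) ^ q) *
     (\<integral>\<theta>. f \<theta> $$ ij * exp (- \<i> * complex_of_real (\<Sum>r<q. real_of_int (k ! r) * \<theta> r)) \<partial>pi_measure q))"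

definition toeplitz_mat ::
    "nat list \<Rightarrow> nat \<Rightarrow> nat \<Rightarrow> (point \<Rightarrow> complex mat) \<Rightarrow> complex mat" where
  "toeplitz_mat m s t f = multi_block_mat m s t
     (\<lambda>i j. fourier_coeff (length m) s t f (map2 (\<lambda>a b. int a - int b) i j))"

definition diag_sampling_mat ::
    "nat list \<Rightarrow> nat \<Rightarrow> nat \<Rightarrow> (point \<Rightarrow> complex mat) \<Rightarrow> complex mat" where
  "diag_sampling_mat m s t a = multi_block_mat m s t
     (\<lambda>i j. if i = j then a (\<lambda>r\<in>{..<length m}. real (i ! r) / real (m ! r)) else 0\<^sub>m s t)"


section \<open>Approximating classes of sequences and GLT sequences\<close>

text \<open>All sequences are indexed by the positive integers, or by an infinite set \<open>I\<close> of them; values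
  at other indices are irrelevant.\<close>

definition matrix_seq ::
    "nat set \<Rightarrow> (nat \<Rightarrow> nat) \<Rightarrow> (nat \<Rightarrow> nat) \<Rightarrow> (nat \<Rightarrow> complex mat) \<Rightarrow> bool" where
  "matrix_seq I d e A \<longleftrightarrow>
     infinite I \<and> I \<subseteq> {1..} \<and> (\<forall>n\<in>I. A n \<in> carrier_mat (d n) (e n)) \<and>
     filterlim d at_top (along I) \<and> filterlim e at_top (along I)"

text \<open>In \<open>acs I d e B A\<close>, the matrix \<open>B m n\<close> is the one usually written \<open>B\<^sub>n\<^sub>,\<^sub>m\<close>.\<close>

definition acs :: "nat set \<Rightarrow> (nat \<Rightarrow> nat) \<Rightarrow> (nat \<Rightarrow> nat) \<Rightarrow>
    (nat \<Rightarrow> nat \<Rightarrow> complex mat) \<Rightarrow> (nat \<Rightarrow> complex mat) \<Rightarrow> bool" where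
  "acs I d e B A \<longleftrightarrow>
     matrix_seq I d e A \<and> (\<forall>m\<ge>1. matrix_seq I d e (B m)) \<and>
     (\<exists>(n0 :: nat \<Rightarrow> nat) (c :: nat \<Rightarrow> real) (\<omega> :: nat \<Rightarrow> real).
        c \<longlonglongrightarrow> 0 \<and> \<omega> \<longlonglongrightarrow> 0 \<and>
        (\<forall>m\<ge>1. \<forall>n\<in>I. n0 m \<le> n \<longrightarrow>
           (\<exists>R\<in>carrier_mat (d n) (e n). \<exists>E\<in>carrier_mat (d n) (e n).
              A n = B m n + R + E \<and>
              real (mat_rank R) \<le> c m * real (min (d n) (e n)) \<and>
              spectral_norm E \<le> \<omega> m)))"

text \<open>\<open>GLT I q m s t X \<kappa>\<close> states that \<open>{X n}\<close>, \<open>n \<in> I\<close>, is a \<open>q\<close>-level GLT sequence with block size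
  \<open>s \<times> t\<close> and symbol \<open>\<kappa>\<close>, with respect to the sequence of \<open>q\<close>-indices \<open>m\<close>. The index of the
  approximating class is called \<open>k\<close>, and \<open>l = 1, \<dots>, L k\<close> numbers the summands. The sizes of
  the \<open>X n\<close> are part of the condition \<^const>\<open>acs\<close>.\<close>

definition GLT :: "nat set \<Rightarrow> nat \<Rightarrow> (nat \<Rightarrow> nat list) \<Rightarrow> nat \<Rightarrow> nat \<Rightarrow>
    (nat \<Rightarrow> complex mat) \<Rightarrow> (point \<Rightarrow> point \<Rightarrow> complex mat) \<Rightarrow> bool" where
  "GLT I q m s t X \<kappa> \<longleftrightarrow>
     multi_index_seq I q m \<and> 0 < s \<and> 0 < t \<and>
     (\<forall>x\<in>unit_cube q. \<forall>\<theta>\<in>pi_cube q. \<kappa> x \<theta> \<in> carrier_mat s t) \<and>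
     (\<forall>i<s. \<forall>j<t. (\<lambda>(x, \<theta>). \<kappa> x \<theta> $$ (i, j)) \<in> borel_measurable (symbol_measure q)) \<and>
     (\<exists>(L :: nat \<Rightarrow> nat) (a :: nat \<Rightarrow> nat \<Rightarrow> point \<Rightarrow> complex) (f :: nat \<Rightarrow> nat \<Rightarrow> point \<Rightarrow> complex mat).
        (\<forall>k\<ge>1. \<forall>l\<in>{1..L k}.
           (AE x in unit_measure q. continuous (at x within unit_cube q) (a l k)) \<and>
           (\<forall>\<theta>\<in>pi_cube q. f l k \<theta> \<in> carrier_mat s t) \<and>
           (\<forall>i<s. \<forall>j<t. integrable (pi_measure q) (\<lambda>\<theta>. f l k \<theta> $$ (i, j)))) \<and>
        (AE (x, \<theta>) in symbol_measure q. \<forall>i<s. \<forall>j<t.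
           (\<lambda>k. \<Sum>l=1..L k. a l k x * f l k \<theta> $$ (i, j)) \<longlonglongrightarrow> \<kappa> x \<theta> $$ (i, j)) \<and>
        acs I (\<lambda>n. prod_list (m n) * s) (\<lambda>n. prod_list (m n) * t)
          (\<lambda>k n. mat_sum (prod_list (m n) * s) (prod_list (m n) * t)
             (\<lambda>l. diag_sampling_mat (m n) s s (\<lambda>x. a l k x \<cdot>\<^sub>m 1\<^sub>m s) * toeplitz_mat (m n) s t (f l k))
             {1..L k})
          X)"


section \<open>Decomposition of points\<close>

text \<open>The \<open>i\<close>th component \<open>x\<^sub>i \<in> \<real>\<^bsup>q i\<^esup>\<close>, \<open>i = 1, 2, \<dots>\<close>, of \<open>x = (x\<^sub>1, x\<^sub>2, \<dots>)\<close>.\<close>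

definition point_part :: "(nat \<Rightarrow> nat) \<Rightarrow> nat \<Rightarrow> point \<Rightarrow> point" where
  "point_part q i x = (\<lambda>r\<in>{..<q i}. x ((\<Sum>j=1..<i. q j) + r))"

end

theory Submission
  imports Defs
begin

text \<open>A product approximation of \<open>A \<otimes> B\<close> cannot be compared with \<open>A \<otimes> B\<close> directly, because the
  norms of the factors are unbounded. They are bounded up to a small rank, however: the sequences
  \<open>T\<^sub>n(f)\<close>, \<open>f \<in> L\<^sup>1\<close>, and \<open>D\<^sub>n(a)\<close>, \<open>a\<close> continuous a.e., are sparsely unbounded, this property passes to
  sums, to products with \<open>D\<^sub>n(a)\<close> and to limits of approximating classes, and hence holds for all GLT sequences.
  Combined with \<open>A \<otimes> B - A' \<otimes> B' = (A - A') \<otimes> B + A \<otimes> (B - B') - (A - A') \<otimes> (B - B')\<close> it shows that the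
  products of approximating classes are approximating classes. After conjugation by \<open>\<Pi>\<close> the product of
  \<open>D(a\<^sub>1) T(f\<^sub>1)\<close> and \<open>D(a\<^sub>2) T(f\<^sub>2)\<close> is again of the form \<open>D(a) T(f)\<close>, with \<open>a(x\<^sub>1, x\<^sub>2) = a\<^sub>1(x\<^sub>1) a\<^sub>2(x\<^sub>2)\<close> and
  \<open>f(\<theta>\<^sub>1, \<theta>\<^sub>2) = f\<^sub>1(\<theta>\<^sub>1) \<otimes> f\<^sub>2(\<theta>\<^sub>2)\<close>, which gives the case of two factors; the general case is an induction.\<close>


section \<open>Mixed radix indices and Kronecker products\<close>

text \<open>The hard point is sparse unboundedness of T_n(f) for f merely in L^1, where no norm
  bound is available. The quadratic form of the Toeplitz matrix of |f| has trace of order N(n) times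
  the L^1 norm of f, so by a Chebyshev count only a small fraction of orthonormal directions can
  have energy above a level t; projecting them away on both sides leaves a matrix of norm at most t.
  Singular values never enter: a splitting into low rank plus bounded takes their place throughout.
  Rank budgets are measured as proportions of the smaller dimension. A part of rank r tensored with
  an arbitrary matrix has rank at most r times the smaller dimension of that matrix, whatever its
  norm; so proportions add under Kronecker products while norms multiply. The domains carry
  completed measures, and the completion of a product is not the product of the completions.
  Splitting a point into two parts is therefore treated by maps that pull null sets back to null
  sets, and Fubini is applied to Borel versions of the symbols.\<close>

text \<open>In \<open>radix N x l\<close> the list \<open>l\<close> names the digits from the most significant to the least; reordering
  \<open>l\<close> describes a permutation of tensor factors.\<close>

definition radix :: "(nat \<Rightarrow> nat) \<Rightarrow> (nat \<Rightarrow> nat) \<Rightarrow> nat list \<Rightarrow> nat" where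
  "radix N x l = foldl (\<lambda>a k. a * N k + x k) 0 l"

lemma radix_Nil [simp]: "radix N x [] = 0"
  by (simp add: radix_def)

lemma radix_snoc [simp]: "radix N x (l @ [k]) = radix N x l * N k + x k"
  by (simp add: radix_def)

lemma radix_append: "radix N x (l @ r) = radix N x l * (\<Prod>k\<leftarrow>r. N k) + radix N x r"
  by (induction r rule: rev_induct) (simp_all add: append_assoc[symmetric] algebra_simps del: append_assoc)

lemma radix_Cons: "radix N x (k # r) = x k * (\<Prod>k\<leftarrow>r. N k) + radix N x r"
  using radix_append[of N x "[k]" r] by (simp add: radix_def)

lemma digit_less: "\<lbrakk>(i::nat) < n; j < m\<rbrakk> \<Longrightarrow> i * m + j < n * m"
proof -
  assume "i < n" "j < m"
  then have "i * m + j < Suc i * m" by simp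
  also have "\<dots> \<le> n * m" using \<open>i < n\<close> by (intro mult_le_mono1) simp
  finally show ?thesis .
qed

lemma radix_less: "(\<And>k. k \<in> set l \<Longrightarrow> x k < N k) \<Longrightarrow> radix N x l < (\<Prod>k\<leftarrow>l. N k)"
  by (induction l rule: rev_induct) (auto intro!: digit_less)

lemma digit_divmod [simp]: "(j::nat) < m \<Longrightarrow> (i * m + j) div m = i" "(j::nat) < m \<Longrightarrow> (i * m + j) mod m = j"
  by simp_all

lemma digit_eq_iff: "\<lbrakk>j < m; j' < m\<rbrakk> \<Longrightarrow> (i::nat) * m + j = i' * m + j' \<longleftrightarrow> i = i' \<and> j = j'"
  by (metis digit_divmod)

lemma radix_eq_iff:
  "\<lbrakk>\<And>k. k \<in> set l \<Longrightarrow> x k < N k; \<And>k. k \<in> set l \<Longrightarrow> y k < N k\<rbrakk> \<Longrightarrow>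
   radix N x l = radix N y l \<longleftrightarrow> (\<forall>k\<in>set l. x k = y k)"
  by (induction l rule: rev_induct) (auto simp: digit_eq_iff)

lemma radix_cong: "\<lbrakk>\<And>k. k \<in> set l \<Longrightarrow> N k = N' k; \<And>k. k \<in> set l \<Longrightarrow> x k = x' k\<rbrakk> \<Longrightarrow> radix N x l = radix N' x' l"
  by (induction l rule: rev_induct) auto

text \<open>The last digit is the remainder, and the quotient is covered by the induction.
  Distinctness lets the new digit be written into \<open>x\<close> without disturbing the digits
  already found.\<close>

lemma radix_surj:
  assumes "i < (\<Prod>k\<leftarrow>l. N k)" "distinct l"
  shows "\<exists>x. (\<forall>k\<in>set l. x k < N k) \<and> i = radix N x l"
  using assms
proof (induction l arbitrary: i rule: rev_induct)
  case (snoc k l)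
  then have pos: "0 < N k" by (auto intro: Nat.gr0I)
  have "i div N k < (\<Prod>k\<leftarrow>l. N k)"
    using snoc.prems(1) pos by (simp add: less_mult_imp_div_less)
  then obtain x where x: "\<forall>k\<in>set l. x k < N k" "i div N k = radix N x l"
    using snoc by auto
  have "radix N (x(k := i mod N k)) l = radix N x l"
    using snoc.prems by (intro radix_cong) auto
  then have "i = radix N (x(k := i mod N k)) (l @ [k])"
    unfolding radix_snoc by (simp flip: x(2))
  moreover have "\<forall>j\<in>set (l @ [k]). (x(k := i mod N k)) j < N j"
    using x pos by auto
  ultimately show ?case by blast
qed auto

lemma radix_map: "radix N x (map f l) = radix (N \<circ> f) (x \<circ> f) l"
  by (induction l rule: rev_induct) auto

text \<open>The names k and n + k are neighbours in the order that defines \<open>perm_Pi\<close>,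
  so each such pair merges into one digit of base \<open>N k * N (n + k)\<close>. For \<Pi> the
  merged digit is a row or column index of the kth Kronecker factor.\<close>

lemma radix_concat_pairs:
  "radix N x (concat (map (\<lambda>i. [i, n + i]) l)) = radix (\<lambda>k. N k * N (n + k)) (\<lambda>k. x k * N (n + k) + x (n + k)) l"
proof (induction l rule: rev_induct)
  case (snoc k l)
  have "concat (map (\<lambda>i. [i, n + i]) (l @ [k])) = (concat (map (\<lambda>i. [i, n + i]) l) @ [k]) @ [n + k]"
    by simp
  then show ?case by (simp only: radix_snoc snoc.IH) (simp add: algebra_simps)
qed simp

section \<open>Entries of Kronecker products in digit form\<close>

lemma dim_kron [simp]:
  "dim_row (kron X Y) = dim_row X * dim_row Y" "dim_col (kron X Y) = dim_col X * dim_col Y"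
  by (simp_all add: kron_def)

lemma kron_index:
  assumes "i < dim_row X" "i' < dim_row Y" "j < dim_col X" "j' < dim_col Y"
  shows "kron X Y $$ (i * dim_row Y + i', j * dim_col Y + j') = X $$ (i, j) * Y $$ (i', j')"
  using assms by (simp add: kron_def digit_less)

lemma kron_index_divmod:
  assumes "i < dim_row X * dim_row Y" "j < dim_col X * dim_col Y"
  shows "kron X Y $$ (i, j) = X $$ (i div dim_row Y, j div dim_col Y) * Y $$ (i mod dim_row Y, j mod dim_col Y)"
  using assms by (simp add: kron_def)

lemma digit_obtain:
  assumes "(i::nat) < a * b"
  obtains i1 i2 where "i1 < a" "i2 < b" "i = i1 * b + i2"
proof
  have "0 < b" using assms by (auto intro: Nat.gr0I)
  then show "i mod b < b" by simp
  show "i div b < a" using assms by (simp add: less_mult_imp_div_less)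
qed simp

text \<open>The two groupings of the same three digits are what the two bracketings of a triple
  Kronecker product read off.\<close>

lemma digit_obtain3:
  assumes "(i::nat) < a * (b * c)"
  obtains i1 i2 i3 where "i1 < a" "i2 < b" "i3 < c" "i = i1 * (b * c) + (i2 * c + i3)" "i = (i1 * b + i2) * c + i3"
proof -
  obtain i1 r where 1: "i1 < a" "r < b * c" "i = i1 * (b * c) + r"
    using digit_obtain[OF assms] .
  obtain i2 i3 where 2: "i2 < b" "i3 < c" "r = i2 * c + i3"
    using digit_obtain[OF 1(2)] .
  show thesis
    by (rule that[OF 1(1) 2(1,2)]) (simp_all add: 1 2 algebra_simps)
qed

lemma kron_assoc: "kron (kron X Y) Z = kron X (kron Y Z)"
proof (rule eq_matI)
  fix i j assume "i < dim_row (kron X (kron Y Z))" "j < dim_col (kron X (kron Y Z))"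
  then have ij: "i < dim_row X * (dim_row Y * dim_row Z)" "j < dim_col X * (dim_col Y * dim_col Z)"
    by auto
  obtain i1 i2 i3 where i: "i1 < dim_row X" "i2 < dim_row Y" "i3 < dim_row Z"
    "i = i1 * (dim_row Y * dim_row Z) + (i2 * dim_row Z + i3)" "i = (i1 * dim_row Y + i2) * dim_row Z + i3"
    using digit_obtain3[OF ij(1)] by metis
  obtain j1 j2 j3 where j: "j1 < dim_col X" "j2 < dim_col Y" "j3 < dim_col Z"
    "j = j1 * (dim_col Y * dim_col Z) + (j2 * dim_col Z + j3)" "j = (j1 * dim_col Y + j2) * dim_col Z + j3"
    using digit_obtain3[OF ij(2)] by metis
  have "kron (kron X Y) Z $$ (i, j) = X $$ (i1, j1) * Y $$ (i2, j2) * Z $$ (i3, j3)"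
    unfolding i(5) j(5) using i j
    by (subst kron_index) (simp_all add: kron_index digit_less)
  moreover have "kron X (kron Y Z) $$ (i, j) = X $$ (i1, j1) * (Y $$ (i2, j2) * Z $$ (i3, j3))"
    unfolding i(4) j(4) using i j kron_index[of i1 X "i2 * dim_row Z + i3" "kron Y Z" j1 "j2 * dim_col Z + j3"]
    by (simp add: kron_index digit_less)
  ultimately show "kron (kron X Y) Z $$ (i, j) = kron X (kron Y Z) $$ (i, j)"
    by simp
qed (auto simp: mult.assoc)

lemma kron_one_right [simp]: "kron X (1\<^sub>m 1) = X"
  by (rule eq_matI) (auto simp: kron_index_divmod)

lemma kron_one_left [simp]: "kron (1\<^sub>m 1) X = X"
  by (rule eq_matI) (auto simp: kron_index_divmod)

lemma kron_list_Nil [simp]: "kron_list [] = 1\<^sub>m 1"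
  by (simp add: kron_list_def)

lemma kron_list_Cons: "kron_list (X # Xs) = kron X (kron_list Xs)"
  by (simp add: kron_list_def)

lemma kron_list_snoc: "kron_list (Xs @ [Y]) = kron (kron_list Xs) Y"
  by (induction Xs) (simp_all only: kron_list_Cons kron_list_Nil append_Nil append_Cons kron_assoc kron_one_left kron_one_right)

lemma dim_kron_list [simp]:
  "dim_row (kron_list Xs) = (\<Prod>X\<leftarrow>Xs. dim_row X)" "dim_col (kron_list Xs) = (\<Prod>X\<leftarrow>Xs. dim_col X)"
  by (induction Xs) (auto simp: kron_list_Cons)

lemma kron_list_index:
  assumes "\<And>k. k \<in> set l \<Longrightarrow> x k < dim_row (X k)" "\<And>k. k \<in> set l \<Longrightarrow> y k < dim_col (X k)"
  shows "kron_list (map X l) $$ (radix (dim_row \<circ> X) x l, radix (dim_col \<circ> X) y l) = (\<Prod>k\<leftarrow>l. X k $$ (x k, y k))"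
  using assms
proof (induction l rule: rev_induct)
  case (snoc k l)
  have 1: "radix (dim_row \<circ> X) x l < dim_row (kron_list (map X l))"
       "radix (dim_col \<circ> X) y l < dim_col (kron_list (map X l))"
    using radix_less[of l x "dim_row \<circ> X"] radix_less[of l y "dim_col \<circ> X"] snoc.prems by (simp_all add: comp_def)
  have 2: "x k < dim_row (X k)" "y k < dim_col (X k)" using snoc.prems by auto
  show ?case
    using kron_index[OF 1(1) 2(1) 1(2) 2(2)] snoc by (simp add: kron_list_snoc comp_def)
qed simp

section \<open>The permutation matrices as reorderings of digits\<close>

lemma perm_P_dim [simp]: "dim_row (perm_P a b) = a * b" "dim_col (perm_P a b) = a * b"
  by (simp_all add: perm_P_def mat_sum_def)

lemma unit_col_index: "r < n \<Longrightarrow> c < 1 \<Longrightarrow> unit_col n i $$ (r, c) = of_bool (r = i)"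
  by (auto simp: unit_col_def mat_of_cols_def unit_vec_def)

lemma unit_col_dim [simp]: "dim_row (unit_col n i) = n" "dim_col (unit_col n i) = 1"
  by (simp_all add: unit_col_def)

text \<open>The kth summand pins the leading row digit and the trailing column digit, both of base
  \<open>n2\<close>, to k, while the identity between them matches the digits of base
  \<open>n1\<close>. What survives the summation is the exchange of the two digits.\<close>

lemma perm_P_index:
  assumes "i1 < n1" "i2 < n2" "j1 < n1" "j2 < n2"
  shows "perm_P n1 n2 $$ (i2 * n1 + i1, j1 * n2 + j2) = of_bool (i1 = j1 \<and> i2 = j2)"
proof -
  have r: "i2 * n1 + i1 < n1 * n2" and c: "j1 * n2 + j2 < n1 * n2"
    using assms by (metis digit_less mult.commute)+
  have k: "kron (kron (unit_col n2 k) (1\<^sub>m n1)) (transpose_mat (unit_col n2 k)) $$ (i2 * n1 + i1, j1 * n2 + j2)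
      = of_bool (i2 = k \<and> i1 = j1 \<and> j2 = k)" if "k < n2" for k
    using assms r c that
    by (simp add: kron_index_divmod unit_col_index mult.commute del: One_nat_def)
  show ?thesis
    using r c assms by (simp add: perm_P_def mat_sum_def k if_distrib flip: of_bool_conj)
      (auto simp: of_bool_def if_distrib cong: if_cong)
qed


lemma radix_upt_Suc: "radix N x [1..<Suc (Suc n)] = radix N x [1..<Suc n] * N (Suc n) + x (Suc n)"
  by (metis radix_snoc upt_Suc_append le_numeral_extra(4) One_nat_def Suc_le_mono le0)

lemma prod_list_distinct_eq:
  fixes N :: "'a \<Rightarrow> nat"
  shows "distinct l \<Longrightarrow> (\<Prod>k\<leftarrow>l. N k) = prod N (set l)"
  by (simp add: prod.distinct_set_conv_list)

lemma perm_Gamma_aux_step: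
  assumes "Suc (Suc (Suc k)) \<notin> set l"
  shows "perm_Gamma_aux (Suc (Suc (Suc k))) ns (l @ Suc (Suc (Suc k)) # r) =
    kron (1\<^sub>m (\<Prod>j\<leftarrow>l. ns ! (j - 1))) (perm_P (\<Prod>j\<leftarrow>r. ns ! (j - 1)) (ns ! (Suc (Suc (Suc k)) - 1)))
         * kron (perm_Gamma_aux (Suc (Suc k)) ns (l @ r)) (1\<^sub>m (ns ! (Suc (Suc (Suc k)) - 1)))"
proof -
  have "takeWhile (\<lambda>j. j \<noteq> Suc (Suc (Suc k))) (l @ Suc (Suc (Suc k)) # r) = l"
    "dropWhile (\<lambda>j. j \<noteq> Suc (Suc (Suc k))) (l @ Suc (Suc (Suc k)) # r) = Suc (Suc (Suc k)) # r"
    using assms by (auto simp: takeWhile_eq_all_conv takeWhile_append dropWhile_append)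
  then show ?thesis by (simp only: perm_Gamma_aux.simps Let_def list.sel)
qed

lemma mult_mat_index:
  assumes "A \<in> carrier_mat a b" "B \<in> carrier_mat b c" "i < a" "j < c"
  shows "(A * B) $$ (i, j) = (\<Sum>k<b. A $$ (i, k) * B $$ (k, j))"
  using assms by (simp add: scalar_prod_def atLeast0LessThan)

text \<open>Rows are read with their digits in the order \<sigma>, columns with their digits in the
  natural order, and a 1 sits where the digits agree. In these terms the recursion is an insertion:
  the factor built from \<tau> sorts all digits except the last name d, and the factor with
  \<open>perm_P\<close> carries the digit of d across the block \<open>r\<close> to its
  right.\<close>

lemma perm_Gamma_aux_index:
  fixes ns :: "nat list"
  assumes "distinct \<sigma>" "set \<sigma> = {1..d}" "0 < d"
  defines "N \<equiv> \<lambda>k. ns ! (k - 1)"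
  defines "P \<equiv> \<Prod>k\<leftarrow>[1..<Suc d]. N k"
  shows "perm_Gamma_aux d ns \<sigma> \<in> carrier_mat P P \<and>
    (\<forall>x. (\<forall>k\<in>{1..d}. x k < N k) \<longrightarrow> (\<forall>j<P.
       perm_Gamma_aux d ns \<sigma> $$ (radix N x \<sigma>, j) = of_bool (j = radix N x [1..<Suc d])))"
  using assms(1-3) unfolding P_def
proof (induction d arbitrary: \<sigma>)
  case 0
  then show ?case by simp
next
  case (Suc d')
  consider "d' = 0" | "d' = Suc 0" | k where "d' = Suc (Suc k)"
    by (metis not0_implies_Suc)
  then show ?case
  proof cases
    case 1
    then have "\<sigma> = [1]" using Suc.prems
      by (cases \<sigma>; cases "tl \<sigma>") auto
    then show ?thesis using 1 by (auto simp: N_def radix_def)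
  next
    case 2
    have u: "[1..<Suc (Suc d')] = [1, 2]" "{1..Suc d'} = {1, 2}" using 2 by auto
    have g: "perm_Gamma_aux (Suc d') ns \<sigma> = (if \<sigma> = [2, 1] then perm_P (N 1) (N 2) else 1\<^sub>m (N 1 * N 2))" for \<sigma>
      using 2 by (simp add: N_def numeral_2_eq_2)
    have e: "radix N x [1, 2] = x 1 * N 2 + x 2" "radix N x [2, 1] = x 2 * N 1 + x 1" for x
      by (simp_all add: radix_def)
    have len: "length \<sigma> = 2" using Suc.prems distinct_card[of \<sigma>] unfolding u by simp
    then obtain a b where ab: "\<sigma> = [a, b]"
      by (auto simp: length_Suc_conv numeral_2_eq_2)
    then have "{a, b} = {1, 2}" "a \<noteq> b"
      using Suc.prems(1,2)[unfolded u ab] by simp_all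
    then consider "\<sigma> = [1, 2]" | "\<sigma> = [2, 1]"
      using ab by (metis doubleton_eq_iff)
    then show ?thesis
    proof cases
      case 1
      show ?thesis unfolding u 1 e g
      proof (intro conjI allI impI)
        fix x j assume "\<forall>k\<in>{1, 2}. x k < N k" and j: "j < (\<Prod>k\<leftarrow>[1, 2]. N k)"
        then have "x 1 * N 2 + x 2 < N 1 * N 2" by (intro digit_less) auto
        then show "(if [1, 2] = [2::nat, 1] then perm_P (N 1) (N 2) else 1\<^sub>m (N 1 * N 2)) $$ (x 1 * N 2 + x 2, j)
            = of_bool (j = x 1 * N 2 + x 2)" using j by (auto simp del: One_nat_def)
      qed (auto simp del: One_nat_def)
    next
      case s: 2
      have "perm_P (N 1) (N 2) $$ (x 2 * N 1 + x 1, j) = of_bool (j = x 1 * N 2 + x 2)"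
        if x: "x 1 < N 1" "x 2 < N 2" "j < N 1 * N 2" for x j
      proof -
        obtain j1 j2 where j: "j1 < N 1" "j2 < N 2" "j = j1 * N 2 + j2"
          using digit_obtain[OF x(3)] .
        show ?thesis
          unfolding j(3) perm_P_index[OF x(1,2) j(1,2)] digit_eq_iff[OF j(2) x(2)] by (simp add: eq_commute)
      qed
      note row = this
      show ?thesis unfolding u s e g
      proof (intro conjI allI impI)
        fix x j assume x: "\<forall>k\<in>{1, 2}. x k < N k" and j: "j < (\<Prod>k\<leftarrow>[1, 2]. N k)"
        show "(if [2, 1] = [2::nat, 1] then perm_P (N 1) (N 2) else 1\<^sub>m (N 1 * N 2)) $$ (x 2 * N 1 + x 1, j)
            = of_bool (j = x 1 * N 2 + x 2)" using row[of x j] x j by simp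
      qed (auto simp del: One_nat_def)
    qed
  next
    case 3
    define d where "d = Suc (Suc (Suc k))"
    have "d \<in> set \<sigma>" using Suc.prems 3 by (simp add: d_def)
    then obtain l r where \<sigma>: "\<sigma> = l @ d # r" by (meson split_list)
    have lr: "d \<notin> set l" "distinct (l @ r)" "set (l @ r) = {1..d'}"
    proof -
      have "set (l @ r) = set \<sigma> - {d}" using Suc.prems(1) \<sigma> by auto
      also have "\<dots> = {1..Suc d'} - {Suc d'}" unfolding Suc.prems(2) d_def 3 ..
      also have "\<dots> = {1..d'}" by auto
      finally show "set (l @ r) = {1..d'}" .
    qed (use Suc.prems(1) \<sigma> in simp_all)
    define L R n where "L = (\<Prod>j\<leftarrow>l. N j)" and "R = (\<Prod>j\<leftarrow>r. N j)" and "n = N d"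
    define Q where "Q = (\<Prod>k\<leftarrow>[1..<Suc d']. N k)"
    have Q: "Q = L * R"
      using prod_list_distinct_eq[OF lr(2), of N] prod_list_distinct_eq[of "[1..<Suc d']" N] lr(3)
      by (simp add: Q_def L_def R_def atLeastLessThanSuc_atLeastAtMost del: upt_Suc)
    define G where "G = perm_Gamma_aux (Suc (Suc k)) ns (l @ r)"
    have G: "G \<in> carrier_mat Q Q"
      "\<And>x j. \<forall>k\<in>{1..d'}. x k < N k \<Longrightarrow> j < Q \<Longrightarrow> G $$ (radix N x (l @ r), j) = of_bool (j = radix N x [1..<Suc d'])"
      using Suc.IH[OF lr(2,3), folded Q_def] unfolding G_def 3[symmetric] by (simp_all add: 3)
    have eq: "perm_Gamma_aux (Suc d') ns \<sigma> = kron (1\<^sub>m L) (perm_P R n) * kron G (1\<^sub>m n)"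
      using perm_Gamma_aux_step[of k l ns r] lr(1) unfolding \<sigma> G_def L_def R_def n_def N_def 3 d_def by simp
    have K: "kron (1\<^sub>m L) (perm_P R n) \<in> carrier_mat (Q * n) (Q * n)" "kron G (1\<^sub>m n) \<in> carrier_mat (Q * n) (Q * n)"
      using G by (auto simp: Q)
    have dd: "d = Suc d'" unfolding d_def 3 ..
    have P: "(\<Prod>k\<leftarrow>[1..<Suc (Suc d')]. N k) = Q * n"
      unfolding Q_def n_def dd by simp
    have "perm_Gamma_aux (Suc d') ns \<sigma> $$ (radix N x \<sigma>, j) = of_bool (j = radix N x [1..<Suc (Suc d')])"
      if x: "\<forall>k\<in>{1..Suc d'}. x k < N k" and j: "j < Q * n" for x j
    proof -
      have "x k < N k" if "k \<in> set (l @ r)" for k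
        using x that unfolding lr(3) by auto
      then have b: "radix N x l < L" "radix N x r < R" "x d < n"
        using x unfolding L_def R_def n_def d_def 3 by (auto intro!: radix_less)
      have e: "radix N x \<sigma> = radix N x l * (R * n) + (x d * R + radix N x r)"
        unfolding \<sigma> radix_append radix_Cons R_def n_def by simp
      have el: "radix N x (l @ r) = radix N x l * R + radix N x r"
        unfolding radix_append R_def by simp
      \<comment> \<open>The left factor only moves the digit of \<open>d\<close> across
        \<open>r\<close>: its row with digits l, d, r has its single 1 in the column with digits l,
        r, d.\<close>
      have "kron (1\<^sub>m L) (perm_P R n) $$ (radix N x \<sigma>, c) = of_bool (c = radix N x (l @ r) * n + x d)"
        if c: "c < Q * n" for c
      proof -
        have "c < L * (R * n)" using c by (simp add: Q mult.assoc)
        then obtain c1 c2 c3 where c: "c1 < L" "c2 < R" "c3 < n" "c = c1 * (R * n) + (c2 * n + c3)"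
          using digit_obtain3[of c L R n] by metis
        have c': "c = (c1 * R + c2) * n + c3" using c by (simp add: algebra_simps)
        have cc: "(c = radix N x (l @ r) * n + x d) = (c1 = radix N x l \<and> c2 = radix N x r \<and> c3 = x d)"
          unfolding el c' digit_eq_iff[OF c(3) b(3)] digit_eq_iff[OF c(2) b(2)] by simp
        have "x d * R + radix N x r < R * n" "c2 * n + c3 < R * n"
          using digit_less[OF b(3,2)] digit_less[OF c(2,3)] by (simp_all add: mult.commute)
        then have "kron (1\<^sub>m L) (perm_P R n) $$ (radix N x l * (R * n) + (x d * R + radix N x r), c1 * (R * n) + (c2 * n + c3))
          = of_bool (radix N x l = c1) * of_bool (radix N x r = c2 \<and> x d = c3)"
          using kron_index[of "radix N x l" "1\<^sub>m L" "x d * R + radix N x r" "perm_P R n" c1 "c2 * n + c3"] b c(1-3)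
            perm_P_index[OF b(2,3) c(2,3)]
          by simp
        then show ?thesis unfolding e cc unfolding c(4) by auto
      qed
      note row = this
      have rl: "radix N x \<sigma> < Q * n"
        using digit_less[OF b(1), of "x d * R + radix N x r" "R * n"] digit_less[OF b(3,2)]
        unfolding e Q by (simp add: ac_simps)
      have "perm_Gamma_aux (Suc d') ns \<sigma> $$ (radix N x \<sigma>, j) =
          (\<Sum>c<Q * n. of_bool (c = radix N x (l @ r) * n + x d) * kron G (1\<^sub>m n) $$ (c, j))"
        unfolding eq mult_mat_index[OF K rl j] by (intro sum.cong refl) (simp add: row)
      also have "\<dots> = kron G (1\<^sub>m n) $$ (radix N x (l @ r) * n + x d, j)"
      proof -
        have "radix N x (l @ r) * n + x d \<in> {..<Q * n}"
          using digit_less[OF digit_less[OF b(1,2)] b(3)] by (simp add: Q el)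
        then show ?thesis
          by (intro trans[OF sum.remove[OF finite_lessThan]]) (auto intro!: sum.neutral)
      qed
      \<comment> \<open>The right factor sorts the digits of \<open>l @ r\<close> by the induction
        hypothesis and leaves the trailing digit of \<open>d\<close> in place.\<close>
      also have "\<dots> = of_bool (j = radix N x [1..<Suc (Suc d')])"
      proof -
        obtain j1 j2 where j: "j1 < Q" "j2 < n" "j = j1 * n + j2"
          using digit_obtain[OF j] .
        have x': "\<forall>k\<in>{1..d'}. x k < N k" using x by simp
        have lrQ: "radix N x (l @ r) < Q" unfolding el Q using b by (simp add: digit_less)
        have "kron G (1\<^sub>m n) $$ (radix N x (l @ r) * n + x d, j) = of_bool (j1 = radix N x [1..<Suc d']) * of_bool (j2 = x d)"
        proof -
          have one: "1\<^sub>m n $$ (x d, j2) = (of_bool (j2 = x d) :: complex)" using b(3) j(2) by auto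
          show ?thesis
            using kron_index[of "radix N x (l @ r)" G "x d" "1\<^sub>m n" j1 j2, unfolded carrier_matD[OF G(1)] index_one_mat(2,3),
                OF lrQ b(3) j(1,2)]
            unfolding one G(2)[OF x' j(1)] j(3) .
        qed
        moreover have "radix N x [1..<Suc (Suc d')] = radix N x [1..<Suc d'] * n + x d"
          unfolding radix_upt_Suc n_def dd ..
        ultimately show ?thesis unfolding j(3) using digit_eq_iff[OF j(2) b(3)] by (simp del: upt_Suc)
      qed
      finally show ?thesis .
    qed
    then show ?thesis unfolding P eq using mult_carrier_mat[OF K] by blast
  qed
qed

text \<open>The case of \<Gamma> with sizes N_1, ..., N_d, s_1, ..., s_d and the interleaved order.
  Rows are grouped by Kronecker factor, as pairs of a grid digit and a block digit; columns carry
  all grid digits before all block digits.\<close>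

lemma perm_Pi_index:
  fixes N s :: "nat \<Rightarrow> nat"
  assumes "0 < d"
  defines "ks \<equiv> [1..<Suc d]"
  defines "n \<equiv> (\<Prod>k\<leftarrow>ks. N k) * (\<Prod>k\<leftarrow>ks. s k)"
  shows perm_Pi_carrier: "perm_Pi (map N ks) (map s ks) \<in> carrier_mat n n"
    and perm_Pi_row: "\<lbrakk>\<And>k. k \<in> set ks \<Longrightarrow> i k < N k; \<And>k. k \<in> set ks \<Longrightarrow> \<alpha> k < s k; j < n\<rbrakk> \<Longrightarrow>
       perm_Pi (map N ks) (map s ks) $$ (radix (\<lambda>k. N k * s k) (\<lambda>k. i k * s k + \<alpha> k) ks, j) =
       of_bool (j = radix N i ks * (\<Prod>k\<leftarrow>ks. s k) + radix s \<alpha> ks)"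
proof -
  define ns where "ns = map N ks @ map s ks"
  define \<sigma> where "\<sigma> = concat (map (\<lambda>i. [i, d + i]) ks)"
  define N' where "N' = (\<lambda>k. ns ! (k - 1))"
  have set_ks: "set ks = {1..d}" and dist_ks: "distinct ks" and len: "length ks = d"
    by (auto simp: ks_def)
  have N'1: "N' k = N k" if "k \<in> set ks" for k
    using that by (auto simp: N'_def ns_def ks_def nth_append simp del: upt_Suc)
  have N'2: "N' (d + k) = s k" if "k \<in> set ks" for k
  proof -
    have k: "1 \<le> k" "k \<le> d" using that by (simp_all add: set_ks)
    have kk: "ks ! (k - 1) = k" unfolding ks_def using k by (subst nth_upt) simp_all
    have "N' (d + k) = (map N ks @ map s ks) ! (length (map N ks) + (k - 1))"
      unfolding N'_def ns_def using k by (simp add: len)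
    also have "\<dots> = map s ks ! (k - 1)" by (rule nth_append_length_plus)
    also have "\<dots> = s (ks ! (k - 1))" using k by (intro nth_map) (simp add: len)
    finally show ?thesis unfolding kk .
  qed
  have P: "perm_Pi (map N ks) (map s ks) = perm_Gamma_aux (2 * d) ns \<sigma>"
    by (simp add: perm_Pi_def perm_Gamma_def ns_def \<sigma>_def len mult_2) (simp add: ks_def)
  have set: "set \<sigma> = {1..2 * d}"
  proof -
    have "set \<sigma> = {1..d} \<union> (\<lambda>i. d + i) ` {1..d}" unfolding \<sigma>_def set_ks[symmetric] by auto
    also have "(\<lambda>i. d + i) ` {1..d} = {d + 1..d + d}" by (simp add: image_add_atLeastAtMost add.commute)
    also have "{1..d} \<union> {d + 1..d + d} = {1..2 * d}" by auto
    finally show ?thesis .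
  qed
  have "length \<sigma> = 2 * d" unfolding \<sigma>_def by (simp add: length_concat comp_def sum_list_triv len)
  then have dist: "distinct \<sigma>" using set card_distinct[of \<sigma>] by simp
  have upt: "[1..<Suc (2 * d)] = ks @ map (\<lambda>k. d + k) ks"
  proof -
    have "[1..<Suc (2 * d)] = [1..<Suc d + d]" by (simp add: mult_2)
    also have "\<dots> = [1..<Suc d] @ [Suc d..<Suc d + d]" by (rule upt_add_eq_append) simp
    also have "[Suc d..<Suc d + d] = map (\<lambda>k. d + k) [1..<Suc d]"
      by (rule nth_equalityI) (simp_all add: nth_append del: upt_Suc)
    finally show ?thesis by (simp only: ks_def)
  qed
  have prods: "(\<Prod>k\<leftarrow>ks. N' k) = (\<Prod>k\<leftarrow>ks. N k)" "(\<Prod>k\<leftarrow>ks. N' (d + k)) = (\<Prod>k\<leftarrow>ks. s k)"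
    using N'1 N'2 by (auto intro!: arg_cong[of _ _ prod_list])
  have n: "(\<Prod>k\<leftarrow>[1..<Suc (2 * d)]. N' k) = n"
    unfolding upt n_def prods[symmetric] by (simp add: comp_def)
  note idx = perm_Gamma_aux_index[OF dist set, of ns, folded N'_def, unfolded n]
  show "perm_Pi (map N ks) (map s ks) \<in> carrier_mat n n"
    unfolding P using idx \<open>0 < d\<close> by simp
  assume i: "\<And>k. k \<in> set ks \<Longrightarrow> i k < N k" and \<alpha>: "\<And>k. k \<in> set ks \<Longrightarrow> \<alpha> k < s k" and j: "j < n"
  \<comment> \<open>Names up to d carry the grid digits, names beyond d the block digits.\<close>
  define x where "x = (\<lambda>k. if k \<le> d then i k else \<alpha> (k - d))"
  have x1: "x k = i k" "x (d + k) = \<alpha> k" if "k \<in> set ks" for k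
    using that unfolding set_ks by (auto simp: x_def)
  have "\<forall>k\<in>set (ks @ map (\<lambda>k. d + k) ks). x k < N' k"
    using i \<alpha> N'1 N'2 x1 by auto
  moreover have "set (ks @ map (\<lambda>k. d + k) ks) = {1..2 * d}" unfolding upt[symmetric] by auto
  ultimately have "\<forall>k\<in>{1..2 * d}. x k < N' k" by simp
  then have "\<forall>k\<in>{1..2 * d}. x k < ns ! (k - 1)" by (simp add: N'_def)
  with idx \<open>0 < d\<close> j have "perm_Gamma_aux (2 * d) ns \<sigma> $$ (radix N' x \<sigma>, j) = of_bool (j = radix N' x [1..<Suc (2 * d)])"
    by simp
  moreover have "radix N' x \<sigma> = radix (\<lambda>k. N k * s k) (\<lambda>k. i k * s k + \<alpha> k) ks"
    unfolding \<sigma>_def radix_concat_pairs using N'1 N'2 x1 by (intro radix_cong) auto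
  moreover have "radix N' x [1..<Suc (2 * d)] = radix N i ks * (\<Prod>k\<leftarrow>ks. s k) + radix s \<alpha> ks"
    unfolding upt radix_append radix_map using prods(2) N'1 N'2 x1
    by (intro arg_cong2[of _ _ _ _ "(+)"] arg_cong2[of _ _ _ _ "(*)"] radix_cong) (auto simp: comp_def)
  ultimately show "perm_Pi (map N ks) (map s ks) $$ (radix (\<lambda>k. N k * s k) (\<lambda>k. i k * s k + \<alpha> k) ks, j) =
       of_bool (j = radix N i ks * (\<Prod>k\<leftarrow>ks. s k) + radix s \<alpha> ks)"
    unfolding P by simp
qed

text \<open>The row index is decomposed into digits, and since digits are unique, the position of
  the 1 in a row also locates the 1 in a column. Conjugation reads \<Pi> by columns, which is why
  this form is needed.\<close>

lemma perm_Pi_col: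
  fixes N s :: "nat \<Rightarrow> nat"
  assumes "0 < d"
  defines "ks \<equiv> [1..<Suc d]"
  assumes i: "\<And>k. k \<in> set ks \<Longrightarrow> i k < N k" and \<alpha>: "\<And>k. k \<in> set ks \<Longrightarrow> \<alpha> k < s k"
    and r: "r < (\<Prod>k\<leftarrow>ks. N k) * (\<Prod>k\<leftarrow>ks. s k)"
  shows "perm_Pi (map N ks) (map s ks) $$ (r, radix N i ks * (\<Prod>k\<leftarrow>ks. s k) + radix s \<alpha> ks) =
    of_bool (r = radix (\<lambda>k. N k * s k) (\<lambda>k. i k * s k + \<alpha> k) ks)"
proof -
  have "(\<Prod>k\<leftarrow>ks. N k) * (\<Prod>k\<leftarrow>ks. s k) = (\<Prod>k\<leftarrow>ks. N k * s k)"
    by (induction ks) auto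
  moreover have "distinct ks" by (simp add: ks_def)
  ultimately obtain y where y: "\<forall>k\<in>set ks. y k < N k * s k" "r = radix (\<lambda>k. N k * s k) y ks"
    using radix_surj[of r "\<lambda>k. N k * s k" ks] r by auto
  have pos: "0 < s k" if "k \<in> set ks" for k using \<alpha>[OF that] by simp
  have dm: "y k div s k < N k" "y k mod s k < s k" "y k = (y k div s k) * s k + y k mod s k" if "k \<in> set ks" for k
    using that y(1) pos by (auto simp: less_mult_imp_div_less)
  have r2: "r = radix (\<lambda>k. N k * s k) (\<lambda>k. y k div s k * s k + y k mod s k) ks"
    unfolding y(2) by (rule radix_cong) auto
  have less: "radix s \<alpha> ks < (\<Prod>k\<leftarrow>ks. s k)" "radix N i ks < (\<Prod>k\<leftarrow>ks. N k)"
    "radix s (\<lambda>k. y k mod s k) ks < (\<Prod>k\<leftarrow>ks. s k)"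
    using i \<alpha> dm by (auto intro!: radix_less)
  have "perm_Pi (map N ks) (map s ks) $$ (r, radix N i ks * (\<Prod>k\<leftarrow>ks. s k) + radix s \<alpha> ks) =
     of_bool (radix N i ks * (\<Prod>k\<leftarrow>ks. s k) + radix s \<alpha> ks =
       radix N (\<lambda>k. y k div s k) ks * (\<Prod>k\<leftarrow>ks. s k) + radix s (\<lambda>k. y k mod s k) ks)"
    unfolding r2 using perm_Pi_row[OF assms(1), where i = "\<lambda>k. y k div s k" and N = N and \<alpha> = "\<lambda>k. y k mod s k" and s = s, folded ks_def] dm
      digit_less[OF less(2,1)] by simp
  also have "\<dots> = of_bool ((\<forall>k\<in>set ks. i k = y k div s k) \<and> (\<forall>k\<in>set ks. \<alpha> k = y k mod s k))"
    unfolding digit_eq_iff[OF less(1,3)] using i \<alpha> dm by (simp add: radix_eq_iff)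
  also have "((\<forall>k\<in>set ks. i k = y k div s k) \<and> (\<forall>k\<in>set ks. \<alpha> k = y k mod s k)) \<longleftrightarrow>
     (\<forall>k\<in>set ks. y k = i k * s k + \<alpha> k)"
    using \<alpha> dm(3) by (metis digit_divmod)
  also have "\<dots> \<longleftrightarrow> r = radix (\<lambda>k. N k * s k) (\<lambda>k. i k * s k + \<alpha> k) ks"
    unfolding y(2) using y(1) i \<alpha> by (subst radix_eq_iff) (auto intro!: digit_less)
  finally show ?thesis .
qed

text \<open>Only column \<open>a\<close> of \<open>P\<close> and column \<open>b\<close> of
  \<open>Q\<close> enter; both are unit vectors, so each matrix product collapses to a single
  term.\<close>

lemma conj_perm_index:
  fixes K :: "complex mat"
  assumes "P \<in> carrier_mat n n" "K \<in> carrier_mat n m" "Q \<in> carrier_mat m m"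
    and "a < n" "b < m" "ra < n" "rb < m"
    and P: "\<And>r. r < n \<Longrightarrow> P $$ (r, a) = of_bool (r = ra)"
    and Q: "\<And>r. r < m \<Longrightarrow> Q $$ (r, b) = of_bool (r = rb)"
  shows "(transpose_mat P * K * Q) $$ (a, b) = K $$ (ra, rb)"
proof -
  have 1: "(transpose_mat P * K) $$ (a, c) = K $$ (ra, c)" if "c < m" for c
  proof -
    have "(transpose_mat P * K) $$ (a, c) = (\<Sum>r<n. transpose_mat P $$ (a, r) * K $$ (r, c))"
      using assms that by (intro mult_mat_index) auto
    also have "\<dots> = (\<Sum>r<n. if r = ra then K $$ (ra, c) else 0)"
      using assms by (intro sum.cong) auto
    finally show ?thesis using assms by simp
  qed
  have "(transpose_mat P * K * Q) $$ (a, b) = (\<Sum>r<m. (transpose_mat P * K) $$ (a, r) * Q $$ (r, b))"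
    using assms by (intro mult_mat_index) auto
  also have "\<dots> = (\<Sum>r<m. if r = rb then K $$ (ra, rb) else 0)"
    using assms 1 by (intro sum.cong) auto
  finally show ?thesis using assms by simp
qed

definition reordered_kron ::
    "nat \<Rightarrow> (nat \<Rightarrow> nat) \<Rightarrow> (nat \<Rightarrow> nat) \<Rightarrow> (nat \<Rightarrow> nat) \<Rightarrow> (nat \<Rightarrow> complex mat) \<Rightarrow> complex mat" where
  "reordered_kron d N s t A =
     transpose_mat (perm_Pi (map N [1..<Suc d]) (map s [1..<Suc d]))
       * kron_list (map A [1..<Suc d])
       * perm_Pi (map N [1..<Suc d]) (map t [1..<Suc d])"

lemma reordered_kron_carrier:
  assumes "0 < d"
  shows "reordered_kron d N s t A \<in> carrier_mat
    ((\<Prod>k\<leftarrow>[1..<Suc d]. N k) * (\<Prod>k\<leftarrow>[1..<Suc d]. s k)) ((\<Prod>k\<leftarrow>[1..<Suc d]. N k) * (\<Prod>k\<leftarrow>[1..<Suc d]. t k))"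
  using perm_Pi_carrier[OF assms, of N s] perm_Pi_carrier[OF assms, of N t]
  by (intro carrier_matI) (simp_all add: reordered_kron_def del: upt_Suc)

lemma prod_list_mult_distrib: "(\<Prod>k\<leftarrow>ks. f k * g k :: nat) = (\<Prod>k\<leftarrow>ks. f k) * (\<Prod>k\<leftarrow>ks. g k)"
  by (induction ks) auto

text \<open>Apart from the sizes, this is all that later arguments use of \<Pi>: conjugation
  replaces the grouping by factors with one grid index followed by one block index.\<close>

lemma reordered_kron_index:
  fixes N s t :: "nat \<Rightarrow> nat"
  assumes "0 < d"
  defines "ks \<equiv> [1..<Suc d]"
  assumes A: "\<And>k. k \<in> set ks \<Longrightarrow> A k \<in> carrier_mat (N k * s k) (N k * t k)"
    and ij: "\<And>k. k \<in> set ks \<Longrightarrow> i k < N k" "\<And>k. k \<in> set ks \<Longrightarrow> j k < N k"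
    and \<alpha>\<beta>: "\<And>k. k \<in> set ks \<Longrightarrow> \<alpha> k < s k" "\<And>k. k \<in> set ks \<Longrightarrow> \<beta> k < t k"
  shows "reordered_kron d N s t A $$
     (radix N i ks * (\<Prod>k\<leftarrow>ks. s k) + radix s \<alpha> ks, radix N j ks * (\<Prod>k\<leftarrow>ks. t k) + radix t \<beta> ks) =
     (\<Prod>k\<leftarrow>ks. A k $$ (i k * s k + \<alpha> k, j k * t k + \<beta> k))"
proof -
  let ?K = "kron_list (map A ks)"
  have dims: "(\<Prod>k\<leftarrow>ks. dim_row (A k)) = (\<Prod>k\<leftarrow>ks. N k * s k)" "(\<Prod>k\<leftarrow>ks. dim_col (A k)) = (\<Prod>k\<leftarrow>ks. N k * t k)"
    by (intro arg_cong[of _ _ prod_list] map_cong refl carrier_matD[OF A]; assumption)+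
  have K: "?K \<in> carrier_mat ((\<Prod>k\<leftarrow>ks. N k) * (\<Prod>k\<leftarrow>ks. s k)) ((\<Prod>k\<leftarrow>ks. N k) * (\<Prod>k\<leftarrow>ks. t k))"
    using dims by (intro carrier_matI) (simp_all add: comp_def prod_list_mult_distrib)
  have "reordered_kron d N s t A $$
     (radix N i ks * (\<Prod>k\<leftarrow>ks. s k) + radix s \<alpha> ks, radix N j ks * (\<Prod>k\<leftarrow>ks. t k) + radix t \<beta> ks) =
     ?K $$ (radix (\<lambda>k. N k * s k) (\<lambda>k. i k * s k + \<alpha> k) ks, radix (\<lambda>k. N k * t k) (\<lambda>k. j k * t k + \<beta> k) ks)"
    unfolding reordered_kron_def ks_def[symmetric]
  proof (rule conj_perm_index[OF _ K])
    show "radix (\<lambda>k. N k * s k) (\<lambda>k. i k * s k + \<alpha> k) ks < (\<Prod>k\<leftarrow>ks. N k) * (\<Prod>k\<leftarrow>ks. s k)"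
      "radix (\<lambda>k. N k * t k) (\<lambda>k. j k * t k + \<beta> k) ks < (\<Prod>k\<leftarrow>ks. N k) * (\<Prod>k\<leftarrow>ks. t k)"
      unfolding prod_list_mult_distrib[symmetric] using ij \<alpha>\<beta> by (intro radix_less digit_less; simp)+
  qed (use perm_Pi_carrier[OF assms(1), folded ks_def] perm_Pi_col[OF assms(1), folded ks_def] ij \<alpha>\<beta>
        in \<open>auto intro!: digit_less radix_less\<close>)
  also have "\<dots> = ?K $$ (radix (dim_row \<circ> A) (\<lambda>k. i k * s k + \<alpha> k) ks, radix (dim_col \<circ> A) (\<lambda>k. j k * t k + \<beta> k) ks)"
    using carrier_matD[OF A]
    by (intro arg_cong[of _ _ "($$) ?K"] arg_cong2[of _ _ _ _ Pair] radix_cong) simp_all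
  also have "\<dots> = (\<Prod>k\<leftarrow>ks. A k $$ (i k * s k + \<alpha> k, j k * t k + \<beta> k))"
    using A ij \<alpha>\<beta> by (intro kron_list_index) (metis carrier_matD digit_less)+
  finally show ?thesis .
qed


text \<open>With trivial blocks every block digit is 0, so both sides have the same entries. The
  matrices \<Pi> themselves are not simplified.\<close>

lemma reordered_kron_ones:
  assumes "0 < d" "\<And>k. k \<in> {1..d} \<Longrightarrow> s k = 1 \<and> t k = 1"
    and A: "\<And>k. k \<in> {1..d} \<Longrightarrow> A k \<in> carrier_mat (N k * s k) (N k * t k)"
  shows "reordered_kron d N s t A = kron_list (map A [1..<Suc d])"
proof -
  define ks where "ks = [1..<Suc d]"
  have set_ks: "set ks = {1..d}" and dist: "distinct ks" by (auto simp: ks_def)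
  have st: "(\<Prod>k\<leftarrow>ks. s k) = 1" "(\<Prod>k\<leftarrow>ks. t k) = 1"
    using assms(2) unfolding set_ks[symmetric] by (induction ks) auto
  have dim: "(\<Prod>k\<leftarrow>ks. dim_row (A k)) = (\<Prod>k\<leftarrow>ks. N k)" "(\<Prod>k\<leftarrow>ks. dim_col (A k)) = (\<Prod>k\<leftarrow>ks. N k)"
    using carrier_matD[OF A] assms(2) unfolding set_ks[symmetric]
    by (auto intro!: arg_cong[of _ _ prod_list])
  have car: "reordered_kron d N s t A \<in> carrier_mat (\<Prod>k\<leftarrow>ks. N k) (\<Prod>k\<leftarrow>ks. N k)"
    using reordered_kron_carrier[OF assms(1), of N s t A] unfolding ks_def[symmetric] st by simp
  have "reordered_kron d N s t A = kron_list (map A ks)"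
  proof (rule eq_matI)
    fix a b assume "a < dim_row (kron_list (map A ks))" "b < dim_col (kron_list (map A ks))"
    then have ab: "a < (\<Prod>k\<leftarrow>ks. N k)" "b < (\<Prod>k\<leftarrow>ks. N k)" by (simp_all add: comp_def dim)
    obtain i j where ij: "\<forall>k\<in>set ks. i k < N k" "a = radix N i ks" "\<forall>k\<in>set ks. j k < N k" "b = radix N j ks"
      using radix_surj[OF ab(1) dist] radix_surj[OF ab(2) dist] by blast
    have z: "radix f (\<lambda>k. 0) ks = 0" for f by (induction ks rule: rev_induct) auto
    have "reordered_kron d N s t A $$ (radix N i ks * (\<Prod>k\<leftarrow>ks. s k) + radix s (\<lambda>k. 0) ks,
         radix N j ks * (\<Prod>k\<leftarrow>ks. t k) + radix t (\<lambda>k. 0) ks) =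
      (\<Prod>k\<leftarrow>ks. A k $$ (i k * s k + 0, j k * t k + 0))"
      using ij(1,3) assms(2)
      by (intro reordered_kron_index[OF assms(1), folded ks_def] A) (simp_all add: set_ks)
    then have "reordered_kron d N s t A $$ (a, b) = (\<Prod>k\<leftarrow>ks. A k $$ (i k * s k, j k * t k))"
      unfolding z st ij(2,4) by simp
    also have "\<dots> = (\<Prod>k\<leftarrow>ks. A k $$ (i k, j k))"
      using assms(2) by (intro arg_cong[of _ _ prod_list] map_cong refl) (simp add: set_ks)
    also have "\<dots> = kron_list (map A ks) $$ (radix (dim_row \<circ> A) i ks, radix (dim_col \<circ> A) j ks)"
      using ij(1,3) carrier_matD[OF A] assms(2) unfolding set_ks[symmetric]
      by (intro kron_list_index[symmetric]) simp_all
    also have "radix (dim_row \<circ> A) i ks = a"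
      unfolding ij(2) using carrier_matD[OF A] assms(2) unfolding set_ks[symmetric]
      by (intro radix_cong) simp_all
    also have "radix (dim_col \<circ> A) j ks = b"
      unfolding ij(4) using carrier_matD[OF A] assms(2) unfolding set_ks[symmetric]
      by (intro radix_cong) simp_all
    finally show "reordered_kron d N s t A $$ (a, b) = kron_list (map A ks) $$ (a, b)" .
  qed (use car in \<open>simp_all add: comp_def dim\<close>)
  then show ?thesis by (simp add: ks_def)
qed

text \<open>An index of the reordered product encodes \<open>((i\<^sub>1, i\<^sub>2), (\<alpha>\<^sub>1, \<alpha>\<^sub>2))\<close>; the indices of the two factors are
  \<open>(i\<^sub>1, \<alpha>\<^sub>1)\<close> and \<open>(i\<^sub>2, \<alpha>\<^sub>2)\<close>.\<close>

definition block_index1 :: "nat \<Rightarrow> nat \<Rightarrow> nat \<Rightarrow> nat \<Rightarrow> nat" where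
  "block_index1 n s1 s2 a = a div (s1 * s2) div n * s1 + a mod (s1 * s2) div s2"

definition block_index2 :: "nat \<Rightarrow> nat \<Rightarrow> nat \<Rightarrow> nat \<Rightarrow> nat" where
  "block_index2 n s1 s2 a = a div (s1 * s2) mod n * s2 + a mod (s1 * s2) mod s2"

definition block_kron :: "nat \<Rightarrow> nat \<Rightarrow> nat \<Rightarrow> nat \<Rightarrow> nat \<Rightarrow> nat \<Rightarrow> complex mat \<Rightarrow> complex mat \<Rightarrow> complex mat" where
  "block_kron n1 n2 s1 s2 t1 t2 X Y = mat (n1 * n2 * (s1 * s2)) (n1 * n2 * (t1 * t2))
     (\<lambda>(a, b). X $$ (block_index1 n2 s1 s2 a, block_index1 n2 t1 t2 b) * Y $$ (block_index2 n2 s1 s2 a, block_index2 n2 t1 t2 b))"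

lemma block_index:
  assumes "i2 < n2" "\<alpha>1 < s1" "\<alpha>2 < s2"
  shows "block_index1 n2 s1 s2 ((i1 * n2 + i2) * (s1 * s2) + (\<alpha>1 * s2 + \<alpha>2)) = i1 * s1 + \<alpha>1"
    and "block_index2 n2 s1 s2 ((i1 * n2 + i2) * (s1 * s2) + (\<alpha>1 * s2 + \<alpha>2)) = i2 * s2 + \<alpha>2"
  using digit_less[OF assms(2,3)] assms by (simp_all add: block_index1_def block_index2_def digit_divmod)

lemma block_index_obtain:
  assumes "(a::nat) < n1 * n2 * (s1 * s2)"
  obtains i1 i2 \<alpha>1 \<alpha>2 where "i1 < n1" "i2 < n2" "\<alpha>1 < s1" "\<alpha>2 < s2"
    "a = (i1 * n2 + i2) * (s1 * s2) + (\<alpha>1 * s2 + \<alpha>2)"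
proof -
  obtain i \<alpha> where "i < n1 * n2" "\<alpha> < s1 * s2" and a: "a = i * (s1 * s2) + \<alpha>"
    using digit_obtain[OF assms] .
  moreover obtain i1 i2 where "i1 < n1" "i2 < n2" "i = i1 * n2 + i2"
    using digit_obtain[OF \<open>i < n1 * n2\<close>] .
  moreover obtain \<alpha>1 \<alpha>2 where "\<alpha>1 < s1" "\<alpha>2 < s2" "\<alpha> = \<alpha>1 * s2 + \<alpha>2"
    using digit_obtain[OF \<open>\<alpha> < s1 * s2\<close>] .
  ultimately show thesis using that by blast
qed

text \<open>Along this bijection, rank and norm bounds pass from a tensor product indexed by pairs
  to \<open>block_kron\<close>.\<close>

lemma bij_betw_block_index:
  "bij_betw (\<lambda>a. (block_index1 n2 s1 s2 a, block_index2 n2 s1 s2 a)) {..<n1 * n2 * (s1 * s2)} ({..<n1 * s1} \<times> {..<n2 * s2})"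
  unfolding bij_betw_def
proof
  show "inj_on (\<lambda>a. (block_index1 n2 s1 s2 a, block_index2 n2 s1 s2 a)) {..<n1 * n2 * (s1 * s2)}"
  proof (rule inj_onI)
    fix a b assume a: "a \<in> {..<n1 * n2 * (s1 * s2)}" and b: "b \<in> {..<n1 * n2 * (s1 * s2)}"
      and eq: "(block_index1 n2 s1 s2 a, block_index2 n2 s1 s2 a) = (block_index1 n2 s1 s2 b, block_index2 n2 s1 s2 b)"
    obtain i1 i2 \<alpha>1 \<alpha>2 where i: "i1 < n1" "i2 < n2" "\<alpha>1 < s1" "\<alpha>2 < s2"
      "a = (i1 * n2 + i2) * (s1 * s2) + (\<alpha>1 * s2 + \<alpha>2)" using block_index_obtain a by (metis lessThan_iff)
    obtain j1 j2 \<beta>1 \<beta>2 where j: "j1 < n1" "j2 < n2" "\<beta>1 < s1" "\<beta>2 < s2"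
      "b = (j1 * n2 + j2) * (s1 * s2) + (\<beta>1 * s2 + \<beta>2)" using block_index_obtain b by (metis lessThan_iff)
    have "i1 * s1 + \<alpha>1 = j1 * s1 + \<beta>1" "i2 * s2 + \<alpha>2 = j2 * s2 + \<beta>2"
      using eq unfolding i(5) j(5) by (simp_all only: block_index[OF i(2-4)] block_index[OF j(2-4)] prod.inject)
    then show "a = b" unfolding i(5) j(5)
      by (simp add: digit_eq_iff[OF i(3) j(3)] digit_eq_iff[OF i(4) j(4)])
  qed
  show "(\<lambda>a. (block_index1 n2 s1 s2 a, block_index2 n2 s1 s2 a)) ` {..<n1 * n2 * (s1 * s2)} = {..<n1 * s1} \<times> {..<n2 * s2}"
  proof (intro subset_antisym subsetI)
    fix p assume "p \<in> (\<lambda>a. (block_index1 n2 s1 s2 a, block_index2 n2 s1 s2 a)) ` {..<n1 * n2 * (s1 * s2)}"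
    then obtain a where a: "a < n1 * n2 * (s1 * s2)" "p = (block_index1 n2 s1 s2 a, block_index2 n2 s1 s2 a)" by auto
    obtain i1 i2 \<alpha>1 \<alpha>2 where i: "i1 < n1" "i2 < n2" "\<alpha>1 < s1" "\<alpha>2 < s2"
      "a = (i1 * n2 + i2) * (s1 * s2) + (\<alpha>1 * s2 + \<alpha>2)" using block_index_obtain[OF a(1)] .
    show "p \<in> {..<n1 * s1} \<times> {..<n2 * s2}"
      unfolding a(2) i(5) block_index[OF i(2-4)] using i by (simp add: digit_less)
  next
    fix p assume "p \<in> {..<n1 * s1} \<times> {..<n2 * s2}"
    then obtain x y where p: "p = (x, y)" "x < n1 * s1" "y < n2 * s2" by auto
    obtain i1 \<alpha>1 where i: "i1 < n1" "\<alpha>1 < s1" "x = i1 * s1 + \<alpha>1" using digit_obtain[OF p(2)] .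
    obtain i2 \<alpha>2 where j: "i2 < n2" "\<alpha>2 < s2" "y = i2 * s2 + \<alpha>2" using digit_obtain[OF p(3)] .
    show "p \<in> (\<lambda>a. (block_index1 n2 s1 s2 a, block_index2 n2 s1 s2 a)) ` {..<n1 * n2 * (s1 * s2)}"
      unfolding p(1) i(3) j(3) using i j
      by (intro image_eqI[of _ _ "(i1 * n2 + i2) * (s1 * s2) + (\<alpha>1 * s2 + \<alpha>2)"])
         (simp_all add: block_index digit_less)
  qed
qed

lemma block_kron_carrier [simp]: "block_kron n1 n2 s1 s2 t1 t2 X Y \<in> carrier_mat (n1 * n2 * (s1 * s2)) (n1 * n2 * (t1 * t2))"
  by (simp add: block_kron_def)

lemma block_kron_index:
  assumes "i1 < n1" "i2 < n2" "\<alpha>1 < s1" "\<alpha>2 < s2" "j1 < n1" "j2 < n2" "\<beta>1 < t1" "\<beta>2 < t2"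
  shows "block_kron n1 n2 s1 s2 t1 t2 X Y $$
      ((i1 * n2 + i2) * (s1 * s2) + (\<alpha>1 * s2 + \<alpha>2), (j1 * n2 + j2) * (t1 * t2) + (\<beta>1 * t2 + \<beta>2)) =
    X $$ (i1 * s1 + \<alpha>1, j1 * t1 + \<beta>1) * Y $$ (i2 * s2 + \<alpha>2, j2 * t2 + \<beta>2)"
  using assms by (simp add: block_kron_def digit_less block_index)

text \<open>Recognises a \<open>block_kron\<close> by entries whose indices are written with digits,
  so that the quotients and remainders of its definition do not have to be handled again.\<close>

lemma eq_block_kronI:
  assumes "M \<in> carrier_mat (n1 * n2 * (s1 * s2)) (n1 * n2 * (t1 * t2))"
    and "\<And>i1 i2 \<alpha>1 \<alpha>2 j1 j2 \<beta>1 \<beta>2. \<lbrakk>i1 < n1; i2 < n2; \<alpha>1 < s1; \<alpha>2 < s2; j1 < n1; j2 < n2; \<beta>1 < t1; \<beta>2 < t2\<rbrakk> \<Longrightarrow>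
      M $$ ((i1 * n2 + i2) * (s1 * s2) + (\<alpha>1 * s2 + \<alpha>2), (j1 * n2 + j2) * (t1 * t2) + (\<beta>1 * t2 + \<beta>2)) =
      X $$ (i1 * s1 + \<alpha>1, j1 * t1 + \<beta>1) * Y $$ (i2 * s2 + \<alpha>2, j2 * t2 + \<beta>2)"
  shows "M = block_kron n1 n2 s1 s2 t1 t2 X Y"
proof (rule eq_matI)
  fix a b assume "a < dim_row (block_kron n1 n2 s1 s2 t1 t2 X Y)" "b < dim_col (block_kron n1 n2 s1 s2 t1 t2 X Y)"
  then have a: "a < n1 * n2 * (s1 * s2)" and b: "b < n1 * n2 * (t1 * t2)" by (simp_all add: block_kron_def)
  obtain i1 i2 \<alpha>1 \<alpha>2 where i: "i1 < n1" "i2 < n2" "\<alpha>1 < s1" "\<alpha>2 < s2"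
    "a = (i1 * n2 + i2) * (s1 * s2) + (\<alpha>1 * s2 + \<alpha>2)" using block_index_obtain[OF a] .
  obtain j1 j2 \<beta>1 \<beta>2 where j: "j1 < n1" "j2 < n2" "\<beta>1 < t1" "\<beta>2 < t2"
    "b = (j1 * n2 + j2) * (t1 * t2) + (\<beta>1 * t2 + \<beta>2)" using block_index_obtain[OF b] .
  show "M $$ (a, b) = block_kron n1 n2 s1 s2 t1 t2 X Y $$ (a, b)"
    unfolding i(5) j(5) assms(2)[OF i(1-4) j(1-4)] block_kron_index[OF i(1-4) j(1-4)] ..
qed (use assms(1) in \<open>simp_all add: block_kron_def\<close>)

lemma reordered_kron_1:
  assumes "A 1 \<in> carrier_mat (N 1 * s 1) (N 1 * t 1)"
  shows "reordered_kron 1 N s t A = A 1"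
proof -
  have ks: "[1..<Suc 1] = [1]" by simp
  have e: "radix f x [1] = x 1" for f x by (simp add: radix_def)
  have p: "(\<Prod>k\<leftarrow>[1::nat]. f k) = f 1" for f :: "nat \<Rightarrow> 'z::monoid_mult" by simp
  show ?thesis
  proof (rule eq_matI)
    fix a b assume "a < dim_row (A 1)" "b < dim_col (A 1)"
    then have "a < N 1 * s 1" "b < N 1 * t 1" using assms by auto
    then obtain i \<alpha> j \<beta> where ij: "i < N 1" "\<alpha> < s 1" "a = i * s 1 + \<alpha>" "j < N 1" "\<beta> < t 1" "b = j * t 1 + \<beta>"
      using digit_obtain by metis
    show "reordered_kron 1 N s t A $$ (a, b) = A 1 $$ (a, b)"
      using reordered_kron_index[of 1 A N s t "\<lambda>_. i" "\<lambda>_. j" "\<lambda>_. \<alpha>" "\<lambda>_. \<beta>", unfolded ks e p] assms ij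
      by simp
  qed (use assms reordered_kron_carrier[of 1 N s t A, unfolded ks p] in auto)
qed

text \<open>The first d grid digits merge into one digit, and so do the first d block digits; the
  digits of the new factor are the least significant ones of the two groups. This reduces d factors
  to two.\<close>

lemma reordered_kron_Suc:
  fixes N s t :: "nat \<Rightarrow> nat"
  assumes "0 < d" and A: "\<And>k. k \<in> {1..Suc d} \<Longrightarrow> A k \<in> carrier_mat (N k * s k) (N k * t k)"
  defines "ks \<equiv> [1..<Suc d]"
  shows "reordered_kron (Suc d) N s t A =
    block_kron (\<Prod>k\<leftarrow>ks. N k) (N (Suc d)) (\<Prod>k\<leftarrow>ks. s k) (s (Suc d)) (\<Prod>k\<leftarrow>ks. t k) (t (Suc d))
      (reordered_kron d N s t A) (A (Suc d))"
proof (rule eq_block_kronI)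
  have ks: "[1..<Suc (Suc d)] = ks @ [Suc d]" by (simp add: ks_def)
  have set_ks: "set ks = {1..d}" and dist: "distinct ks" by (auto simp: ks_def)
  have p: "(\<Prod>k\<leftarrow>ks @ [Suc d]. f k) = (\<Prod>k\<leftarrow>ks. f k) * f (Suc d)" for f :: "nat \<Rightarrow> 'z::monoid_mult" by simp
  show "reordered_kron (Suc d) N s t A \<in> carrier_mat ((\<Prod>k\<leftarrow>ks. N k) * N (Suc d) * ((\<Prod>k\<leftarrow>ks. s k) * s (Suc d)))
     ((\<Prod>k\<leftarrow>ks. N k) * N (Suc d) * ((\<Prod>k\<leftarrow>ks. t k) * t (Suc d)))"
    using reordered_kron_carrier[of "Suc d" N s t A] unfolding ks p by simp
  fix i1 i2 \<alpha>1 \<alpha>2 j1 j2 \<beta>1 \<beta>2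
  assume *: "i1 < (\<Prod>k\<leftarrow>ks. N k)" "i2 < N (Suc d)" "\<alpha>1 < (\<Prod>k\<leftarrow>ks. s k)" "\<alpha>2 < s (Suc d)"
    "j1 < (\<Prod>k\<leftarrow>ks. N k)" "j2 < N (Suc d)" "\<beta>1 < (\<Prod>k\<leftarrow>ks. t k)" "\<beta>2 < t (Suc d)"
  obtain i where i: "\<forall>k\<in>set ks. i k < N k" "i1 = radix N i ks" using radix_surj[OF *(1) dist] by blast
  obtain j where j: "\<forall>k\<in>set ks. j k < N k" "j1 = radix N j ks" using radix_surj[OF *(5) dist] by blast
  obtain \<alpha> where \<alpha>: "\<forall>k\<in>set ks. \<alpha> k < s k" "\<alpha>1 = radix s \<alpha> ks" using radix_surj[OF *(3) dist] by blast
  obtain \<beta> where \<beta>: "\<forall>k\<in>set ks. \<beta> k < t k" "\<beta>1 = radix t \<beta> ks" using radix_surj[OF *(7) dist] by blast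
  \<comment> \<open>The digit families over 1, ..., d are extended at the new name, which is not
    among the old ones.\<close>
  have ext: "radix f (x(Suc d := y)) (ks @ [Suc d]) = radix f x ks * f (Suc d) + y" for f x y
  proof -
    have "radix f (x(Suc d := y)) ks = radix f x ks" by (intro radix_cong) (auto simp: set_ks)
    then show ?thesis by simp
  qed
  have ball: "(x(Suc d := y)) k < f k" if "\<forall>k\<in>set ks. x k < f k" "y < f (Suc d)" "k \<in> set (ks @ [Suc d])"
    for x y k and f :: "nat \<Rightarrow> nat"
    using that by auto
  have "reordered_kron (Suc d) N s t A $$
      ((i1 * N (Suc d) + i2) * ((\<Prod>k\<leftarrow>ks. s k) * s (Suc d)) + (\<alpha>1 * s (Suc d) + \<alpha>2),
       (j1 * N (Suc d) + j2) * ((\<Prod>k\<leftarrow>ks. t k) * t (Suc d)) + (\<beta>1 * t (Suc d) + \<beta>2)) =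
    (\<Prod>k\<leftarrow>ks @ [Suc d]. A k $$ ((i(Suc d := i2)) k * s k + (\<alpha>(Suc d := \<alpha>2)) k, (j(Suc d := j2)) k * t k + (\<beta>(Suc d := \<beta>2)) k))"
  proof -
    have "A k \<in> carrier_mat (N k * s k) (N k * t k)" if "k \<in> set (ks @ [Suc d])" for k
      using that by (intro A) (auto simp: set_ks)
    from reordered_kron_index[of "Suc d" A N s t "i(Suc d := i2)" "j(Suc d := j2)" "\<alpha>(Suc d := \<alpha>2)" "\<beta>(Suc d := \<beta>2)", unfolded ks, OF _ this ball[OF i(1) *(2)] ball[OF j(1) *(6)] ball[OF \<alpha>(1) *(4)] ball[OF \<beta>(1) *(8)]]
    show ?thesis unfolding ext p i(2) j(2) \<alpha>(2) \<beta>(2) by simp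
  qed
  also have "\<dots> = (\<Prod>k\<leftarrow>ks. A k $$ (i k * s k + \<alpha> k, j k * t k + \<beta> k)) *
      A (Suc d) $$ (i2 * s (Suc d) + \<alpha>2, j2 * t (Suc d) + \<beta>2)"
    unfolding p by (intro arg_cong2[of _ _ _ _ "(*)"] arg_cong[of _ _ prod_list] map_cong) (auto simp: set_ks)
  also have "(\<Prod>k\<leftarrow>ks. A k $$ (i k * s k + \<alpha> k, j k * t k + \<beta> k)) =
    reordered_kron d N s t A $$ (i1 * (\<Prod>k\<leftarrow>ks. s k) + \<alpha>1, j1 * (\<Prod>k\<leftarrow>ks. t k) + \<beta>1)"
    unfolding i(2) j(2) \<alpha>(2) \<beta>(2)
    by (rule reordered_kron_index[OF assms(1), folded ks_def, symmetric])
       (use A i(1) j(1) \<alpha>(1) \<beta>(1) in \<open>simp_all add: set_ks\<close>)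
  finally show "reordered_kron (Suc d) N s t A $$
      ((i1 * N (Suc d) + i2) * ((\<Prod>k\<leftarrow>ks. s k) * s (Suc d)) + (\<alpha>1 * s (Suc d) + \<alpha>2),
       (j1 * N (Suc d) + j2) * ((\<Prod>k\<leftarrow>ks. t k) * t (Suc d)) + (\<beta>1 * t (Suc d) + \<beta>2)) =
    reordered_kron d N s t A $$ (i1 * (\<Prod>k\<leftarrow>ks. s k) + \<alpha>1, j1 * (\<Prod>k\<leftarrow>ks. t k) + \<beta>1) *
      A (Suc d) $$ (i2 * s (Suc d) + \<alpha>2, j2 * t (Suc d) + \<beta>2)" .
qed

section \<open>Low rank plus bounded decompositions\<close>

text \<open>Matrices are treated as functions on arbitrary finite index sets here, so that Kronecker products
  are indexed by pairs and the reordering by \<open>\<Pi>\<close> is a mere change of index.\<close>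

definition outer_rank_le :: "'a set \<Rightarrow> 'b set \<Rightarrow> ('a \<Rightarrow> 'b \<Rightarrow> complex) \<Rightarrow> nat \<Rightarrow> bool" where
  "outer_rank_le I J X r \<longleftrightarrow> (\<exists>u v. \<forall>i\<in>I. \<forall>j\<in>J. X i j = (\<Sum>k<r. u k i * v k j))"

text \<open>A bound on the spectral norm, stated as an inequality for every vector so that no
  supremum has to be handled.\<close>

definition op_bounded :: "'a set \<Rightarrow> 'b set \<Rightarrow> ('a \<Rightarrow> 'b \<Rightarrow> complex) \<Rightarrow> real \<Rightarrow> bool" where
  "op_bounded I J X M \<longleftrightarrow>
     (\<forall>y. L2_set (\<lambda>i. cmod (\<Sum>j\<in>J. X i j * y j)) I \<le> M * L2_set (\<lambda>j. cmod (y j)) J)"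

text \<open>The rank budget is real because it will be a proportion of the dimension. Nonnegativity
  of the norm bound is included since bounds get multiplied under tensor products and diagonal
  scalings.\<close>

definition splits :: "'a set \<Rightarrow> 'b set \<Rightarrow> ('a \<Rightarrow> 'b \<Rightarrow> complex) \<Rightarrow> real \<Rightarrow> real \<Rightarrow> bool" where
  "splits I J X r M \<longleftrightarrow> 0 \<le> M \<and>
     (\<exists>R E k. (\<forall>i\<in>I. \<forall>j\<in>J. X i j = R i j + E i j) \<and> outer_rank_le I J R k \<and> real k \<le> r \<and> op_bounded I J E M)"

section \<open>Rank bounds by sums of rank-one terms\<close>

text \<open>Any finite set may label the rank-one terms, so that sums and tensor products can use
  disjoint unions and Cartesian products of labels.\<close>

lemma outer_rank_le_sum_fin:
  assumes "finite K" "\<And>i j. i \<in> I \<Longrightarrow> j \<in> J \<Longrightarrow> X i j = (\<Sum>k\<in>K. u k i * v k j)"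
  shows "outer_rank_le I J X (card K)"
proof -
  obtain h where h: "bij_betw h {..<card K} K"
    using ex_bij_betw_nat_finite[OF assms(1)] by (auto simp: atLeast0LessThan)
  have "X i j = (\<Sum>k<card K. u (h k) i * v (h k) j)" if "i \<in> I" "j \<in> J" for i j
    unfolding assms(2)[OF that] by (rule sum.reindex_bij_betw[OF h, symmetric])
  then show ?thesis
    unfolding outer_rank_le_def by (intro exI[of _ "\<lambda>k. u (h k)"] exI[of _ "\<lambda>k. v (h k)"]) auto
qed

lemma outer_rank_le_cong:
  "(\<And>i j. i \<in> I \<Longrightarrow> j \<in> J \<Longrightarrow> X i j = Y i j) \<Longrightarrow> outer_rank_le I J X r \<longleftrightarrow> outer_rank_le I J Y r"
  unfolding outer_rank_le_def by auto

lemma outer_rank_le_add: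
  assumes "outer_rank_le I J X r" "outer_rank_le I J Y r'"
  shows "outer_rank_le I J (\<lambda>i j. X i j + Y i j) (r + r')"
proof -
  obtain u v where 1: "\<forall>i\<in>I. \<forall>j\<in>J. X i j = (\<Sum>k<r. u k i * v k j)"
    using assms(1) unfolding outer_rank_le_def by blast
  obtain u' v' where 2: "\<forall>i\<in>I. \<forall>j\<in>J. Y i j = (\<Sum>k<r'. u' k i * v' k j)"
    using assms(2) unfolding outer_rank_le_def by blast
  have "outer_rank_le I J (\<lambda>i j. X i j + Y i j) (card ({..<r} <+> {..<r'}))"
    by (rule outer_rank_le_sum_fin[where u = "case_sum u u'" and v = "case_sum v v'"])
       (use 1 2 in \<open>auto simp: sum.Plus\<close>)
  then show ?thesis by (simp add: card_Plus)
qed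

lemma outer_rank_le_rows:
  assumes "finite K" "\<And>i j. i \<in> I \<Longrightarrow> j \<in> J \<Longrightarrow> i \<notin> K \<Longrightarrow> X i j = 0"
  shows "outer_rank_le I J X (card K)"
proof (rule outer_rank_le_sum_fin[OF assms(1), where u = "\<lambda>k i. of_bool (i = k)" and v = X])
  fix i j assume ij: "i \<in> I" "j \<in> J"
  have "(\<Sum>k\<in>K. of_bool (i = k) * X k j) = (\<Sum>k\<in>K. if k = i then X i j else 0)"
    by (intro sum.cong) auto
  then show "X i j = (\<Sum>k\<in>K. of_bool (i = k) * X k j)"
    using assms ij by (auto simp: sum.delta)
qed

lemma outer_rank_le_cols:
  assumes "finite J"
  shows "outer_rank_le I J X (card J)"
proof (rule outer_rank_le_sum_fin[OF assms(1), where v = "\<lambda>k j. of_bool (j = k)" and u = "\<lambda>k i. X i k"])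
  fix i j assume ij: "i \<in> I" "j \<in> J"
  have "(\<Sum>k\<in>J. X i k * of_bool (j = k)) = (\<Sum>k\<in>J. if k = j then X i j else 0)"
    by (intro sum.cong) auto
  then show "X i j = (\<Sum>k\<in>J. X i k * of_bool (j = k))"
    using assms ij by (auto simp: sum.delta)
qed

lemma outer_rank_le_min:
  assumes "finite I" "finite J"
  shows "outer_rank_le I J X (min (card I) (card J))"
  using outer_rank_le_rows[OF assms(1), of I J X] outer_rank_le_cols[OF assms(2), of I X] by (auto simp: min_def)

lemma outer_rank_le_tensor:
  assumes "outer_rank_le I J X r" "outer_rank_le I' J' Y r'"
  shows "outer_rank_le (I \<times> I') (J \<times> J') (\<lambda>(i, i') (j, j'). X i j * Y i' j') (r * r')"
proof -
  obtain u v where 1: "\<forall>i\<in>I. \<forall>j\<in>J. X i j = (\<Sum>k<r. u k i * v k j)"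
    using assms(1) unfolding outer_rank_le_def by blast
  obtain u' v' where 2: "\<forall>i\<in>I'. \<forall>j\<in>J'. Y i j = (\<Sum>k<r'. u' k i * v' k j)"
    using assms(2) unfolding outer_rank_le_def by blast
  have "outer_rank_le (I \<times> I') (J \<times> J') (\<lambda>(i, i') (j, j'). X i j * Y i' j') (card ({..<r} \<times> {..<r'}))"
  proof (rule outer_rank_le_sum_fin[where u = "\<lambda>(k, k') (i, i'). u k i * u' k' i'" and v = "\<lambda>(k, k') (j, j'). v k j * v' k' j'"])
    fix p q assume "p \<in> I \<times> I'" "q \<in> J \<times> J'"
    then obtain i i' j j' where p: "p = (i, i')" "q = (j, j')" "i \<in> I" "i' \<in> I'" "j \<in> J" "j' \<in> J'" by auto
    have "X i j * Y i' j' = (\<Sum>k<r. \<Sum>k'<r'. (u k i * v k j) * (u' k' i' * v' k' j'))"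
      using 1 2 p by (simp add: sum_product)
    also have "\<dots> = (\<Sum>l\<in>{..<r} \<times> {..<r'}. (case l of (k, k') \<Rightarrow> \<lambda>(i, i'). u k i * u' k' i') p *
        (case l of (k, k') \<Rightarrow> \<lambda>(j, j'). v k j * v' k' j') q)"
      unfolding sum.cartesian_product p(1,2) by (intro sum.cong) (auto simp: ac_simps)
    finally show "(case p of (i, i') \<Rightarrow> \<lambda>(j, j'). X i j * Y i' j') q = \<dots>" unfolding p(1,2) by simp
  qed simp
  then show ?thesis by simp
qed

lemma outer_rank_le_diag:
  assumes "outer_rank_le I J X r"
  shows "outer_rank_le I J (\<lambda>i j. a i * X i j) r"
proof -
  obtain u v where 1: "\<forall>i\<in>I. \<forall>j\<in>J. X i j = (\<Sum>k<r. u k i * v k j)"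
    using assms(1) unfolding outer_rank_le_def by blast
  show ?thesis unfolding outer_rank_le_def
    by (intro exI[of _ "\<lambda>k i. a i * u k i"] exI[of _ v]) (use 1 in \<open>auto simp: sum_distrib_left mult.assoc\<close>)
qed

lemma outer_rank_le_reindex:
  assumes "f \<in> I' \<rightarrow> I" "g \<in> J' \<rightarrow> J" "outer_rank_le I J X r"
  shows "outer_rank_le I' J' (\<lambda>i j. X (f i) (g j)) r"
proof -
  obtain u v where 1: "\<forall>i\<in>I. \<forall>j\<in>J. X i j = (\<Sum>k<r. u k i * v k j)"
    using assms(3) unfolding outer_rank_le_def by blast
  show ?thesis unfolding outer_rank_le_def
    by (intro exI[of _ "\<lambda>k i. u k (f i)"] exI[of _ "\<lambda>k j. v k (g j)"]) (use 1 assms(1,2) in auto)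
qed

section \<open>Norm bounds\<close>

lemma op_bounded_sq:
  assumes "0 \<le> M"
  shows "op_bounded I J X M \<longleftrightarrow>
    (\<forall>y. (\<Sum>i\<in>I. (cmod (\<Sum>j\<in>J. X i j * y j))\<^sup>2) \<le> M\<^sup>2 * (\<Sum>j\<in>J. (cmod (y j))\<^sup>2))"
proof -
  have "L2_set (\<lambda>i. cmod (\<Sum>j\<in>J. X i j * y j)) I \<le> M * L2_set (\<lambda>j. cmod (y j)) J \<longleftrightarrow>
     (\<Sum>i\<in>I. (cmod (\<Sum>j\<in>J. X i j * y j))\<^sup>2) \<le> M\<^sup>2 * (\<Sum>j\<in>J. (cmod (y j))\<^sup>2)" for y
  proof -
    have "M * L2_set (\<lambda>j. cmod (y j)) J = sqrt (M\<^sup>2 * (\<Sum>j\<in>J. (cmod (y j))\<^sup>2))"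
      using assms by (simp add: L2_set_def real_sqrt_mult)
    then show ?thesis by (simp add: L2_set_def)
  qed
  then show ?thesis unfolding op_bounded_def by simp
qed

lemma op_bounded_cong:
  "(\<And>i j. i \<in> I \<Longrightarrow> j \<in> J \<Longrightarrow> X i j = Y i j) \<Longrightarrow> op_bounded I J X M \<longleftrightarrow> op_bounded I J Y M"
  unfolding op_bounded_def by (simp cong: L2_set_cong)

lemma op_bounded_mono: "op_bounded I J X M \<Longrightarrow> M \<le> M' \<Longrightarrow> op_bounded I J X M'"
  unfolding op_bounded_def by (meson L2_set_nonneg mult_right_mono order_trans)

lemma op_bounded_add:
  assumes "op_bounded I J X M" "op_bounded I J Y M'"
  shows "op_bounded I J (\<lambda>i j. X i j + Y i j) (M + M')"
  unfolding op_bounded_def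
proof
  fix y
  have "L2_set (\<lambda>i. cmod (\<Sum>j\<in>J. (X i j + Y i j) * y j)) I \<le>
      L2_set (\<lambda>i. cmod (\<Sum>j\<in>J. X i j * y j) + cmod (\<Sum>j\<in>J. Y i j * y j)) I"
    by (rule L2_set_mono) (simp_all add: distrib_right sum.distrib norm_triangle_ineq)
  also have "\<dots> \<le> L2_set (\<lambda>i. cmod (\<Sum>j\<in>J. X i j * y j)) I + L2_set (\<lambda>i. cmod (\<Sum>j\<in>J. Y i j * y j)) I"
    by (rule L2_set_triangle_ineq)
  also have "\<dots> \<le> M * L2_set (\<lambda>j. cmod (y j)) J + M' * L2_set (\<lambda>j. cmod (y j)) J"
    using assms unfolding op_bounded_def by (intro add_mono) auto
  finally show "L2_set (\<lambda>i. cmod (\<Sum>j\<in>J. (X i j + Y i j) * y j)) I \<le> (M + M') * L2_set (\<lambda>j. cmod (y j)) J"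
    by (simp add: distrib_right)
qed

lemma op_bounded_zero: "op_bounded I J (\<lambda>i j. 0) 0"
  unfolding op_bounded_def by (simp add: L2_set_def)

text \<open>The tensor product factors as X \<otimes> 1 after 1 \<otimes> Y. The vector
  \<open>w\<close> is the result of applying Y in the second coordinate; X is then applied for each
  fixed value of the other one.\<close>

lemma op_bounded_tensor:
  assumes "op_bounded I J X M" "op_bounded I' J' Y M'" "0 \<le> M" "0 \<le> M'" "finite J" "finite J'" "finite I" "finite I'"
  shows "op_bounded (I \<times> I') (J \<times> J') (\<lambda>(i, i') (j, j'). X i j * Y i' j') (M * M')"
proof -
  have X: "(\<Sum>i\<in>I. (cmod (\<Sum>j\<in>J. X i j * y j))\<^sup>2) \<le> M\<^sup>2 * (\<Sum>j\<in>J. (cmod (y j))\<^sup>2)" for y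
    using assms(1,3) op_bounded_sq by blast
  have Y: "(\<Sum>i\<in>I'. (cmod (\<Sum>j\<in>J'. Y i j * y j))\<^sup>2) \<le> M'\<^sup>2 * (\<Sum>j\<in>J'. (cmod (y j))\<^sup>2)" for y
    using assms(2,4) op_bounded_sq by blast
  have "(\<Sum>p\<in>I \<times> I'. (cmod (\<Sum>q\<in>J \<times> J'. (\<lambda>(i, i') (j, j'). X i j * Y i' j') p q * y q))\<^sup>2)
     \<le> (M * M')\<^sup>2 * (\<Sum>q\<in>J \<times> J'. (cmod (y q))\<^sup>2)" for y
  proof -
    define w where "w j i' = (\<Sum>j'\<in>J'. Y i' j' * y (j, j'))" for j i'
    have "(\<Sum>q\<in>J \<times> J'. (case q of (j, j') \<Rightarrow> X i j * Y i' j') * y q) = (\<Sum>j\<in>J. X i j * w j i')" for i i'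
      unfolding w_def sum_distrib_left sum.cartesian_product
      by (intro sum.cong) (auto simp: mult.assoc)
    then have "(\<Sum>p\<in>I \<times> I'. (cmod (\<Sum>q\<in>J \<times> J'. (\<lambda>(i, i') (j, j'). X i j * Y i' j') p q * y q))\<^sup>2)
      = (\<Sum>i\<in>I. \<Sum>i'\<in>I'. (cmod (\<Sum>j\<in>J. X i j * w j i'))\<^sup>2)"
      unfolding sum.cartesian_product by (intro sum.cong) auto
    also have "\<dots> = (\<Sum>i'\<in>I'. \<Sum>i\<in>I. (cmod (\<Sum>j\<in>J. X i j * w j i'))\<^sup>2)"
      by (rule sum.swap)
    also have "\<dots> \<le> (\<Sum>i'\<in>I'. M\<^sup>2 * (\<Sum>j\<in>J. (cmod (w j i'))\<^sup>2))"
      by (intro sum_mono X)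
    also have "\<dots> = M\<^sup>2 * (\<Sum>j\<in>J. \<Sum>i'\<in>I'. (cmod (w j i'))\<^sup>2)"
      unfolding sum_distrib_left[symmetric] by (subst sum.swap) simp
    also have "\<dots> \<le> M\<^sup>2 * (\<Sum>j\<in>J. M'\<^sup>2 * (\<Sum>j'\<in>J'. (cmod (y (j, j')))\<^sup>2))"
      unfolding w_def by (intro mult_left_mono sum_mono Y) auto
    also have "\<dots> = (M * M')\<^sup>2 * (\<Sum>q\<in>J \<times> J'. (cmod (y q))\<^sup>2)"
      by (simp add: sum_distrib_left[symmetric] sum.cartesian_product power_mult_distrib mult.assoc split_def)
    finally show ?thesis .
  qed
  then show ?thesis using assms(3,4) by (subst op_bounded_sq) auto
qed

lemma op_bounded_diag:
  assumes "op_bounded I J X M" "0 \<le> M" "0 \<le> K" "\<And>i. i \<in> I \<Longrightarrow> cmod (a i) \<le> K"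
  shows "op_bounded I J (\<lambda>i j. a i * X i j) (K * M)"
  unfolding op_bounded_def
proof
  fix y
  have "L2_set (\<lambda>i. cmod (\<Sum>j\<in>J. a i * X i j * y j)) I \<le> L2_set (\<lambda>i. K * cmod (\<Sum>j\<in>J. X i j * y j)) I"
  proof (rule L2_set_mono)
    fix i assume "i \<in> I"
    have "(\<Sum>j\<in>J. a i * X i j * y j) = a i * (\<Sum>j\<in>J. X i j * y j)"
      by (simp add: sum_distrib_left mult.assoc)
    then show "cmod (\<Sum>j\<in>J. a i * X i j * y j) \<le> K * cmod (\<Sum>j\<in>J. X i j * y j)"
      using assms(4)[OF \<open>i \<in> I\<close>] by (simp add: norm_mult mult_right_mono)
  qed auto
  also have "\<dots> = K * L2_set (\<lambda>i. cmod (\<Sum>j\<in>J. X i j * y j)) I"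
    using assms(3) by (simp add: L2_set_right_distrib)
  also have "\<dots> \<le> K * (M * L2_set (\<lambda>j. cmod (y j)) J)"
    using assms(1,3) unfolding op_bounded_def by (intro mult_left_mono) auto
  finally show "L2_set (\<lambda>i. cmod (\<Sum>j\<in>J. a i * X i j * y j)) I \<le> K * M * L2_set (\<lambda>j. cmod (y j)) J"
    by (simp add: mult.assoc)
qed

lemma op_bounded_reindex:
  assumes f: "bij_betw f I' I" and g: "bij_betw g J' J" and "op_bounded I J X M"
  shows "op_bounded I' J' (\<lambda>i j. X (f i) (g j)) M"
  unfolding op_bounded_def
proof
  fix y
  define y' where "y' j = (y (the_inv_into J' g j) :: complex)" for j
  have y': "y' (g j) = y j" if "j \<in> J'" for j
    using that g by (simp add: y'_def the_inv_into_f_f bij_betw_imp_inj_on)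
  have 1: "(\<Sum>j\<in>J. X i j * y' j) = (\<Sum>j\<in>J'. X i (g j) * y j)" for i
    using sum.reindex_bij_betw[OF g, of "\<lambda>j. X i j * y' j"] y' by simp
  have 2: "L2_set (\<lambda>j. cmod (y' j)) J = L2_set (\<lambda>j. cmod (y j)) J'"
    unfolding L2_set_def using sum.reindex_bij_betw[OF g, of "\<lambda>j. (cmod (y' j))\<^sup>2"] y' by simp
  have 3: "L2_set (\<lambda>i. cmod (\<Sum>j\<in>J'. X (f i) (g j) * y j)) I' = L2_set (\<lambda>i. cmod (\<Sum>j\<in>J. X i j * y' j)) I"
    unfolding 1 L2_set_def using sum.reindex_bij_betw[OF f, of "\<lambda>i. (cmod (\<Sum>j\<in>J'. X i (g j) * y j))\<^sup>2"] by simp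
  show "L2_set (\<lambda>i. cmod (\<Sum>j\<in>J'. X (f i) (g j) * y j)) I' \<le> M * L2_set (\<lambda>j. cmod (y j)) J'"
    unfolding 2[symmetric] 3 using assms(3) unfolding op_bounded_def by blast
qed

text \<open>For z = X y, testing the form with the conjugate of z gives the square of the norm of z
  on the left, and one factor cancels. The form is bilinear, not sesquilinear, hence the conjugate
  in the test vector.\<close>

lemma op_boundedI_form:
  assumes "finite I" "0 \<le> M"
    and "\<And>x y. cmod (\<Sum>i\<in>I. x i * (\<Sum>j\<in>J. X i j * y j)) \<le> M * L2_set (\<lambda>i. cmod (x i)) I * L2_set (\<lambda>j. cmod (y j)) J"
  shows "op_bounded I J X M"
  unfolding op_bounded_def
proof
  fix y
  define z where "z i = (\<Sum>j\<in>J. X i j * y j)" for i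
  let ?n = "L2_set (\<lambda>i. cmod (z i)) I"
  have "(\<Sum>i\<in>I. cnj (z i) * z i) = of_real (\<Sum>i\<in>I. (cmod (z i))\<^sup>2)"
    unfolding of_real_sum by (intro sum.cong refl) (metis complex_norm_square mult.commute)
  then have "cmod (\<Sum>i\<in>I. cnj (z i) * z i) = \<bar>\<Sum>i\<in>I. (cmod (z i))\<^sup>2\<bar>"
    by (simp only: norm_of_real)
  also have "\<dots> = (\<Sum>i\<in>I. (cmod (z i))\<^sup>2)" by (intro abs_of_nonneg sum_nonneg) simp
  also have "\<dots> = ?n * ?n" by (simp add: L2_set_def sum_nonneg)
  finally have "?n * ?n \<le> M * ?n * L2_set (\<lambda>j. cmod (y j)) J"
    using assms(3)[of "\<lambda>i. cnj (z i)" y, folded z_def, unfolded complex_mod_cnj] by simp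
  then have "?n * ?n \<le> ?n * (M * L2_set (\<lambda>j. cmod (y j)) J)" by (simp add: mult_ac)
  moreover have "0 \<le> M * L2_set (\<lambda>j. cmod (y j)) J" using assms(2) by simp
  ultimately have "?n \<le> M * L2_set (\<lambda>j. cmod (y j)) J"
    using L2_set_nonneg[of "\<lambda>i. cmod (z i)" I] by (cases "?n = 0") (auto simp: mult_le_cancel_left)
  then show "L2_set (\<lambda>i. cmod (\<Sum>j\<in>J. X i j * y j)) I \<le> M * L2_set (\<lambda>j. cmod (y j)) J"
    by (simp add: z_def)
qed

section \<open>Calculus of low rank plus bounded splittings\<close>

lemma splitsI:
  assumes "\<And>i j. i \<in> I \<Longrightarrow> j \<in> J \<Longrightarrow> X i j = R i j + E i j"
    and "outer_rank_le I J R k" "real k \<le> r" "op_bounded I J E M" "0 \<le> M"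
  shows "splits I J X r M"
  unfolding splits_def
  by (intro conjI exI[of _ R] exI[of _ E] exI[of _ k] ballI) (rule assms; assumption)+

lemma splits_cong:
  "(\<And>i j. i \<in> I \<Longrightarrow> j \<in> J \<Longrightarrow> X i j = Y i j) \<Longrightarrow> splits I J X r M \<longleftrightarrow> splits I J Y r M"
  unfolding splits_def by simp

lemma splits_mono: "splits I J X r M \<Longrightarrow> r \<le> r' \<Longrightarrow> M \<le> M' \<Longrightarrow> splits I J X r' M'"
  unfolding splits_def using op_bounded_mono order_trans[of 0 M M'] order_trans[of _ r r'] by blast

lemma splits_add:
  assumes "splits I J X r M" "splits I J Y r' M'"
  shows "splits I J (\<lambda>i j. X i j + Y i j) (r + r') (M + M')"
proof -
  obtain R E k where 1: "\<forall>i\<in>I. \<forall>j\<in>J. X i j = R i j + E i j" "outer_rank_le I J R k" "real k \<le> r" "op_bounded I J E M" "0 \<le> M"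
    using assms(1) unfolding splits_def by blast
  obtain R' E' k' where 2: "\<forall>i\<in>I. \<forall>j\<in>J. Y i j = R' i j + E' i j" "outer_rank_le I J R' k'" "real k' \<le> r'" "op_bounded I J E' M'" "0 \<le> M'"
    using assms(2) unfolding splits_def by blast
  show ?thesis
    by (rule splitsI[OF _ outer_rank_le_add[OF 1(2) 2(2)] _ op_bounded_add[OF 1(4) 2(4)]]) (use 1 2 in auto)
qed

lemma splits_zero: "splits I J (\<lambda>i j. 0) 0 0"
  by (rule splitsI[of _ _ _ "\<lambda>i j. 0" "\<lambda>i j. 0" 0]) (auto simp: outer_rank_le_def op_bounded_zero)

lemma splits_sum:
  assumes "finite K" "\<And>k. k \<in> K \<Longrightarrow> splits I J (X k) (r k) (M k)"
  shows "splits I J (\<lambda>i j. \<Sum>k\<in>K. X k i j) (\<Sum>k\<in>K. r k) (\<Sum>k\<in>K. M k)"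
  using assms by (induction K rule: finite_induct) (auto intro: splits_zero splits_add)

text \<open>Multipliers larger than \<open>K\<close> are replaced by 0. The correction lives in the
  affected rows only, so its rank is at most their number, however large the multipliers
  are.\<close>

lemma splits_diag:
  assumes "splits I J X r M" "finite I" "0 \<le> K" "real (card {i\<in>I. K < cmod (a i)}) \<le> b"
  shows "splits I J (\<lambda>i j. a i * X i j) (r + b) (K * M)"
proof -
  obtain R E k where 1: "\<forall>i\<in>I. \<forall>j\<in>J. X i j = R i j + E i j" "outer_rank_le I J R k" "real k \<le> r" "op_bounded I J E M" "0 \<le> M"
    using assms(1) unfolding splits_def by blast
  define a' where "a' i = (if K < cmod (a i) then 0 else a i)" for i
  have R: "outer_rank_le I J (\<lambda>i j. a i * R i j + (a i - a' i) * E i j) (k + card {i\<in>I. K < cmod (a i)})"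
    by (intro outer_rank_le_add outer_rank_le_diag 1 outer_rank_le_rows) (use assms(2) in \<open>auto simp: a'_def\<close>)
  have E: "op_bounded I J (\<lambda>i j. a' i * E i j) (K * M)"
    by (intro op_bounded_diag 1) (use assms(3) in \<open>auto simp: a'_def\<close>)
  show ?thesis
    by (rule splitsI[OF _ R _ E]) (use 1 assms in \<open>auto simp: algebra_simps\<close>)
qed

text \<open>From X \<otimes> Y = R \<otimes> Y + E \<otimes> R' + E \<otimes> E'. The first two
  terms are charged to the rank, where the norm of the full factor does not matter; only the last
  one is charged to the norm.\<close>

lemma splits_tensor:
  assumes "splits I J X r M" "splits I' J' Y r' M'" "finite I" "finite J" "finite I'" "finite J'"
  shows "splits (I \<times> I') (J \<times> J') (\<lambda>(i, i') (j, j'). X i j * Y i' j')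
    (r * real (min (card I') (card J')) + r' * real (min (card I) (card J))) (M * M')"
proof -
  obtain R E k where 1: "\<forall>i\<in>I. \<forall>j\<in>J. X i j = R i j + E i j" "outer_rank_le I J R k" "real k \<le> r" "op_bounded I J E M" "0 \<le> M"
    using assms(1) unfolding splits_def by blast
  obtain R' E' k' where 2: "\<forall>i\<in>I'. \<forall>j\<in>J'. Y i j = R' i j + E' i j" "outer_rank_le I' J' R' k'" "real k' \<le> r'" "op_bounded I' J' E' M'" "0 \<le> M'"
    using assms(2) unfolding splits_def by blast
  have R: "outer_rank_le (I \<times> I') (J \<times> J') (\<lambda>p q. (\<lambda>(i, i') (j, j'). R i j * Y i' j') p q + (\<lambda>(i, i') (j, j'). E i j * R' i' j') p q)
     (k * min (card I') (card J') + min (card I) (card J) * k')"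
    by (intro outer_rank_le_add outer_rank_le_tensor 1 2 outer_rank_le_min assms)
  have k: "real (k * min (card I') (card J') + min (card I) (card J) * k') \<le>
      r * real (min (card I') (card J')) + r' * real (min (card I) (card J))"
    using mult_right_mono[OF 1(3), of "real (min (card I') (card J'))"] mult_right_mono[OF 2(3), of "real (min (card I) (card J))"]
    by (simp add: mult.commute)
  show ?thesis
    by (rule splitsI[OF _ R k op_bounded_tensor[OF 1(4) 2(4) 1(5) 2(5)]]) (use 1 2 assms in \<open>auto simp: algebra_simps\<close>)
qed

lemma splits_reindex:
  assumes f: "bij_betw f I' I" and g: "bij_betw g J' J" and "splits I J X r M"
  shows "splits I' J' (\<lambda>i j. X (f i) (g j)) r M"
proof -
  obtain R E k where 1: "\<forall>i\<in>I. \<forall>j\<in>J. X i j = R i j + E i j" "outer_rank_le I J R k" "real k \<le> r" "op_bounded I J E M" "0 \<le> M"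
    using assms(3) unfolding splits_def by blast
  have fg: "f \<in> I' \<rightarrow> I" "g \<in> J' \<rightarrow> J" using f g by (auto simp: bij_betw_def)
  show ?thesis
    by (rule splitsI[OF _ outer_rank_le_reindex[OF fg 1(2)] 1(3) op_bounded_reindex[OF f g 1(4)] 1(5)])
       (use 1 fg in auto)
qed

section \<open>Comparison with the rank and the spectral norm of matrices\<close>

text \<open>For one direction, a maximal independent set of columns spans all columns, and the
  coefficients are the second factors of the rank-one terms. For the other, rank is subadditive and
  each term has rank at most one.\<close>

lemma mat_rank_le_iff:
  assumes "R \<in> carrier_mat d e"
  shows "mat_rank R \<le> k \<longleftrightarrow> outer_rank_le {..<d} {..<e} (\<lambda>i j. R $$ (i, j)) k"
proof
  interpret V: vec_space "TYPE(complex)" d .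
  have mr: "mat_rank R = V.rank R" using assms by (simp add: mat_rank_def)
  {
    assume k: "mat_rank R \<le> k"
    let ?S = "set (cols R)"
    have S: "?S \<subseteq> carrier_vec d" using assms cols_dim by blast
    obtain U where U: "maximal U (\<lambda>T. T \<subseteq> ?S \<and> V.lin_indpt T)" "finite U"
      using maximal_exists_superset[of ?S "\<lambda>T. T \<subseteq> ?S \<and> V.lin_indpt T" "{}"] V.lin_dep_def by auto
    have cU: "card U = V.rank R" using V.rank_card_indpt[OF assms U(1)] by simp
    have US: "U \<subseteq> ?S" "V.lin_indpt U" using U(1) unfolding maximal_def by auto
    have sp: "s \<in> V.span U" if "s \<in> ?S" for s
    proof (rule ccontr)
      assume n: "s \<notin> V.span U"
      have sU: "s \<notin> U" using n V.span_mem US S by blast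
      have "V.lin_indpt (U \<union> {s})"
        using V.lin_dep_iff_in_span[of U s] US S n sU that by auto
      then have "U \<union> {s} \<subseteq> U" using U(1) US that unfolding maximal_def by blast
      then show False using sU by blast
    qed
    have "\<exists>a. \<forall>i<d. R $$ (i, j) = (\<Sum>v\<in>U. a v * v $ i)" if j: "j < e" for j
    proof -
      have "col R j \<in> ?S" using j assms by (auto simp: cols_def)
      then have "col R j \<in> V.span U" by (rule sp)
      then obtain a where a: "col R j = V.lincomb a U"
        using V.finite_span[OF U(2)] US S by auto
      have "R $$ (i, j) = (\<Sum>v\<in>U. a v * v $ i)" if "i < d" for i
      proof -
        have "R $$ (i, j) = col R j $ i" using that j assms by simp
        also have "\<dots> = (\<Sum>v\<in>U. a v * v $ i)"
          unfolding a using V.lincomb_index[OF that, of U a] US S by auto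
        finally show ?thesis .
      qed
      then show ?thesis by blast
    qed
    then obtain a where a: "\<And>i j. i < d \<Longrightarrow> j < e \<Longrightarrow> R $$ (i, j) = (\<Sum>v\<in>U. a j v * v $ i)" by metis
    have "outer_rank_le {..<d} {..<e} (\<lambda>i j. R $$ (i, j)) (card U)"
      by (rule outer_rank_le_sum_fin[OF U(2), where u = "\<lambda>v i. v $ i" and v = "\<lambda>v j. a j v"])
         (auto simp: a mult.commute)
    \<comment> \<open>Zero terms pad the sum from the exact rank up to \<open>k\<close>.\<close>
    then have "outer_rank_le {..<d} {..<e} (\<lambda>i j. R $$ (i, j) + 0) (card U + (k - card U))"
      by (rule outer_rank_le_add) (auto simp: outer_rank_le_def intro!: exI[of _ "\<lambda>_ _. 0"])
    then show "outer_rank_le {..<d} {..<e} (\<lambda>i j. R $$ (i, j)) k"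
      using k cU mr by simp
  }
  assume "outer_rank_le {..<d} {..<e} (\<lambda>i j. R $$ (i, j)) k"
  then obtain u v where uv: "\<forall>i<d. \<forall>j<e. R $$ (i, j) = (\<Sum>l<k. u l i * v l j)"
    unfolding outer_rank_le_def by (auto simp: Ball_def)
  have "V.rank (mat d e (\<lambda>(i, j). \<Sum>l<k. u l i * v l j)) \<le> k" for k
  proof (induction k)
    case 0
    have z: "mat d e (\<lambda>(i, j). \<Sum>l<(0::nat). u l i * v l j) = 0\<^sub>m d e" by (rule eq_matI) auto
    show ?case unfolding z V.rank_0I ..
  next
    case (Suc k)
    have "mat d e (\<lambda>(i, j). \<Sum>l<Suc k. u l i * v l j) =
       mat d e (\<lambda>(i, j). \<Sum>l<k. u l i * v l j) + mat d e (\<lambda>(i, j). u k i * v k j)"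
      by (rule eq_matI) auto
    moreover have "V.rank (mat d e (\<lambda>(i, j). u k i * v k j)) \<le> 1"
      by (rule V.rank_le_1_product_entries[where f = "u k" and g = "v k"]) auto
    ultimately show ?case
      using V.rank_subadditive[of "mat d e (\<lambda>(i, j). \<Sum>l<k. u l i * v l j)" e "mat d e (\<lambda>(i, j). u k i * v k j)"] Suc
      by simp
  qed
  moreover have "R = mat d e (\<lambda>(i, j). \<Sum>l<k. u l i * v l j)"
    using assms uv by (intro eq_matI) auto
  ultimately show "mat_rank R \<le> k" unfolding mr by (simp only:)
qed

lemma vec_norm2_mult:
  "E \<in> carrier_mat d e \<Longrightarrow> dim_vec v = e \<Longrightarrow> vec_norm2 (E *\<^sub>v v) = L2_set (\<lambda>i. cmod (\<Sum>j<e. E $$ (i, j) * v $ j)) {..<d}"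
  unfolding vec_norm2_def by (auto simp: scalar_prod_def atLeast0LessThan intro!: L2_set_cong)

text \<open>The real supremum can be compared with its members only once it is known to be bounded
  above; the sum of the moduli of all entries is a crude bound. The rest is scaling to the unit
  ball.\<close>

lemma spectral_norm_le_iff:
  assumes E: "E \<in> carrier_mat d e" and "0 \<le> M"
  shows "spectral_norm E \<le> M \<longleftrightarrow> op_bounded {..<d} {..<e} (\<lambda>i j. E $$ (i, j)) M"
proof
  let ?B = "{v \<in> carrier_vec (dim_col E). vec_norm2 v \<le> 1}"
  have de: "dim_col E = e" using E by simp
  have bdd: "bdd_above ((\<lambda>v. vec_norm2 (E *\<^sub>v v)) ` ?B)"
  proof (rule bdd_aboveI2)
    fix v assume v: "v \<in> ?B"
    then have dv: "dim_vec v = e" using de by simp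
    have vj: "cmod (v $ j) \<le> 1" if "j < e" for j
      using member_le_L2_set[of "{..<e}" j "\<lambda>j. cmod (v $ j)"] that v dv by (simp add: vec_norm2_def)
    have "vec_norm2 (E *\<^sub>v v) \<le> (\<Sum>i<d. cmod (\<Sum>j<e. E $$ (i, j) * v $ j))"
      unfolding vec_norm2_mult[OF E dv] by (rule L2_set_le_sum) simp
    also have "\<dots> \<le> (\<Sum>i<d. \<Sum>j<e. cmod (E $$ (i, j)))"
    proof (intro sum_mono order_trans[OF norm_sum])
      fix i j assume "j \<in> {..<e}"
      then show "cmod (E $$ (i, j) * v $ j) \<le> cmod (E $$ (i, j))"
        using vj[of j] by (simp add: norm_mult mult_left_le)
    qed
    finally show "vec_norm2 (E *\<^sub>v v) \<le> (\<Sum>i<d. \<Sum>j<e. cmod (E $$ (i, j)))" .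
  qed
  {
    assume le: "spectral_norm E \<le> M"
    show "op_bounded {..<d} {..<e} (\<lambda>i j. E $$ (i, j)) M"
      unfolding op_bounded_def
    proof
      fix y
      define n where "n = L2_set (\<lambda>j. cmod (y j)) {..<e}"
      show "L2_set (\<lambda>i. cmod (\<Sum>j<e. E $$ (i, j) * y j)) {..<d} \<le> M * n"
      proof (cases "n = 0")
        case True
        then have "\<forall>j<e. y j = 0" unfolding n_def by (simp add: L2_set_eq_0_iff)
        then show ?thesis using True by (simp add: L2_set_def)
      next
        case False
        then have n: "0 < n" unfolding n_def by (simp add: order_less_le L2_set_nonneg)
        define v where "v = vec e (\<lambda>j. y j / of_real n)"
        have "vec_norm2 v = L2_set (\<lambda>j. (1 / n) * cmod (y j)) {..<e}"
          unfolding vec_norm2_def v_def using n by (auto intro!: L2_set_cong simp: norm_divide)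
        also have "\<dots> = (1 / n) * n" unfolding n_def using n by (intro L2_set_right_distrib[symmetric]) (simp add: n_def)
        finally have "v \<in> ?B" using n by (simp add: de v_def)
        then have "vec_norm2 (E *\<^sub>v v) \<le> spectral_norm E"
          unfolding spectral_norm_def by (intro cSUP_upper bdd)
        then have "vec_norm2 (E *\<^sub>v v) \<le> M" using le by simp
        moreover have "vec_norm2 (E *\<^sub>v v) = L2_set (\<lambda>i. (1 / n) * cmod (\<Sum>j<e. E $$ (i, j) * y j)) {..<d}"
          using n by (subst vec_norm2_mult[OF E])
             (auto simp: v_def norm_divide sum_divide_distrib[symmetric] intro!: L2_set_cong)
        moreover have "\<dots> = (1 / n) * L2_set (\<lambda>i. cmod (\<Sum>j<e. E $$ (i, j) * y j)) {..<d}"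
          using n by (intro L2_set_right_distrib[symmetric]) simp
        ultimately have "(1 / n) * L2_set (\<lambda>i. cmod (\<Sum>j<e. E $$ (i, j) * y j)) {..<d} \<le> M"
          by (simp only:)
        then show ?thesis using n by (simp add: divide_le_eq)
      qed
    qed
  }
  assume b: "op_bounded {..<d} {..<e} (\<lambda>i j. E $$ (i, j)) M"
  \<comment> \<open>The unit ball is nonempty, as bounding a real supremum from above
    requires.\<close>
  have z: "0\<^sub>v e \<in> ?B" by (simp add: de vec_norm2_def L2_set_def)
  show "spectral_norm E \<le> M"
    unfolding spectral_norm_def
  proof (rule cSUP_least)
    fix v assume v: "v \<in> ?B"
    then have dv: "dim_vec v = e" using de by simp
    have "vec_norm2 (E *\<^sub>v v) \<le> M * vec_norm2 v"
      using b unfolding op_bounded_def vec_norm2_mult[OF E dv] by (simp add: vec_norm2_def dv)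
    also have "\<dots> \<le> M" using v \<open>0 \<le> M\<close> by (simp add: mult_left_le)
    finally show "vec_norm2 (E *\<^sub>v v) \<le> M" .
  qed (use z in blast)
qed

text \<open>The decomposition required by the definition of \<open>acs\<close>, in the language of
  splittings.\<close>

lemma splits_mat_iff:
  assumes X: "X \<in> carrier_mat d e" and Y: "Y \<in> carrier_mat d e" and "0 \<le> M"
  shows "(\<exists>R\<in>carrier_mat d e. \<exists>E\<in>carrier_mat d e. X = Y + R + E \<and> real (mat_rank R) \<le> r \<and> spectral_norm E \<le> M)
    \<longleftrightarrow> splits {..<d} {..<e} (\<lambda>i j. X $$ (i, j) - Y $$ (i, j)) r M"
proof
  assume "\<exists>R\<in>carrier_mat d e. \<exists>E\<in>carrier_mat d e. X = Y + R + E \<and> real (mat_rank R) \<le> r \<and> spectral_norm E \<le> M"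
  then obtain R E where RE: "R \<in> carrier_mat d e" "E \<in> carrier_mat d e" "X = Y + R + E" "real (mat_rank R) \<le> r" "spectral_norm E \<le> M"
    by blast
  show "splits {..<d} {..<e} (\<lambda>i j. X $$ (i, j) - Y $$ (i, j)) r M"
    by (rule splitsI[OF _ iffD1[OF mat_rank_le_iff[OF RE(1)] order_refl] RE(4) iffD1[OF spectral_norm_le_iff[OF RE(2) assms(3)] RE(5)]])
       (use RE(1-3) Y assms(3) in auto)
next
  assume "splits {..<d} {..<e} (\<lambda>i j. X $$ (i, j) - Y $$ (i, j)) r M"
  then obtain R E k where RE: "\<forall>i\<in>{..<d}. \<forall>j\<in>{..<e}. X $$ (i, j) - Y $$ (i, j) = R i j + E i j"
    "outer_rank_le {..<d} {..<e} R k" "real k \<le> r" "op_bounded {..<d} {..<e} E M"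
    unfolding splits_def by blast
  define R' E' where "R' = mat d e (\<lambda>(i, j). R i j)" and "E' = mat d e (\<lambda>(i, j). E i j)"
  have car: "R' \<in> carrier_mat d e" "E' \<in> carrier_mat d e" by (simp_all add: R'_def E'_def)
  have "mat_rank R' \<le> k"
    unfolding mat_rank_le_iff[OF car(1)] using RE(2) by (subst outer_rank_le_cong[of _ _ _ R]) (auto simp: R'_def)
  moreover have "spectral_norm E' \<le> M"
    unfolding spectral_norm_le_iff[OF car(2) assms(3)] using RE(4) by (subst op_bounded_cong[of _ _ _ E]) (auto simp: E'_def)
  moreover have "X = Y + R' + E'"
  proof (rule eq_matI)
    fix i j assume "i < dim_row (Y + R' + E')" "j < dim_col (Y + R' + E')"
    then have ij: "i < d" "j < e" using car by auto
    have "X $$ (i, j) - Y $$ (i, j) = R i j + E i j" using RE(1) ij by auto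
    then show "X $$ (i, j) = (Y + R' + E') $$ (i, j)" using ij Y by (simp add: R'_def E'_def algebra_simps)
  qed (use X car in auto)
  ultimately show "\<exists>R\<in>carrier_mat d e. \<exists>E\<in>carrier_mat d e. X = Y + R + E \<and> real (mat_rank R) \<le> r \<and> spectral_norm E \<le> M"
    using car RE(3) by (intro bexI[of _ R'] bexI[of _ E'] conjI) auto
qed

section \<open>Splitting points into two parts\<close>

text \<open>Projecting Lebesgue measure onto some of the coordinates does not preserve measure,
  since fibres are in general of infinite measure; it does pull null sets back to null sets. This is
  enough to transport statements that hold almost everywhere and measurability for
  completions.\<close>

definition nonsingular_map :: "'a measure \<Rightarrow> 'b measure \<Rightarrow> ('a \<Rightarrow> 'b) \<Rightarrow> bool" where
  "nonsingular_map M N T \<longleftrightarrow> T \<in> M \<rightarrow>\<^sub>M N \<and> (\<forall>A\<in>null_sets N. T -` A \<inter> space M \<in> null_sets M)"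

lemma nonsingular_map_AE:
  assumes "nonsingular_map M N T" "AE x in N. P x"
  shows "AE x in M. P (T x)"
proof -
  have T: "T \<in> M \<rightarrow>\<^sub>M N" using assms(1) by (simp add: nonsingular_map_def)
  obtain A where A: "{x\<in>space N. \<not> P x} \<subseteq> A" "A \<in> null_sets N"
    using assms(2) by (rule AE_E3) auto
  have "AE x in M. x \<notin> T -` A \<inter> space M"
    using assms(1) A(2) by (intro AE_not_in) (simp add: nonsingular_map_def)
  with AE_space show ?thesis
    by eventually_elim (use A(1) measurable_space[OF T] in auto)
qed

text \<open>A set of the completion is a measurable set up to a subset of a null set, and preimages
  under \<open>T\<close> respect both.\<close>

lemma nonsingular_map_completion:
  assumes "nonsingular_map M N T"
  shows "T \<in> completion M \<rightarrow>\<^sub>M completion N"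
proof -
  have T: "T \<in> M \<rightarrow>\<^sub>M N" using assms by (simp add: nonsingular_map_def)
  show ?thesis
  proof (rule completion.measurable_completion2)
    show "T \<in> completion M \<rightarrow>\<^sub>M N" using T by (rule measurable_completion)
    show "null_sets N \<subseteq> null_sets (distr (completion M) N T)"
    proof
      fix A assume A: "A \<in> null_sets N"
      then have "T -` A \<inter> space M \<in> null_sets (completion M)"
        using assms by (intro null_sets_completionI) (simp add: nonsingular_map_def)
      then show "A \<in> null_sets (distr (completion M) N T)"
        unfolding null_sets_distr_iff[OF measurable_completion[OF T]] using A by (simp add: null_setsD2)
    qed
  qed
qed

text \<open>Fubini in both directions: almost every slice of a null set is null, the slices are
  pulled back by \<open>T'\<close> and the set of good first coordinates by \<open>T\<close>, and a
  measurable set with almost all slices null is null.\<close>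

lemma nonsingular_map_prod:
  assumes T: "nonsingular_map M N T" and T': "nonsingular_map M' N' T'"
    and "sigma_finite_measure M" "sigma_finite_measure M'" "sigma_finite_measure N" "sigma_finite_measure N'"
  shows "nonsingular_map (M \<Otimes>\<^sub>M M') (N \<Otimes>\<^sub>M N') (map_prod T T')"
proof -
  interpret P: pair_sigma_finite M M' using assms by (simp add: pair_sigma_finite_def)
  interpret Q: pair_sigma_finite N N' using assms by (simp add: pair_sigma_finite_def)
  have [measurable]: "T \<in> M \<rightarrow>\<^sub>M N" "T' \<in> M' \<rightarrow>\<^sub>M N'" using T T' by (auto simp: nonsingular_map_def)
  have m: "map_prod T T' \<in> M \<Otimes>\<^sub>M M' \<rightarrow>\<^sub>M N \<Otimes>\<^sub>M N'"
    by (rule measurable_pair) (simp_all add: comp_def)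
  have "map_prod T T' -` A \<inter> space (M \<Otimes>\<^sub>M M') \<in> null_sets (M \<Otimes>\<^sub>M M')" if A: "A \<in> null_sets (N \<Otimes>\<^sub>M N')" for A
  proof -
    have "AE x in N. AE y in N'. (x, y) \<notin> A"
      using AE_not_in[OF A] by (rule Q.AE_pair)
    then have "AE x in N. AE y in M'. (x, T' y) \<notin> A"
      by eventually_elim (rule nonsingular_map_AE[OF T'])
    then have "AE x in M. AE y in M'. (T x, T' y) \<notin> A"
      by (rule nonsingular_map_AE[OF T])
    moreover have S: "map_prod T T' -` A \<inter> space (M \<Otimes>\<^sub>M M') \<in> sets (M \<Otimes>\<^sub>M M')"
      using m A by (intro measurable_sets[OF m]) auto
    moreover have "{p \<in> space (M \<Otimes>\<^sub>M M'). map_prod T T' p \<notin> A} = space (M \<Otimes>\<^sub>M M') - (map_prod T T' -` A \<inter> space (M \<Otimes>\<^sub>M M'))"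
      by auto
    ultimately have "AE p in M \<Otimes>\<^sub>M M'. map_prod T T' p \<notin> A"
      by (intro P.AE_pair_measure) (simp_all add: sets.compl_sets)
    then have "AE p in M \<Otimes>\<^sub>M M'. p \<notin> map_prod T T' -` A \<inter> space (M \<Otimes>\<^sub>M M')"
      by eventually_elim auto
    then show ?thesis using S by (subst AE_iff_null_sets) auto
  qed
  with m show ?thesis by (simp add: nonsingular_map_def)
qed

section \<open>Lebesgue measure and the parts of a point\<close>

definition fst_part :: "nat \<Rightarrow> point \<Rightarrow> point" where
  "fst_part p x = (\<lambda>r\<in>{..<p}. x r)"

definition snd_part :: "nat \<Rightarrow> nat \<Rightarrow> point \<Rightarrow> point" where
  "snd_part p q x = (\<lambda>r\<in>{..<q}. x (p + r))"

definition join_parts :: "nat \<Rightarrow> nat \<Rightarrow> point \<times> point \<Rightarrow> point" where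
  "join_parts p q = (\<lambda>(x, y). \<lambda>r\<in>{..<p + q}. if r < p then x r else y (r - p))"

lemma space_borel_lebesgue: "space (borel_lebesgue q) = extensional {..<q}"
  by (auto simp: borel_lebesgue_def space_PiM PiE_def)

lemma sigma_finite_borel_lebesgue: "sigma_finite_measure (borel_lebesgue q)"
proof -
  interpret finite_product_sigma_finite "\<lambda>_. lborel :: real measure" "{..<q}"
    by standard simp
  show ?thesis unfolding borel_lebesgue_def by (rule sigma_finite_measure_axioms)
qed

lemma measurable_component_lebesgue [measurable]: "r < q \<Longrightarrow> (\<lambda>x. x r) \<in> borel_lebesgue q \<rightarrow>\<^sub>M borel"
  unfolding borel_lebesgue_def using measurable_component_singleton[of r "{..<q}" "\<lambda>_. lborel"] by simp

lemma measurable_fst_part [measurable]: "fst_part p \<in> borel_lebesgue (p + q) \<rightarrow>\<^sub>M borel_lebesgue p"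
  unfolding fst_part_def borel_lebesgue_def by (intro measurable_restrict measurable_component_singleton) simp

lemma measurable_snd_part [measurable]: "snd_part p q \<in> borel_lebesgue (p + q) \<rightarrow>\<^sub>M borel_lebesgue q"
  unfolding snd_part_def borel_lebesgue_def by (intro measurable_restrict measurable_component_singleton) simp

lemma measurable_join_parts [measurable]:
  "join_parts p q \<in> borel_lebesgue p \<Otimes>\<^sub>M borel_lebesgue q \<rightarrow>\<^sub>M borel_lebesgue (p + q)"
proof -
  have "(\<lambda>z. \<lambda>r\<in>{..<p + q}. if r < p then fst z r else snd z (r - p)) \<in>
     borel_lebesgue p \<Otimes>\<^sub>M borel_lebesgue q \<rightarrow>\<^sub>M PiM {..<p + q} (\<lambda>_. lborel)"
  proof (rule measurable_restrict)
    fix r assume "r \<in> {..<p + q}"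
    then show "(\<lambda>z. if r < p then fst z r else snd z (r - p)) \<in> borel_lebesgue p \<Otimes>\<^sub>M borel_lebesgue q \<rightarrow>\<^sub>M lborel"
      by (cases "r < p")
         (auto intro!: measurable_compose[OF measurable_fst measurable_component_lebesgue]
            measurable_compose[OF measurable_snd measurable_component_lebesgue])
  qed
  then show ?thesis by (simp add: join_parts_def split_def borel_lebesgue_def)
qed

lemma parts_join:
  assumes "x \<in> extensional {..<p}" "y \<in> extensional {..<q}"
  shows "fst_part p (join_parts p q (x, y)) = x" "snd_part p q (join_parts p q (x, y)) = y"
  using assms by (auto simp: fst_part_def snd_part_def join_parts_def extensional_def fun_eq_iff)

lemma prod_lessThan_add:
  fixes p q :: nat
  shows "(\<Prod>r<p + q. f r) = (\<Prod>r<p. f r) * (\<Prod>r<q. f (p + r) :: 'a::comm_monoid_mult)"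
  by (induction q) (simp_all add: mult.assoc)

lemma sum_lessThan_add:
  fixes p q :: nat
  shows "(\<Sum>r<p + q. f r) = (\<Sum>r<p. f r) + (\<Sum>r<q. f (p + r) :: 'a::comm_monoid_add)"
  by (induction q) (simp_all add: add.assoc)

text \<open>A product measure is determined by its values on boxes, and the preimage of a box under
  \<open>join_parts\<close> is a product of two boxes.\<close>

lemma distr_join_parts:
  "distr (borel_lebesgue p \<Otimes>\<^sub>M borel_lebesgue q) (borel_lebesgue (p + q)) (join_parts p q) = borel_lebesgue (p + q)"
proof -
  interpret L: product_sigma_finite "\<lambda>_::nat. lborel :: real measure" by standard
  interpret Q: sigma_finite_measure "borel_lebesgue q" by (rule sigma_finite_borel_lebesgue)
  have "distr (borel_lebesgue p \<Otimes>\<^sub>M borel_lebesgue q) (borel_lebesgue (p + q)) (join_parts p q) = PiM {..<p + q} (\<lambda>_. lborel)"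
  proof (rule L.PiM_eqI)
    fix A :: "nat \<Rightarrow> real set" assume A: "\<And>i. i \<in> {..<p + q} \<Longrightarrow> A i \<in> sets lborel"
    have AE: "Pi\<^sub>E {..<p + q} A \<in> sets (borel_lebesgue (p + q))"
      unfolding borel_lebesgue_def using A by (intro sets_PiM_I_finite) auto
    have 1: "join_parts p q -` Pi\<^sub>E {..<p + q} A \<inter> space (borel_lebesgue p \<Otimes>\<^sub>M borel_lebesgue q) =
       Pi\<^sub>E {..<p} A \<times> Pi\<^sub>E {..<q} (\<lambda>r. A (p + r))"
    proof (intro subset_antisym subsetI)
      fix z assume z: "z \<in> join_parts p q -` Pi\<^sub>E {..<p + q} A \<inter> space (borel_lebesgue p \<Otimes>\<^sub>M borel_lebesgue q)"
      obtain x y where xy: "z = (x, y)" by (cases z)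
      have ext: "x \<in> extensional {..<p}" "y \<in> extensional {..<q}"
        using z by (auto simp: xy space_pair_measure space_borel_lebesgue)
      have m: "join_parts p q (x, y) r \<in> A r" if "r < p + q" for r
        using z that by (auto simp: xy PiE_iff)
      have "x r \<in> A r" if "r < p" for r using m[of r] that by (simp add: join_parts_def)
      moreover have "y r \<in> A (p + r)" if "r < q" for r using m[of "p + r"] that by (simp add: join_parts_def)
      ultimately show "z \<in> Pi\<^sub>E {..<p} A \<times> Pi\<^sub>E {..<q} (\<lambda>r. A (p + r))"
        using ext by (auto simp: xy PiE_iff)
    next
      fix z assume "z \<in> Pi\<^sub>E {..<p} A \<times> Pi\<^sub>E {..<q} (\<lambda>r. A (p + r))"
      then obtain x y where xy: "z = (x, y)" "x \<in> Pi\<^sub>E {..<p} A" "y \<in> Pi\<^sub>E {..<q} (\<lambda>r. A (p + r))"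
        by (cases z) simp
      have "join_parts p q (x, y) r \<in> A r" if "r < p + q" for r
      proof (cases "r < p")
        case False
        then have "y (r - p) \<in> A (p + (r - p))" using that by (intro PiE_mem[OF xy(3)]) simp
        then show ?thesis using False that by (simp add: join_parts_def)
      qed (use xy that in \<open>auto simp: join_parts_def\<close>)
      then show "z \<in> join_parts p q -` Pi\<^sub>E {..<p + q} A \<inter> space (borel_lebesgue p \<Otimes>\<^sub>M borel_lebesgue q)"
        using xy by (auto simp: space_pair_measure space_borel_lebesgue PiE_iff join_parts_def)
    qed
    have s: "Pi\<^sub>E {..<p} A \<in> sets (borel_lebesgue p)" "Pi\<^sub>E {..<q} (\<lambda>r. A (p + r)) \<in> sets (borel_lebesgue q)"
      unfolding borel_lebesgue_def using A by (auto intro!: sets_PiM_I_finite)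
    have "emeasure (distr (borel_lebesgue p \<Otimes>\<^sub>M borel_lebesgue q) (borel_lebesgue (p + q)) (join_parts p q)) (Pi\<^sub>E {..<p + q} A)
      = emeasure (borel_lebesgue p) (Pi\<^sub>E {..<p} A) * emeasure (borel_lebesgue q) (Pi\<^sub>E {..<q} (\<lambda>r. A (p + r)))"
      unfolding emeasure_distr[OF measurable_join_parts AE] 1 by (rule Q.emeasure_pair_measure_Times[OF s])
    also have "\<dots> = (\<Prod>r<p. emeasure lborel (A r)) * (\<Prod>r<q. emeasure lborel (A (p + r)))"
      unfolding borel_lebesgue_def using A by (intro arg_cong2[of _ _ _ _ "(*)"] L.emeasure_PiM) auto
    also have "\<dots> = (\<Prod>r<p + q. emeasure lborel (A r))"
      by (rule prod_lessThan_add[symmetric])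
    finally show "emeasure (distr (borel_lebesgue p \<Otimes>\<^sub>M borel_lebesgue q) (borel_lebesgue (p + q)) (join_parts p q)) (Pi\<^sub>E {..<p + q} A)
      = (\<Prod>r<p + q. emeasure lborel (A r))" .
  qed (simp_all add: borel_lebesgue_def)
  then show ?thesis by (simp add: borel_lebesgue_def)
qed

text \<open>Null sets may be tested after pulling back along \<open>join_parts\<close>, where the
  set in question becomes a null set times a whole space.\<close>

lemma nonsingular_fst_part: "nonsingular_map (borel_lebesgue (p + q)) (borel_lebesgue p) (fst_part p)"
  and nonsingular_snd_part: "nonsingular_map (borel_lebesgue (p + q)) (borel_lebesgue q) (snd_part p q)"
proof -
  interpret Q: sigma_finite_measure "borel_lebesgue q" by (rule sigma_finite_borel_lebesgue)
  let ?P = "borel_lebesgue p \<Otimes>\<^sub>M borel_lebesgue q"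
  have null: "S \<in> null_sets (borel_lebesgue (p + q))"
    if "S \<in> sets (borel_lebesgue (p + q))" "join_parts p q -` S \<inter> space ?P \<in> null_sets ?P" for S
    using that null_sets_distr_iff[OF measurable_join_parts[of p q], of S] unfolding distr_join_parts by auto
  have "fst_part p -` A \<inter> space (borel_lebesgue (p + q)) \<in> null_sets (borel_lebesgue (p + q))"
    if A: "A \<in> null_sets (borel_lebesgue p)" for A
  proof (rule null)
    show "fst_part p -` A \<inter> space (borel_lebesgue (p + q)) \<in> sets (borel_lebesgue (p + q))"
      using A by (intro measurable_sets[OF measurable_fst_part]) auto
    have "join_parts p q -` (fst_part p -` A \<inter> space (borel_lebesgue (p + q))) \<inter> space ?P = A \<times> space (borel_lebesgue q)"
      using sets.sets_into_space[of A "borel_lebesgue p"] A measurable_space[OF measurable_join_parts[of p q]]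
      by (auto simp: space_pair_measure space_borel_lebesgue parts_join null_setsD2)
    then show "join_parts p q -` (fst_part p -` A \<inter> space (borel_lebesgue (p + q))) \<inter> space ?P \<in> null_sets ?P"
      using A Q.times_in_null_sets1 by auto
  qed
  then show "nonsingular_map (borel_lebesgue (p + q)) (borel_lebesgue p) (fst_part p)"
    by (simp add: nonsingular_map_def)
  have "snd_part p q -` A \<inter> space (borel_lebesgue (p + q)) \<in> null_sets (borel_lebesgue (p + q))"
    if A: "A \<in> null_sets (borel_lebesgue q)" for A
  proof (rule null)
    show "snd_part p q -` A \<inter> space (borel_lebesgue (p + q)) \<in> sets (borel_lebesgue (p + q))"
      using A by (intro measurable_sets[OF measurable_snd_part]) auto
    have "join_parts p q -` (snd_part p q -` A \<inter> space (borel_lebesgue (p + q))) \<inter> space ?P = space (borel_lebesgue p) \<times> A"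
      using sets.sets_into_space[of A "borel_lebesgue q"] A measurable_space[OF measurable_join_parts[of p q]]
      by (auto simp: space_pair_measure space_borel_lebesgue parts_join null_setsD2)
    then show "join_parts p q -` (snd_part p q -` A \<inter> space (borel_lebesgue (p + q))) \<inter> space ?P \<in> null_sets ?P"
      using A Q.times_in_null_sets2 by auto
  qed
  then show "nonsingular_map (borel_lebesgue (p + q)) (borel_lebesgue q) (snd_part p q)"
    by (simp add: nonsingular_map_def)
qed

lemma unit_cube_parts: "x \<in> unit_cube (p + q) \<Longrightarrow> fst_part p x \<in> unit_cube p"
  "x \<in> unit_cube (p + q) \<Longrightarrow> snd_part p q x \<in> unit_cube q"
  by (auto simp: unit_cube_def fst_part_def snd_part_def PiE_iff)

lemma pi_cube_parts: "x \<in> pi_cube (p + q) \<Longrightarrow> fst_part p x \<in> pi_cube p"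
  "x \<in> pi_cube (p + q) \<Longrightarrow> snd_part p q x \<in> pi_cube q"
  by (auto simp: pi_cube_def fst_part_def snd_part_def PiE_iff)

lemma pi_cube_iff:
  "x \<in> extensional {..<p + q} \<Longrightarrow> x \<in> pi_cube (p + q) \<longleftrightarrow> fst_part p x \<in> pi_cube p \<and> snd_part p q x \<in> pi_cube q"
proof (intro iffI conjI pi_cube_parts; (elim conjE)?)
  assume x: "x \<in> extensional {..<p + q}" "fst_part p x \<in> pi_cube p" "snd_part p q x \<in> pi_cube q"
  have "x r \<in> {- pi..pi}" if "r < p + q" for r
  proof (cases "r < p")
    case True
    then have "fst_part p x r \<in> {- pi..pi}" using PiE_mem[OF x(2)[unfolded pi_cube_def], of r] by simp
    then show ?thesis using True by (simp add: fst_part_def)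
  next
    case False
    then have "snd_part p q x (r - p) \<in> {- pi..pi}" using that PiE_mem[OF x(3)[unfolded pi_cube_def], of "r - p"] by simp
    moreover have "r - p < q" "p + (r - p) = r" using False that by simp_all
    then have "snd_part p q x (r - p) = x r" by (simp add: snd_part_def)
    ultimately show ?thesis by simp
  qed
  then show "x \<in> pi_cube (p + q)" using x(1) by (auto simp: pi_cube_def PiE_iff)
qed

lemma sets_cubes [measurable]:
  "unit_cube q \<in> sets (borel_lebesgue q)" "pi_cube q \<in> sets (borel_lebesgue q)"
  unfolding unit_cube_def pi_cube_def borel_lebesgue_def by (auto intro!: sets_PiM_I_finite)

text \<open>Removes the restriction and the completion at once, so that arguments almost everywhere
  run in the Borel product measure.\<close>

lemma AE_unit_measure: "(AE x in unit_measure q. P x) \<longleftrightarrow> (AE x in borel_lebesgue q. x \<in> unit_cube q \<longrightarrow> P x)"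
  unfolding unit_measure_def
  by (subst AE_restrict_space_iff) (auto simp: AE_completion_iff intro!: sets.Int)

lemma AE_symbol_measure:
  "(AE z in symbol_measure q. P z) \<longleftrightarrow>
   (AE z in borel_lebesgue q \<Otimes>\<^sub>M borel_lebesgue q. z \<in> unit_cube q \<times> pi_cube q \<longrightarrow> P z)"
  unfolding symbol_measure_def
  by (subst AE_restrict_space_iff) (auto simp: AE_completion_iff intro!: sets.Int)

lemma nonsingular_fst_part2:
  "nonsingular_map (borel_lebesgue (p + q) \<Otimes>\<^sub>M borel_lebesgue (p + q)) (borel_lebesgue p \<Otimes>\<^sub>M borel_lebesgue p)
     (map_prod (fst_part p) (fst_part p))"
  and nonsingular_snd_part2:
  "nonsingular_map (borel_lebesgue (p + q) \<Otimes>\<^sub>M borel_lebesgue (p + q)) (borel_lebesgue q \<Otimes>\<^sub>M borel_lebesgue q)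
     (map_prod (snd_part p q) (snd_part p q))"
  by (intro nonsingular_map_prod nonsingular_fst_part nonsingular_snd_part sigma_finite_borel_lebesgue)+

text \<open>Off its cube a symbol is arbitrary. Multiplication by indicators first gives functions
  measurable on the whole space, to which composition with maps between completions applies; on the
  joint cube the indicators of the parts equal 1.\<close>

lemma measurable_symbol_parts:
  fixes f g :: "point \<times> point \<Rightarrow> complex"
  assumes "f \<in> borel_measurable (symbol_measure p)" "g \<in> borel_measurable (symbol_measure q)"
  shows "(\<lambda>z. f (map_prod (fst_part p) (fst_part p) z) * g (map_prod (snd_part p q) (snd_part p q) z))
    \<in> borel_measurable (symbol_measure (p + q))"
proof -
  let ?M = "\<lambda>q. completion (borel_lebesgue q \<Otimes>\<^sub>M borel_lebesgue q)"
  let ?C = "\<lambda>q. unit_cube q \<times> pi_cube q"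
  have C: "?C q \<inter> space (?M q) \<in> sets (?M q)" for q by (intro sets.Int) auto
  have f: "(\<lambda>z. indicator (?C p) z *\<^sub>R f z) \<in> borel_measurable (?M p)"
    using assms(1) unfolding symbol_measure_def borel_measurable_restrict_space_iff[OF C] by (simp add: mult.commute)
  have g: "(\<lambda>z. indicator (?C q) z *\<^sub>R g z) \<in> borel_measurable (?M q)"
    using assms(2) unfolding symbol_measure_def borel_measurable_restrict_space_iff[OF C] by (simp add: mult.commute)
  note f' = measurable_compose[OF nonsingular_map_completion[OF nonsingular_fst_part2[of p q]] f]
  note g' = measurable_compose[OF nonsingular_map_completion[OF nonsingular_snd_part2[of p q]] g]
  have I: "indicator (?C (p + q)) \<in> borel_measurable (?M (p + q))"
    by (intro borel_measurable_indicator sets_completionI_sets) auto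
  have "(\<lambda>z. indicator (?C (p + q)) z *\<^sub>R
     ((indicator (?C p) (map_prod (fst_part p) (fst_part p) z) *\<^sub>R f (map_prod (fst_part p) (fst_part p) z)) *
      (indicator (?C q) (map_prod (snd_part p q) (snd_part p q) z) *\<^sub>R g (map_prod (snd_part p q) (snd_part p q) z))))
      \<in> borel_measurable (?M (p + q))"
    by (intro borel_measurable_scaleR borel_measurable_times f' g' I)
  note meas = this
  have eq: "indicator (?C (p + q)) z *\<^sub>R
     ((indicator (?C p) (map_prod (fst_part p) (fst_part p) z) *\<^sub>R f (map_prod (fst_part p) (fst_part p) z)) *
      (indicator (?C q) (map_prod (snd_part p q) (snd_part p q) z) *\<^sub>R g (map_prod (snd_part p q) (snd_part p q) z)))
      = indicator (?C (p + q)) z *\<^sub>R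
       (f (map_prod (fst_part p) (fst_part p) z) * g (map_prod (snd_part p q) (snd_part p q) z))" for z
    by (cases z) (auto simp: indicator_def unit_cube_parts pi_cube_parts)
  show ?thesis
    unfolding symbol_measure_def borel_measurable_restrict_space_iff[OF C] using meas unfolding eq .
qed

lemma continuous_parts:
  "continuous_on S (fst_part p)" "continuous_on S (snd_part p q)"
proof -
  have c: "continuous_on S (\<lambda>x::point. x r)" for r
    by (rule continuous_on_product_then_coordinatewise) (rule continuous_on_id)
  have "continuous_on S (\<lambda>x. fst_part p x r)" for r
    by (cases "r < p") (auto simp: fst_part_def intro: c)
  then show "continuous_on S (fst_part p)" by (rule continuous_on_coordinatewise_then_product)
  have "continuous_on S (\<lambda>x. snd_part p q x r)" for r
    by (cases "r < q") (auto simp: snd_part_def intro: c)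
  then show "continuous_on S (snd_part p q)" by (rule continuous_on_coordinatewise_then_product)
qed

text \<open>The product can be discontinuous at a point only if one of the factors is discontinuous
  at its part of the point, and both exceptional sets are preimages of null sets.\<close>

lemma AE_continuous_parts:
  fixes a b :: "point \<Rightarrow> complex"
  assumes "AE x in unit_measure p. continuous (at x within unit_cube p) a"
    and "AE x in unit_measure q. continuous (at x within unit_cube q) b"
  shows "AE x in unit_measure (p + q). continuous (at x within unit_cube (p + q)) (\<lambda>x. a (fst_part p x) * b (snd_part p q x))"
proof -
  note * = assms[unfolded AE_unit_measure]
  show ?thesis
    unfolding AE_unit_measure
    using nonsingular_map_AE[OF nonsingular_fst_part *(1)] nonsingular_map_AE[OF nonsingular_snd_part *(2)]
  proof eventually_elim
    case (elim x)
    show ?case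
    proof
      assume x: "x \<in> unit_cube (p + q)"
      have "continuous (at (fst_part p x) within fst_part p ` unit_cube (p + q)) a"
        by (rule continuous_within_subset[OF mp[OF elim(1) unit_cube_parts(1)[OF x]] image_subsetI[OF unit_cube_parts(1)]])
      then have 1: "continuous (at x within unit_cube (p + q)) (\<lambda>x. a (fst_part p x))"
        by (rule continuous_within_compose2[OF bspec[OF iffD1[OF continuous_on_eq_continuous_within continuous_parts(1)] x]])
      have "continuous (at (snd_part p q x) within snd_part p q ` unit_cube (p + q)) b"
        by (rule continuous_within_subset[OF mp[OF elim(2) unit_cube_parts(2)[OF x]] image_subsetI[OF unit_cube_parts(2)]])
      then have 2: "continuous (at x within unit_cube (p + q)) (\<lambda>x. b (snd_part p q x))"
        by (rule continuous_within_compose2[OF bspec[OF iffD1[OF continuous_on_eq_continuous_within continuous_parts(2)] x]])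
      show "continuous (at x within unit_cube (p + q)) (\<lambda>x. a (fst_part p x) * b (snd_part p q x))"
        using 1 2 by (rule continuous_mult)
    qed
  qed
qed

section \<open>Integrals of products over the frequency cube\<close>

lemma completion_ex_borel_measurable_complex:
  fixes g :: "'a \<Rightarrow> complex"
  assumes g: "g \<in> borel_measurable (completion M)"
  shows "\<exists>g'\<in>borel_measurable M. (AE x in M. g x = g' x)"
proof -
  have "(\<lambda>x. Re (g x)) \<in> borel_measurable (completion M)" "(\<lambda>x. Im (g x)) \<in> borel_measurable (completion M)"
    using g by measurable
  from this[THEN completion_ex_borel_measurable_real]
  obtain u v where [measurable]: "u \<in> borel_measurable M" "v \<in> borel_measurable M"
    and ae: "AE x in M. Re (g x) = u x" "AE x in M. Im (g x) = v x" by blast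
  have "(\<lambda>x. Complex (u x) (v x)) \<in> borel_measurable M"
    unfolding Complex_eq by measurable
  moreover have "AE x in M. g x = Complex (u x) (v x)"
    using ae by eventually_elim (simp add: complex_eq_iff)
  ultimately show ?thesis by (intro bexI[of _ "\<lambda>x. Complex (u x) (v x)"])
qed

lemma integrable_completion_AE:
  fixes f :: "'a \<Rightarrow> complex"
  assumes "integrable (completion M) f"
  obtains g where "integrable M g" "AE x in M. f x = g x" "integral\<^sup>L M g = integral\<^sup>L (completion M) f"
proof -
  obtain g where g: "g \<in> borel_measurable M" "AE x in M. f x = g x"
    using completion_ex_borel_measurable_complex[OF borel_measurable_integrable[OF assms]] by blast
  have c: "AE x in completion M. f x = g x" using g(2) by (rule AE_completion)
  have gc: "g \<in> borel_measurable (completion M)" using g(1) by (rule measurable_completion)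
  have "integrable (completion M) g"
    using assms integrable_cong_AE[OF borel_measurable_integrable[OF assms] gc c] by simp
  moreover have "integral\<^sup>L (completion M) f = integral\<^sup>L (completion M) g"
    by (rule integral_cong_AE[OF borel_measurable_integrable[OF assms] gc c])
  ultimately show thesis
    using that[OF _ g(2)] integrable_completion[OF g(1)] integral_completion[OF g(1)] by simp
qed

lemma integrable_pi_measure_iff:
  fixes f :: "point \<Rightarrow> complex"
  shows "integrable (pi_measure q) f \<longleftrightarrow> integrable (completion (borel_lebesgue q)) (\<lambda>x. indicator (pi_cube q) x *\<^sub>R f x)"
  unfolding pi_measure_def by (intro integrable_restrict_space sets.Int) auto

lemma integral_pi_measure:
  fixes f :: "point \<Rightarrow> complex"
  shows "integral\<^sup>L (pi_measure q) f = integral\<^sup>L (completion (borel_lebesgue q)) (\<lambda>x. indicator (pi_cube q) x *\<^sub>R f x)"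
  unfolding pi_measure_def by (intro integral_restrict_space sets.Int) auto

text \<open>Fubini concerns the product of the Borel measures, not of their completions. Hence
  \<open>f\<close> and \<open>g\<close>, extended by 0, are replaced by Borel versions
  \<open>u\<close> and \<open>v\<close>; their product is integrated by Fubini through
  \<open>join_parts\<close>, and equality almost everywhere is pulled back along the parts.\<close>

lemma pi_measure_parts:
  fixes f g :: "point \<Rightarrow> complex"
  assumes "integrable (pi_measure p) f" "integrable (pi_measure q) g"
  shows "integrable (pi_measure (p + q)) (\<lambda>x. f (fst_part p x) * g (snd_part p q x))"
    and "integral\<^sup>L (pi_measure (p + q)) (\<lambda>x. f (fst_part p x) * g (snd_part p q x)) =
      integral\<^sup>L (pi_measure p) f * integral\<^sup>L (pi_measure q) g"
proof -
  let ?B = "borel_lebesgue"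
  interpret P: pair_sigma_finite "?B p" "?B q" by (simp add: pair_sigma_finite_def sigma_finite_borel_lebesgue)
  obtain u where u: "integrable (?B p) u" "AE x in ?B p. indicator (pi_cube p) x *\<^sub>R f x = u x"
    "integral\<^sup>L (?B p) u = integral\<^sup>L (pi_measure p) f"
    using integrable_completion_AE assms(1) unfolding integrable_pi_measure_iff integral_pi_measure by blast
  obtain v where v: "integrable (?B q) v" "AE x in ?B q. indicator (pi_cube q) x *\<^sub>R g x = v x"
    "integral\<^sup>L (?B q) v = integral\<^sup>L (pi_measure q) g"
    using integrable_completion_AE assms(2) unfolding integrable_pi_measure_iff integral_pi_measure by blast
  have [measurable]: "u \<in> borel_measurable (?B p)" "v \<in> borel_measurable (?B q)"
    using u(1) v(1) by auto
  define w where "w x = u (fst_part p x) * v (snd_part p q x)" for x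
  have [measurable]: "w \<in> borel_measurable (?B (p + q))" unfolding w_def by measurable
  have uv: "integrable (?B p \<Otimes>\<^sub>M ?B q) (\<lambda>(x, y). u x * v y)"
    using u(1) v(1) by (intro P.Fubini_integrable) (auto simp: norm_mult)
  have wj: "w (join_parts p q z) = (\<lambda>(x, y). u x * v y) z" if "z \<in> space (?B p \<Otimes>\<^sub>M ?B q)" for z
    using that by (cases z) (auto simp: w_def space_pair_measure space_borel_lebesgue parts_join)
  have "integrable (?B p \<Otimes>\<^sub>M ?B q) (\<lambda>z. w (join_parts p q z))"
    using uv wj by (subst Bochner_Integration.integrable_cong[OF refl, of _ _ "\<lambda>(x, y). u x * v y"]) auto
  then have w: "integrable (?B (p + q)) w"
    using integrable_distr_eq[OF measurable_join_parts[of p q], of w] unfolding distr_join_parts by simp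
  have "integral\<^sup>L (?B (p + q)) w = (\<integral>z. w (join_parts p q z) \<partial>(?B p \<Otimes>\<^sub>M ?B q))"
    using integral_distr[OF measurable_join_parts[of p q], of w] unfolding distr_join_parts by simp
  also have "\<dots> = (\<integral>z. (case z of (x, y) \<Rightarrow> u x * v y) \<partial>(?B p \<Otimes>\<^sub>M ?B q))"
    using wj by (intro Bochner_Integration.integral_cong) auto
  also have "\<dots> = (\<integral>x. \<integral>y. u x * v y \<partial>?B q \<partial>?B p)"
    using P.integral_fst'[OF uv] by simp
  also have "\<dots> = integral\<^sup>L (?B p) u * integral\<^sup>L (?B q) v"
    by simp
  finally have iw: "integral\<^sup>L (?B (p + q)) w = integral\<^sup>L (pi_measure p) f * integral\<^sup>L (pi_measure q) g"
    using u(3) v(3) by simp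
  define h where "h x = indicator (pi_cube (p + q)) x *\<^sub>R (f (fst_part p x) * g (snd_part p q x))" for x
  have "AE x in ?B (p + q). h x = w x"
    using nonsingular_map_AE[OF nonsingular_fst_part u(2)] nonsingular_map_AE[OF nonsingular_snd_part v(2)] AE_space
  proof eventually_elim
    case (elim x)
    then show ?case
      using pi_cube_iff[of x p q] by (auto simp: h_def w_def space_borel_lebesgue indicator_def split: if_splits)
  qed
  then have hw: "AE x in completion (?B (p + q)). w x = h x" by (intro AE_completion) auto
  have wc: "integrable (completion (?B (p + q))) w" using w by (simp add: integrable_completion)
  \<comment> \<open>The indicators of the two smaller cubes change nothing on the joint cube, but
    turn \<open>f\<close> and \<open>g\<close> into functions measurable on the whole space before
    they are composed.\<close>
  have hm: "h \<in> borel_measurable (completion (?B (p + q)))"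
  proof -
    have "(\<lambda>x. indicator (pi_cube (p + q)) x *\<^sub>R
       ((indicator (pi_cube p) (fst_part p x) *\<^sub>R f (fst_part p x)) * (indicator (pi_cube q) (snd_part p q x) *\<^sub>R g (snd_part p q x))))
       \<in> borel_measurable (completion (?B (p + q)))"
      using assms unfolding integrable_pi_measure_iff
      by (intro borel_measurable_scaleR borel_measurable_times borel_measurable_indicator sets_completionI_sets sets_cubes
          measurable_compose[OF nonsingular_map_completion[OF nonsingular_fst_part], of _ p]
          measurable_compose[OF nonsingular_map_completion[OF nonsingular_snd_part], of _ q] borel_measurable_integrable)
    moreover have "indicator (pi_cube (p + q)) x *\<^sub>R
       ((indicator (pi_cube p) (fst_part p x) *\<^sub>R f (fst_part p x)) * (indicator (pi_cube q) (snd_part p q x) *\<^sub>R g (snd_part p q x)))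
       = h x" for x
      unfolding h_def by (simp add: indicator_def pi_cube_parts)
    ultimately show ?thesis by (simp only:)
  qed
  show "integrable (pi_measure (p + q)) (\<lambda>x. f (fst_part p x) * g (snd_part p q x))"
    unfolding integrable_pi_measure_iff h_def[symmetric]
    using wc hw hm integrable_cong_AE[OF borel_measurable_integrable[OF wc] hm hw] by simp
  show "integral\<^sup>L (pi_measure (p + q)) (\<lambda>x. f (fst_part p x) * g (snd_part p q x)) =
      integral\<^sup>L (pi_measure p) f * integral\<^sup>L (pi_measure q) g"
    unfolding integral_pi_measure[of "p + q"] h_def[symmetric]
    using integral_cong_AE[OF borel_measurable_integrable[OF wc] hm hw] iw integral_completion[of w "?B (p + q)"] by simp
qed

section \<open>Toeplitz forms\<close>

definition orthonormal_family :: "'i set \<Rightarrow> nat \<Rightarrow> (nat \<Rightarrow> 'i \<Rightarrow> complex) \<Rightarrow> bool" where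
  "orthonormal_family I r v \<longleftrightarrow> (\<forall>k<r. \<forall>l<r. (\<Sum>i\<in>I. v k i * cnj (v l i)) = of_bool (k = l))"

lemma sum_cnj_self: "(\<Sum>i\<in>I. x i * cnj (x i)) = of_real (\<Sum>i\<in>I. (cmod (x i))\<^sup>2)"
  unfolding of_real_sum complex_norm_square ..

lemma proj_orthogonal:
  fixes y :: "'i \<Rightarrow> complex"
  assumes "orthonormal_family I r v" "finite I" "l < r"
  defines "c \<equiv> \<lambda>k. \<Sum>i\<in>I. y i * cnj (v k i)"
  shows "(\<Sum>i\<in>I. (y i - (\<Sum>k<r. c k * v k i)) * cnj (v l i)) = 0"
proof -
  have "(\<Sum>i\<in>I. (y i - (\<Sum>k<r. c k * v k i)) * cnj (v l i)) = c l - (\<Sum>i\<in>I. \<Sum>k<r. c k * (v k i * cnj (v l i)))"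
    by (simp add: left_diff_distrib sum_subtractf c_def sum_distrib_right mult.assoc)
  also have "(\<Sum>i\<in>I. \<Sum>k<r. c k * (v k i * cnj (v l i))) = (\<Sum>k<r. c k * (\<Sum>i\<in>I. v k i * cnj (v l i)))"
    by (subst sum.swap) (simp add: sum_distrib_left)
  also have "\<dots> = (\<Sum>k<r. if k = l then c l else 0)"
    using assms(1,3) by (intro sum.cong) (auto simp: orthonormal_family_def)
  also have "\<dots> = c l" using assms(3) by simp
  finally show ?thesis by simp
qed

text \<open>Pythagoras: the residual p is orthogonal to every \<open>v k\<close>, so its product
  with itself equals its product with y, which expands to the difference of the two sums.\<close>

lemma proj_norm:
  fixes y :: "'i \<Rightarrow> complex"
  assumes "orthonormal_family I r v" "finite I"
  defines "c \<equiv> \<lambda>k. \<Sum>i\<in>I. y i * cnj (v k i)"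
  shows "(\<Sum>i\<in>I. (cmod (y i - (\<Sum>k<r. c k * v k i)))\<^sup>2) + (\<Sum>k<r. (cmod (c k))\<^sup>2) = (\<Sum>i\<in>I. (cmod (y i))\<^sup>2)"
proof -
  define p where "p i = y i - (\<Sum>k<r. c k * v k i)" for i
  have "(\<Sum>i\<in>I. p i * cnj (p i)) = (\<Sum>i\<in>I. p i * cnj (y i)) - (\<Sum>i\<in>I. p i * cnj (\<Sum>k<r. c k * v k i))"
    by (simp add: p_def[of _] right_diff_distrib sum_subtractf del: cnj_sum)
  also have "(\<Sum>i\<in>I. p i * cnj (\<Sum>k<r. c k * v k i)) = (\<Sum>k<r. cnj (c k) * (\<Sum>i\<in>I. p i * cnj (v k i)))"
    by (simp add: sum_distrib_left) (subst sum.swap, simp add: mult_ac)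
  also have "\<dots> = 0"
    using proj_orthogonal[OF assms(1,2), of _ y] by (simp add: p_def c_def)
  also have "(\<Sum>i\<in>I. p i * cnj (y i)) = (\<Sum>i\<in>I. y i * cnj (y i)) - (\<Sum>i\<in>I. \<Sum>k<r. c k * (v k i * cnj (y i)))"
    by (simp add: p_def left_diff_distrib sum_subtractf sum_distrib_right mult.assoc)
  also have "(\<Sum>i\<in>I. \<Sum>k<r. c k * (v k i * cnj (y i))) = (\<Sum>k<r. c k * cnj (c k))"
  proof -
    have "(\<Sum>i\<in>I. v k i * cnj (y i)) = cnj (c k)" for k by (simp add: c_def mult.commute)
    then show ?thesis by (subst sum.swap) (simp only: sum_distrib_left[symmetric])
  qed
  finally have "of_real (\<Sum>i\<in>I. (cmod (p i))\<^sup>2) = (of_real (\<Sum>i\<in>I. (cmod (y i))\<^sup>2) - of_real (\<Sum>k<r. (cmod (c k))\<^sup>2) :: complex)"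
    unfolding sum_cnj_self by simp
  then have "(of_real (\<Sum>i\<in>I. (cmod (p i))\<^sup>2) :: complex) = of_real ((\<Sum>i\<in>I. (cmod (y i))\<^sup>2) - (\<Sum>k<r. (cmod (c k))\<^sup>2))"
    by (simp only: of_real_diff)
  then have "(\<Sum>i\<in>I. (cmod (p i))\<^sup>2) = (\<Sum>i\<in>I. (cmod (y i))\<^sup>2) - (\<Sum>k<r. (cmod (c k))\<^sup>2)"
    by (simp only: of_real_eq_iff)
  then show ?thesis by (simp add: p_def)
qed

lemma bessel:
  assumes "orthonormal_family I r v" "finite I"
  shows "(\<Sum>k<r. (cmod (\<Sum>i\<in>I. y i * cnj (v k i)))\<^sup>2) \<le> (\<Sum>i\<in>I. (cmod (y i))\<^sup>2)"
  using proj_norm[OF assms, of y] sum_nonneg[of I "\<lambda>i. (cmod (y i - (\<Sum>k<r. (\<Sum>i\<in>I. y i * cnj (v k i)) * v k i)))\<^sup>2"]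
  by simp

section \<open>Matrices of integral forms with unimodular test functions\<close>

text \<open>Isolates what the estimate takes from Toeplitz matrices: the entries are integrals of f
  against products of functions of modulus 1.\<close>

locale integral_form =
  fixes M :: "'a measure" and f :: "'a \<Rightarrow> complex" and \<phi> :: "'i \<Rightarrow> 'a \<Rightarrow> complex" and I :: "'i set"
  assumes f: "integrable M f" and fin: "finite I"
    and \<phi>_meas: "\<And>i. i \<in> I \<Longrightarrow> \<phi> i \<in> borel_measurable M"
    and \<phi>_norm: "\<And>i x. i \<in> I \<Longrightarrow> x \<in> space M \<Longrightarrow> cmod (\<phi> i x) = 1"
begin

definition ev :: "('i \<Rightarrow> complex) \<Rightarrow> 'a \<Rightarrow> complex" where
  "ev y x = (\<Sum>i\<in>I. y i * \<phi> i x)"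

text \<open>The quadratic form of the positive semidefinite matrix built from |f| in place of
  f.\<close>

definition energy :: "('i \<Rightarrow> complex) \<Rightarrow> real" where
  "energy y = (\<integral>x. cmod (f x) * (cmod (ev y x))\<^sup>2 \<partial>M)"

lemma ev_meas [measurable]: "ev y \<in> borel_measurable M"
  unfolding ev_def using \<phi>_meas by (intro borel_measurable_sum borel_measurable_times) auto

lemma ev_bound: "x \<in> space M \<Longrightarrow> cmod (ev y x) \<le> (\<Sum>i\<in>I. cmod (y i))"
  unfolding ev_def by (rule order_trans[OF norm_sum]) (simp add: norm_mult \<phi>_norm)

lemma energy_integrable: "integrable M (\<lambda>x. cmod (f x) * (cmod (ev y x))\<^sup>2)"
proof (rule Bochner_Integration.integrable_bound)
  show "integrable M (\<lambda>x. (\<Sum>i\<in>I. cmod (y i))\<^sup>2 * cmod (f x))"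
    using f by simp
  show "(\<lambda>x. cmod (f x) * (cmod (ev y x))\<^sup>2) \<in> borel_measurable M"
    using f by (intro borel_measurable_times borel_measurable_power borel_measurable_norm ev_meas) auto
  show "AE x in M. norm (cmod (f x) * (cmod (ev y x))\<^sup>2) \<le> norm ((\<Sum>i\<in>I. cmod (y i))\<^sup>2 * cmod (f x))"
    using ev_bound by (intro AE_I2) (auto simp: mult.commute intro!: mult_left_mono power_mono)
qed

lemma energy_scale: "energy (\<lambda>i. c * y i) = (cmod c)\<^sup>2 * energy y"
proof -
  have "ev (\<lambda>i. c * y i) x = c * ev y x" for x by (simp add: ev_def sum_distrib_left mult.assoc)
  then show ?thesis unfolding energy_def
    by (simp add: norm_mult power_mult_distrib mult.left_commute del: integral_mult_right_zero flip: integral_mult_right_zero)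
qed

text \<open>A trace inequality. Pointwise it is Bessel's inequality for the vector of the conjugates
  of \<open>\<phi> i x\<close>, whose squared norm is \<open>card I\<close>; integrating against |f|
  gives the claim.\<close>

lemma energy_family:
  assumes v: "orthonormal_family I r v"
  shows "(\<Sum>k<r. energy (v k)) \<le> card I * (\<integral>x. cmod (f x) \<partial>M)"
proof -
  have "(\<Sum>k<r. energy (v k)) = (\<integral>x. (\<Sum>k<r. cmod (f x) * (cmod (ev (v k) x))\<^sup>2) \<partial>M)"
    unfolding energy_def using energy_integrable by (simp add: Bochner_Integration.integral_sum)
  also have "\<dots> \<le> (\<integral>x. card I * cmod (f x) \<partial>M)"
  proof (rule integral_mono)
    fix x assume x: "x \<in> space M"
    have "(\<Sum>k<r. (cmod (ev (v k) x))\<^sup>2) = (\<Sum>k<r. (cmod (\<Sum>i\<in>I. cnj (\<phi> i x) * cnj (v k i)))\<^sup>2)"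
    proof (intro sum.cong refl)
      fix k
      have "(\<Sum>i\<in>I. cnj (\<phi> i x) * cnj (v k i)) = cnj (ev (v k) x)" by (simp add: ev_def mult.commute)
      then show "(cmod (ev (v k) x))\<^sup>2 = (cmod (\<Sum>i\<in>I. cnj (\<phi> i x) * cnj (v k i)))\<^sup>2" by simp
    qed
    also have "\<dots> \<le> (\<Sum>i\<in>I. (cmod (cnj (\<phi> i x)))\<^sup>2)" by (rule bessel[OF v fin])
    also have "\<dots> = card I" using \<phi>_norm x by simp
    finally show "(\<Sum>k<r. cmod (f x) * (cmod (ev (v k) x))\<^sup>2) \<le> card I * cmod (f x)"
      unfolding sum_distrib_left[symmetric] by (metis mult.commute mult_right_mono norm_ge_zero)
  qed (use energy_integrable f in auto)
  finally show ?thesis by simp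
qed

text \<open>By the trace bound, an orthonormal family whose members all have energy above
  \<open>t\<close> has bounded length, so it cannot be prolonged indefinitely. A vector orthogonal
  to a family that admits no longer one must have energy at most \<open>t\<close> after
  normalisation, as it could be adjoined otherwise.\<close>

lemma exists_maximal_family:
  assumes "0 < t"
  obtains r v where "orthonormal_family I r v" "real r * t \<le> card I * (\<integral>x. cmod (f x) \<partial>M)"
    "\<And>w. (\<And>k. k < r \<Longrightarrow> (\<Sum>i\<in>I. w i * cnj (v k i)) = 0) \<Longrightarrow> energy w \<le> t * (\<Sum>i\<in>I. (cmod (w i))\<^sup>2)"
proof -
  define P where "P r \<longleftrightarrow> (\<exists>v. orthonormal_family I r v \<and> (\<forall>k<r. t < energy (v k)))" for r
  have bound: "real r * t \<le> card I * (\<integral>x. cmod (f x) \<partial>M)" if v: "orthonormal_family I r v" "\<forall>k<r. t < energy (v k)" for r v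
  proof -
    have "real r * t = (\<Sum>k<r. t)" by simp
    also have "\<dots> \<le> (\<Sum>k<r. energy (v k))" using v(2) by (intro sum_mono) (simp add: less_imp_le)
    finally show ?thesis using energy_family[OF v(1)] by simp
  qed
  obtain n :: nat where n: "card I * (\<integral>x. cmod (f x) \<partial>M) / t < n" using reals_Archimedean2 by blast
  have nP: "\<not> P n"
  proof
    assume "P n"
    then have "real n * t \<le> card I * (\<integral>x. cmod (f x) \<partial>M)" unfolding P_def using bound by blast
    then show False using n assms by (simp add: field_simps)
  qed
  have "P 0" by (simp add: P_def orthonormal_family_def)
  \<comment> \<open>The length r precedes the least length for which no such family exists.\<close>
  then obtain r where r: "P r" "\<not> P (Suc r)"
    using ex_least_nat_less[of "\<lambda>r. \<not> P r" n] nP by auto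
  then obtain v where v: "orthonormal_family I r v" "\<forall>k<r. t < energy (v k)" by (auto simp: P_def)
  have "energy w \<le> t * (\<Sum>i\<in>I. (cmod (w i))\<^sup>2)" if w: "\<And>k. k < r \<Longrightarrow> (\<Sum>i\<in>I. w i * cnj (v k i)) = 0" for w
  proof (cases "(\<Sum>i\<in>I. (cmod (w i))\<^sup>2) = 0")
    case True
    then have "\<forall>i\<in>I. w i = 0" using fin by (simp add: sum_nonneg_eq_0_iff)
    then have "energy w = 0" by (simp add: energy_def ev_def)
    then show ?thesis using True by simp
  next
    case False
    define s where "s = sqrt (\<Sum>i\<in>I. (cmod (w i))\<^sup>2)"
    have s2: "s\<^sup>2 = (\<Sum>i\<in>I. (cmod (w i))\<^sup>2)" unfolding s_def by (simp add: sum_nonneg)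
    have s: "0 < s" unfolding s_def using False by (simp add: sum_nonneg order_less_le)
    define u where "u i = of_real (1 / s) * w i" for i
    have e: "energy w = s\<^sup>2 * energy u"
      unfolding u_def energy_scale using s by (simp add: power_divide norm_divide)
    have uu: "(\<Sum>i\<in>I. u i * cnj (u i)) = 1"
    proof -
      have "(\<Sum>i\<in>I. u i * cnj (u i)) = of_real (1 / s\<^sup>2) * (\<Sum>i\<in>I. w i * cnj (w i))"
        unfolding u_def sum_distrib_left by (intro sum.cong) (auto simp: power2_eq_square)
      then show ?thesis unfolding sum_cnj_self s2[symmetric] using s by simp
    qed
    have uv: "(\<Sum>i\<in>I. u i * cnj (v k i)) = 0" if "k < r" for k
      using w[OF that] unfolding u_def mult.assoc sum_distrib_left[symmetric] by simp
    have vu: "(\<Sum>i\<in>I. v k i * cnj (u i)) = 0" if "k < r" for k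
    proof -
      have "(\<Sum>i\<in>I. v k i * cnj (u i)) = cnj (\<Sum>i\<in>I. u i * cnj (v k i))" by (simp add: mult.commute)
      then show ?thesis using uv[OF that] by simp
    qed
    have "\<not> t < energy u"
    proof
      assume t: "t < energy u"
      have "orthonormal_family I (Suc r) (v(r := u))"
        unfolding orthonormal_family_def
      proof (intro allI impI)
        fix k l assume "k < Suc r" "l < Suc r"
        then consider "k < r" "l < r" | "k < r" "l = r" | "k = r" "l < r" | "k = r" "l = r" by linarith
        then show "(\<Sum>i\<in>I. (v(r := u)) k i * cnj ((v(r := u)) l i)) = of_bool (k = l)"
          by cases (use v(1) uu uv vu in \<open>auto simp: orthonormal_family_def\<close>)
      qed
      moreover have "\<forall>k<Suc r. t < energy ((v(r := u)) k)" using v(2) t by (simp add: less_Suc_eq)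
      ultimately show False using r(2) unfolding P_def by blast
    qed
    then show ?thesis unfolding e s2[symmetric] using s by simp
  qed
  then show thesis using that v bound by blast
qed

text \<open>A weighted inequality between arithmetic and geometric means, applied under the
  integral, stands in for the Cauchy-Schwarz inequality of the semi-inner product given by
  |f|.\<close>

lemma form_bound:
  assumes "energy x \<le> t * a\<^sup>2" "energy y \<le> t * b\<^sup>2" "0 \<le> t" "0 < a" "0 < b"
  shows "cmod (\<integral>z. f z * ev y z * cnj (ev x z) \<partial>M) \<le> t * a * b"
proof -
  \<comment> \<open>This weight balances the two energies: each term contributes t a b / 2.\<close>
  define l where "l = a / b"
  have l: "0 < l" using assms by (simp add: l_def)
  have "cmod (\<integral>z. f z * ev y z * cnj (ev x z) \<partial>M) \<le> (\<integral>z. cmod (f z * ev y z * cnj (ev x z)) \<partial>M)"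
    by (rule integral_norm_bound)
  also have "\<dots> \<le> (\<integral>z. (l / 2) * (cmod (f z) * (cmod (ev y z))\<^sup>2) + (1 / (2 * l)) * (cmod (f z) * (cmod (ev x z))\<^sup>2) \<partial>M)"
  proof (rule integral_mono_AE')
    show "integrable M (\<lambda>z. (l / 2) * (cmod (f z) * (cmod (ev y z))\<^sup>2) + (1 / (2 * l)) * (cmod (f z) * (cmod (ev x z))\<^sup>2))"
      using energy_integrable by (intro Bochner_Integration.integrable_add integrable_mult_right) auto
    show "AE z in M. cmod (f z * ev y z * cnj (ev x z)) \<le>
       (l / 2) * (cmod (f z) * (cmod (ev y z))\<^sup>2) + (1 / (2 * l)) * (cmod (f z) * (cmod (ev x z))\<^sup>2)"
    proof (rule AE_I2)
      fix z
      have "0 \<le> (l * cmod (ev y z) - cmod (ev x z))\<^sup>2" by simp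
      then have "2 * l * (cmod (ev y z) * cmod (ev x z)) \<le> l\<^sup>2 * (cmod (ev y z))\<^sup>2 + (cmod (ev x z))\<^sup>2"
        by (simp add: power2_eq_square algebra_simps)
      then have "cmod (ev y z) * cmod (ev x z) \<le> (l / 2) * (cmod (ev y z))\<^sup>2 + (1 / (2 * l)) * (cmod (ev x z))\<^sup>2"
        using l by (simp add: field_simps power2_eq_square)
      from mult_left_mono[OF this norm_ge_zero[of "f z"]]
      show "cmod (f z * ev y z * cnj (ev x z)) \<le>
         (l / 2) * (cmod (f z) * (cmod (ev y z))\<^sup>2) + (1 / (2 * l)) * (cmod (f z) * (cmod (ev x z))\<^sup>2)"
        by (simp add: norm_mult algebra_simps)
    qed
    show "AE z in M. 0 \<le> (l / 2) * (cmod (f z) * (cmod (ev y z))\<^sup>2) + (1 / (2 * l)) * (cmod (f z) * (cmod (ev x z))\<^sup>2)"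
      using l by (intro AE_I2 add_nonneg_nonneg mult_nonneg_nonneg) simp_all
  qed
  also have "\<dots> = (l / 2) * energy y + (1 / (2 * l)) * energy x"
    unfolding energy_def using energy_integrable
    by (subst Bochner_Integration.integral_add) (auto intro!: integrable_mult_right)
  also have "\<dots> \<le> (l / 2) * (t * b\<^sup>2) + (1 / (2 * l)) * (t * a\<^sup>2)"
    using assms l by (intro add_mono mult_left_mono) auto
  also have "\<dots> = t * a * b"
    unfolding l_def using assms by (simp add: field_simps power2_eq_square)
  finally show ?thesis .
qed

lemma form_integral:
  assumes X: "\<And>i j. i \<in> I \<Longrightarrow> j \<in> I \<Longrightarrow> X i j = (\<integral>z. f z * \<phi> j z * cnj (\<phi> i z) \<partial>M)"
  shows "(\<Sum>i\<in>I. x i * (\<Sum>j\<in>I. X i j * y j)) = (\<integral>z. f z * ev y z * cnj (ev (\<lambda>i. cnj (x i)) z) \<partial>M)"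
proof -
  have int: "integrable M (\<lambda>z. f z * \<phi> j z * cnj (\<phi> i z))" if "i \<in> I" "j \<in> I" for i j
  proof (rule Bochner_Integration.integrable_bound[OF f])
    show "(\<lambda>z. f z * \<phi> j z * cnj (\<phi> i z)) \<in> borel_measurable M"
      using f \<phi>_meas[OF that(1)] \<phi>_meas[OF that(2)]
      by (intro borel_measurable_times borel_measurable_continuous_on[OF _ \<phi>_meas[OF that(1)]] continuous_intros) auto
  qed (use \<phi>_norm that in \<open>auto simp: norm_mult\<close>)
  have "(\<integral>z. f z * ev y z * cnj (ev (\<lambda>i. cnj (x i)) z) \<partial>M) =
     (\<integral>z. (\<Sum>i\<in>I. \<Sum>j\<in>I. x i * y j * (f z * \<phi> j z * cnj (\<phi> i z))) \<partial>M)"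
  proof (intro arg_cong[of _ _ "integral\<^sup>L M"] ext)
    fix z
    have "cnj (ev (\<lambda>i. cnj (x i)) z) = (\<Sum>i\<in>I. x i * cnj (\<phi> i z))"
      by (simp add: ev_def)
    then have "f z * ev y z * cnj (ev (\<lambda>i. cnj (x i)) z) = f z * ((\<Sum>i\<in>I. x i * cnj (\<phi> i z)) * (\<Sum>j\<in>I. y j * \<phi> j z))"
      by (simp only: ev_def mult_ac)
    also have "\<dots> = (\<Sum>i\<in>I. \<Sum>j\<in>I. x i * y j * (f z * \<phi> j z * cnj (\<phi> i z)))"
      unfolding sum_product by (simp add: sum_distrib_left mult_ac)
    finally show "f z * ev y z * cnj (ev (\<lambda>i. cnj (x i)) z) = \<dots>" .
  qed
  also have "\<dots> = (\<Sum>i\<in>I. \<Sum>j\<in>I. x i * y j * (\<integral>z. f z * \<phi> j z * cnj (\<phi> i z) \<partial>M))"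
    using int by (simp add: Bochner_Integration.integral_sum Bochner_Integration.integrable_sum)
  also have "\<dots> = (\<Sum>i\<in>I. x i * (\<Sum>j\<in>I. X i j * y j))"
    unfolding sum_distrib_left by (intro sum.cong refl) (simp add: X mult_ac)
  finally show ?thesis ..
qed

text \<open>The projection onto a maximal orthonormal family of high energy directions is split off from
  both sides of \<open>X\<close>; by maximality the remaining form is bounded by \<open>t\<close>.\<close>

theorem splits_integral:
  assumes X: "\<And>i j. i \<in> I \<Longrightarrow> j \<in> I \<Longrightarrow> X i j = (\<integral>z. f z * \<phi> j z * cnj (\<phi> i z) \<partial>M)" and "0 < t"
  shows "splits I I X (2 * card I * (\<integral>x. cmod (f x) \<partial>M) / t) t"
proof (rule exists_maximal_family[OF assms(2)])
  fix r v assume v: "orthonormal_family I r v" and r: "real r * t \<le> card I * (\<integral>x. cmod (f x) \<partial>M)"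
    and max: "\<And>w. (\<And>k. k < r \<Longrightarrow> (\<Sum>i\<in>I. w i * cnj (v k i)) = 0) \<Longrightarrow> energy w \<le> t * (\<Sum>i\<in>I. (cmod (w i))\<^sup>2)"
  \<comment> \<open>With P the projection onto the family, \<open>Z\<close> is (1 - P) X and
    \<open>E\<close> is (1 - P) X (1 - P). The rows \<open>A\<close> and the columns
    \<open>B\<close> are the coefficients of the parts removed on the left and on the right.\<close>
  define A where "A k j = (\<Sum>a\<in>I. cnj (v k a) * X a j)" for k j
  define Z where "Z i j = X i j - (\<Sum>k<r. v k i * A k j)" for i j
  define B where "B k i = (\<Sum>b\<in>I. Z i b * v k b)" for k i
  define E where "E i j = Z i j - (\<Sum>k<r. B k i * cnj (v k j))" for i j
  define R where "R i j = (\<Sum>k<r. v k i * A k j) + (\<Sum>k<r. B k i * cnj (v k j))" for i j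
  \<comment> \<open>One term of rank at most r comes from each side, whence the factor 2 in the rank
    budget.\<close>
  have rank: "outer_rank_le I I R (r + r)"
    unfolding R_def by (rule outer_rank_le_add; unfold outer_rank_le_def)
      (rule exI[of _ v], rule exI[of _ A], simp, rule exI[of _ B], rule exI[of _ "\<lambda>k j. cnj (v k j)"], simp)
  define pr where "pr y i = y i - (\<Sum>k<r. (\<Sum>j\<in>I. y j * cnj (v k j)) * v k i)" for y i
  have pr_energy: "energy (pr y) \<le> t * (L2_set (\<lambda>i. cmod (y i)) I)\<^sup>2" for y
  proof -
    have "energy (pr y) \<le> t * (\<Sum>i\<in>I. (cmod (pr y i))\<^sup>2)"
      unfolding pr_def by (rule max) (rule proj_orthogonal[OF v fin])
    also have "\<dots> \<le> t * (\<Sum>i\<in>I. (cmod (y i))\<^sup>2)"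
      using proj_norm[OF v fin, of y] sum_nonneg[of "{..<r}" "\<lambda>k. (cmod (\<Sum>i\<in>I. y i * cnj (v k i)))\<^sup>2"] assms(2)
      by (intro mult_left_mono) (auto simp: pr_def)
    finally show ?thesis by (simp add: L2_set_def sum_nonneg)
  qed
  \<comment> \<open>The projections are moved from the matrix to the vectors. On the left they act
    on the conjugate of \<open>x\<close>, since the form is bilinear.\<close>
  have E_form: "(\<Sum>i\<in>I. x i * (\<Sum>j\<in>I. E i j * y j)) =
     (\<Sum>i\<in>I. cnj (pr (\<lambda>i. cnj (x i)) i) * (\<Sum>j\<in>I. X i j * pr y j))" for x y
  proof -
    have 1: "(\<Sum>j\<in>I. E i j * y j) = (\<Sum>j\<in>I. Z i j * pr y j)" for i
    proof -
      have "(\<Sum>j\<in>I. E i j * y j) = (\<Sum>j\<in>I. Z i j * y j) - (\<Sum>k<r. B k i * (\<Sum>j\<in>I. y j * cnj (v k j)))"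
        unfolding E_def left_diff_distrib sum_subtractf sum_distrib_right sum_distrib_left
        by (subst (2) sum.swap) (simp add: mult_ac)
      also have "(\<Sum>k<r. B k i * (\<Sum>j\<in>I. y j * cnj (v k j))) = (\<Sum>b\<in>I. Z i b * (\<Sum>k<r. (\<Sum>j\<in>I. y j * cnj (v k j)) * v k b))"
        unfolding B_def sum_distrib_right[of _ I "\<Sum>j\<in>I. y j * cnj (v k j)" for k]
        unfolding sum_distrib_left[of "Z i b" _ "{..<r}" for b]
        by (subst (2) sum.swap) (simp add: mult_ac)
      finally show ?thesis unfolding pr_def right_diff_distrib sum_subtractf .
    qed
    have 2: "(\<Sum>i\<in>I. x i * Z i b) = (\<Sum>i\<in>I. cnj (pr (\<lambda>i. cnj (x i)) i) * X i b)" for b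
    proof -
      have "(\<Sum>i\<in>I. x i * Z i b) = (\<Sum>i\<in>I. x i * X i b) - (\<Sum>k<r. (\<Sum>i\<in>I. x i * v k i) * A k b)"
        unfolding Z_def right_diff_distrib sum_subtractf sum_distrib_right sum_distrib_left
        by (subst (2) sum.swap) (simp add: mult_ac)
      also have "(\<Sum>k<r. (\<Sum>i\<in>I. x i * v k i) * A k b) = (\<Sum>a\<in>I. (\<Sum>k<r. (\<Sum>i\<in>I. x i * v k i) * cnj (v k a)) * X a b)"
        unfolding A_def sum_distrib_left[of "\<Sum>i\<in>I. x i * v k i" _ I for k]
        unfolding sum_distrib_right[of _ "{..<r}" "X a b" for a]
        by (subst (2) sum.swap) (simp add: mult_ac)
      finally show ?thesis unfolding pr_def by (simp add: left_diff_distrib sum_subtractf)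
    qed
    have "(\<Sum>i\<in>I. x i * (\<Sum>j\<in>I. E i j * y j)) = (\<Sum>j\<in>I. (\<Sum>i\<in>I. x i * Z i j) * pr y j)"
      unfolding 1 sum_distrib_left sum_distrib_right by (subst sum.swap) (simp add: mult_ac)
    also have "\<dots> = (\<Sum>i\<in>I. cnj (pr (\<lambda>i. cnj (x i)) i) * (\<Sum>j\<in>I. X i j * pr y j))"
      unfolding 2 sum_distrib_left sum_distrib_right by (subst sum.swap) (simp add: mult_ac)
    finally show ?thesis .
  qed
  have bounded: "op_bounded I I E t"
  proof (rule op_boundedI_form[OF fin])
    fix x y :: "'i \<Rightarrow> complex"
    let ?a = "L2_set (\<lambda>i. cmod (x i)) I" and ?b = "L2_set (\<lambda>i. cmod (y i)) I"
    show "cmod (\<Sum>i\<in>I. x i * (\<Sum>j\<in>I. E i j * y j)) \<le> t * ?a * ?b"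
    \<comment> \<open>Zero vectors are set apart because the weight in \<open>form_bound\<close>
      divides by the norms.\<close>
    proof (cases "?a = 0 \<or> ?b = 0")
      case True
      then have "(\<forall>i\<in>I. x i = 0) \<or> (\<forall>i\<in>I. y i = 0)" using fin by (simp add: L2_set_eq_0_iff)
      then have "(\<Sum>i\<in>I. x i * (\<Sum>j\<in>I. E i j * y j)) = 0" by auto
      then show ?thesis using assms(2) by simp
    next
      case False
      have "(\<Sum>i\<in>I. x i * (\<Sum>j\<in>I. E i j * y j)) = (\<integral>z. f z * ev (pr y) z * cnj (ev (pr (\<lambda>i. cnj (x i))) z) \<partial>M)"
        unfolding E_form using form_integral[OF X, of "\<lambda>i. cnj (pr (\<lambda>i. cnj (x i)) i)" "pr y"] by simp
      also have "cmod \<dots> \<le> t * ?a * ?b"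
        using pr_energy[of "\<lambda>i. cnj (x i)"] pr_energy[of y] False assms(2)
        by (intro form_bound) (auto simp: order_less_le L2_set_nonneg)
      finally show ?thesis .
    qed
  qed (use assms(2) in simp)
  show ?thesis
    by (rule splitsI[OF _ rank _ bounded]) (use r assms(2) in \<open>auto simp: R_def E_def Z_def field_simps\<close>)
qed

end

section \<open>Toeplitz and diagonal sampling matrices\<close>

lemma length_concat_uniform: "(\<And>x. x \<in> set xs \<Longrightarrow> length (f x) = n) \<Longrightarrow> length (concat (map f xs)) = length xs * n"
  by (induction xs) auto

lemma nth_concat_uniform:
  "\<lbrakk>\<And>x. x \<in> set xs \<Longrightarrow> length (f x) = n; i < length xs; j < n\<rbrakk> \<Longrightarrow> concat (map f xs) ! (i * n + j) = f (xs ! i) ! j"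
proof (induction xs arbitrary: i)
  case (Cons x xs)
  have l: "length (f x) = n" using Cons.prems(1)[of x] by simp
  show ?case
  proof (cases i)
    case 0
    then show ?thesis using Cons.prems l by (simp add: nth_append)
  next
    case (Suc i')
    have "concat (map f (x # xs)) ! (i * n + j) = (f x @ concat (map f xs)) ! (length (f x) + (i' * n + j))"
      using Suc l by (simp add: add.assoc)
    also have "\<dots> = concat (map f xs) ! (i' * n + j)" by (rule nth_append_length_plus)
    also have "\<dots> = f (xs ! i') ! j" using Cons.prems Suc by (intro Cons.IH) auto
    finally show ?thesis using Suc by simp
  qed
qed simp

lemma concat_map_concat: "concat (map f (concat xss)) = concat (map (\<lambda>xs. concat (map f xs)) xss)"
  by (induction xss) auto

lemma product_lists_append:
  "product_lists (xs @ ys) = concat (map (\<lambda>a. map ((@) a) (product_lists ys)) (product_lists xs))"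
proof (induction xs)
  case Nil
  then show ?case by (simp add: map_idI)
next
  case (Cons x xs)
  have "((@) (y # z)) = (\<lambda>w. y # z @ w)" for y :: 'a and z by (rule ext) simp
  with Cons show ?case by (simp add: map_concat concat_map_concat comp_def concat_map_concat[where f = "\<lambda>x. x", simplified])
qed

lemma length_multi_range [simp]: "length (multi_range m) = prod_list m"
proof (induction m)
  case (Cons k m)
  then show ?case unfolding multi_range_def
    by (simp add: length_concat_uniform[where n = "prod_list m"] del: upt_Suc)
qed (simp add: multi_range_def)

text \<open>In lexicographic order the suffix varies fastest, so concatenating multi-indices amounts
  to joining their positions as digits. This links the grid of the concatenated sizes to the
  reordered Kronecker indices.\<close>

lemma multi_range_append:
  assumes "i < prod_list m" "j < prod_list m'"
  shows "multi_range (m @ m') ! (i * prod_list m' + j) = multi_range m ! i @ multi_range m' ! j"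
proof -
  have "multi_range (m @ m') = concat (map (\<lambda>a. map ((@) a) (multi_range m')) (multi_range m))"
    by (simp add: multi_range_def product_lists_append)
  then show ?thesis
    using nth_concat_uniform[of "multi_range m" "\<lambda>a. map ((@) a) (multi_range m')" "prod_list m'" i j] assms
    by simp
qed

lemma set_multi_range: "l \<in> set (multi_range m) \<longleftrightarrow> list_all2 (\<lambda>x k. 1 \<le> x \<and> x \<le> k) l m"
  unfolding multi_range_def product_lists_set
  by (auto simp: list_all2_map2 less_Suc_eq_le simp del: upt_Suc)

lemma distinct_multi_range: "distinct (multi_range m)"
proof (induction m)
  case (Cons k m)
  have "distinct (concat (map (\<lambda>x. map ((#) x) (multi_range m)) ks))" if "distinct ks" for ks
    using that by (induction ks) (auto simp: distinct_map Cons.IH inj_on_def)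
  then show ?case unfolding multi_range_def by (simp del: upt_Suc)
qed (simp add: multi_range_def)

lemma multi_range_nth:
  assumes "i < prod_list m"
  shows "length (multi_range m ! i) = length m"
    and "\<And>r. r < length m \<Longrightarrow> 1 \<le> multi_range m ! i ! r \<and> multi_range m ! i ! r \<le> m ! r"
proof -
  have "list_all2 (\<lambda>x k. 1 \<le> x \<and> x \<le> k) (multi_range m ! i) m"
    unfolding set_multi_range[symmetric] using assms by (intro nth_mem) simp
  then show "length (multi_range m ! i) = length m"
    "\<And>r. r < length m \<Longrightarrow> 1 \<le> multi_range m ! i ! r \<and> multi_range m ! i ! r \<le> m ! r"
    by (auto simp: list_all2_conv_all_nth)
qed

lemma multi_range_eq_iff: "i < prod_list m \<Longrightarrow> j < prod_list m \<Longrightarrow> multi_range m ! i = multi_range m ! j \<longleftrightarrow> i = j"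
  by (simp add: nth_eq_iff_index_eq[OF distinct_multi_range])

text \<open>The argument i/n at which a diagonal sampling matrix evaluates its function.\<close>

definition grid_point :: "nat list \<Rightarrow> nat list \<Rightarrow> point" where
  "grid_point m l = (\<lambda>r\<in>{..<length m}. real (l ! r) / real (m ! r))"

lemma multi_block_carrier: "multi_block_mat m s t B \<in> carrier_mat (prod_list m * s) (prod_list m * t)"
  by (simp add: multi_block_mat_def)

lemma toeplitz_carrier: "toeplitz_mat m s t f \<in> carrier_mat (prod_list m * s) (prod_list m * t)"
  unfolding toeplitz_mat_def by (rule multi_block_carrier)

lemma diag_sampling_carrier: "diag_sampling_mat m s t f \<in> carrier_mat (prod_list m * s) (prod_list m * t)"
  unfolding diag_sampling_mat_def by (rule multi_block_carrier)

lemma diag_sampling_index: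
  assumes "i < prod_list m * s" "j < prod_list m * s"
  shows "diag_sampling_mat m s s (\<lambda>x. a x \<cdot>\<^sub>m 1\<^sub>m s) $$ (i, j) =
    (if i = j then a (grid_point m (multi_range m ! (i div s))) else 0)"
proof -
  have s: "0 < s" using assms by (auto intro: Nat.gr0I)
  have d: "i div s < prod_list m" "j div s < prod_list m" "i mod s < s" "j mod s < s"
    using assms s by (simp_all add: less_mult_imp_div_less)
  have "i = j \<longleftrightarrow> i div s = j div s \<and> i mod s = j mod s"
    by (metis div_mult_mod_eq)
  then show ?thesis
    using assms d by (simp add: diag_sampling_mat_def multi_block_mat_def multi_range_eq_iff grid_point_def)
qed

lemma diag_sampling_mult_index:
  assumes T: "T \<in> carrier_mat (prod_list m * s) e" and i: "i < prod_list m * s" and j: "j < e"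
  shows "(diag_sampling_mat m s s (\<lambda>x. a x \<cdot>\<^sub>m 1\<^sub>m s) * T) $$ (i, j) =
    a (grid_point m (multi_range m ! (i div s))) * T $$ (i, j)"
proof -
  have "(diag_sampling_mat m s s (\<lambda>x. a x \<cdot>\<^sub>m 1\<^sub>m s) * T) $$ (i, j) =
    (\<Sum>k<prod_list m * s. diag_sampling_mat m s s (\<lambda>x. a x \<cdot>\<^sub>m 1\<^sub>m s) $$ (i, k) * T $$ (k, j))"
    by (rule mult_mat_index[OF diag_sampling_carrier T i j])
  also have "\<dots> = (\<Sum>k<prod_list m * s. if k = i then a (grid_point m (multi_range m ! (i div s))) * T $$ (i, j) else 0)"
    using i by (intro sum.cong) (auto simp: diag_sampling_index)
  finally show ?thesis using i by simp
qed

section \<open>Toeplitz matrices as integral forms\<close>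

lemma measurable_pi_component: "r < q \<Longrightarrow> (\<lambda>\<theta>. \<theta> r) \<in> borel_measurable (pi_measure q)"
  unfolding pi_measure_def
  by (intro measurable_restrict_space1 measurable_completion measurable_component_lebesgue)

lemma space_pi_measure: "space (pi_measure q) = pi_cube q"
proof -
  have "pi_cube q \<subseteq> space (borel_lebesgue q)" unfolding space_borel_lebesgue pi_cube_def PiE_def by (rule Int_lower2)
  then show ?thesis by (simp add: pi_measure_def space_restrict_space Int_absorb2)
qed

text \<open>The character of frequency l. A Toeplitz entry involves the difference i - j of two
  multi-indices, and its Fourier kernel is the wave of j times the conjugate of the wave of
  i.\<close>

definition wave :: "nat \<Rightarrow> nat list \<Rightarrow> point \<Rightarrow> complex" where
  "wave q l \<theta> = exp (\<i> * complex_of_real (\<Sum>r<q. real (l ! r) * \<theta> r))"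

lemma wave_measurable: "wave q l \<in> borel_measurable (pi_measure q)"
proof -
  have [measurable]: "(\<lambda>\<theta>. \<Sum>r<q. real (l ! r) * \<theta> r) \<in> borel_measurable (pi_measure q)"
    by (intro borel_measurable_sum borel_measurable_times borel_measurable_const measurable_pi_component) simp
  show ?thesis unfolding wave_def[abs_def] by measurable
qed

lemma cmod_wave [simp]: "cmod (wave q l \<theta>) = 1"
  unfolding wave_def by (simp add: norm_exp_i_times)

lemma wave_diff:
  assumes "length k = q" "length l = q"
  shows "exp (- \<i> * complex_of_real (\<Sum>r<q. real_of_int (map2 (\<lambda>a b. int a - int b) k l ! r) * \<theta> r)) =
    wave q l \<theta> * cnj (wave q k \<theta>)"
proof -
  have "(\<Sum>r<q. real_of_int (map2 (\<lambda>a b. int a - int b) k l ! r) * \<theta> r) =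
    (\<Sum>r<q. real (k ! r) * \<theta> r) - (\<Sum>r<q. real (l ! r) * \<theta> r)"
    unfolding sum_subtractf[symmetric] using assms by (intro sum.cong) (auto simp: algebra_simps)
  note eq = this
  have "exp (- \<i> * complex_of_real (\<Sum>r<q. real_of_int (map2 (\<lambda>a b. int a - int b) k l ! r) * \<theta> r)) =
     exp (\<i> * complex_of_real (\<Sum>r<q. real (l ! r) * \<theta> r) + - (\<i> * complex_of_real (\<Sum>r<q. real (k ! r) * \<theta> r)))"
  proof -
    have "- \<i> * complex_of_real (A - B) = \<i> * complex_of_real B + - (\<i> * complex_of_real A)" for A B
      by (simp add: algebra_simps)
    then show ?thesis unfolding eq by (rule arg_cong)
  qed
  also have "\<dots> = wave q l \<theta> * cnj (wave q k \<theta>)"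
    unfolding exp_add wave_def by (simp add: exp_cnj del: of_real_sum)
  finally show ?thesis .
qed

text \<open>The shape that \<open>integral_form\<close> expects: for a fixed position inside the
  blocks, the waves of the multi-indices are the test functions, and the normalising constant is
  absorbed into f.\<close>

lemma toeplitz_index:
  assumes "i < prod_list m * s" "j < prod_list m * t" "length m = q"
  shows "toeplitz_mat m s t f $$ (i, j) = (\<integral>\<theta>. (1 / complex_of_real ((2 * pi) ^ q) * f \<theta> $$ (i mod s, j mod t)) *
     wave q (multi_range m ! (j div t)) \<theta> * cnj (wave q (multi_range m ! (i div s)) \<theta>) \<partial>pi_measure q)"
proof -
  have st: "0 < s" "0 < t" using assms by (auto intro: Nat.gr0I)
  have d: "i div s < prod_list m" "j div t < prod_list m" "i mod s < s" "j mod t < t"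
    using assms st by (simp_all add: less_mult_imp_div_less)
  have len: "length (multi_range m ! (i div s)) = q" "length (multi_range m ! (j div t)) = q"
    using multi_range_nth(1)[OF d(1)] multi_range_nth(1)[OF d(2)] assms by auto
  have "toeplitz_mat m s t f $$ (i, j) = 1 / complex_of_real ((2 * pi) ^ q) *
     (\<integral>\<theta>. f \<theta> $$ (i mod s, j mod t) * (wave q (multi_range m ! (j div t)) \<theta> * cnj (wave q (multi_range m ! (i div s)) \<theta>)) \<partial>pi_measure q)"
    using assms d unfolding toeplitz_mat_def multi_block_mat_def fourier_coeff_def wave_diff[OF len, symmetric]
    by simp
  also have "\<dots> = (\<integral>\<theta>. 1 / complex_of_real ((2 * pi) ^ q) * (f \<theta> $$ (i mod s, j mod t) * (wave q (multi_range m ! (j div t)) \<theta> * cnj (wave q (multi_range m ! (i div s)) \<theta>))) \<partial>pi_measure q)"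
    by (rule integral_mult_right_zero[symmetric])
  finally show ?thesis by (simp add: mult.assoc)
qed

lemma bij_betw_div_mod: "0 < s \<Longrightarrow> bij_betw (\<lambda>i. (i div s, i mod s)) {..<N * s} ({..<N} \<times> {..<s::nat})"
proof (rule bij_betw_byWitness[where f' = "\<lambda>(i, a). i * s + a"])
  show "(\<lambda>(i, a). i * s + a) ` ({..<N} \<times> {..<s}) \<subseteq> {..<N * s}" by (auto intro: digit_less)
qed (auto simp: less_mult_imp_div_less)

text \<open>T_n(f) is the sum over (\<alpha>, \<beta>) of the scalar Toeplitz matrix of the
  component of f tensored with a matrix unit. Each scalar matrix is split at level \<tau>; there are
  s t summands, which gives the norm bound, and tensoring multiplies each rank budget by the smaller
  of s and t.\<close>

lemma toeplitz_splits:
  assumes m: "length m = q" and "0 < s" "0 < t" "0 < \<tau>"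
    and f: "\<And>\<alpha> \<beta>. \<alpha> < s \<Longrightarrow> \<beta> < t \<Longrightarrow> integrable (pi_measure q) (\<lambda>\<theta>. f \<theta> $$ (\<alpha>, \<beta>))"
  defines "F \<equiv> (\<Sum>(\<alpha>, \<beta>)\<in>{..<s} \<times> {..<t}. \<integral>\<theta>. cmod (1 / complex_of_real ((2 * pi) ^ q) * f \<theta> $$ (\<alpha>, \<beta>)) \<partial>pi_measure q)"
  shows "splits {..<prod_list m * s} {..<prod_list m * t} (\<lambda>i j. toeplitz_mat m s t f $$ (i, j))
    (2 * F / \<tau> * min (prod_list m * s) (prod_list m * t)) (real (s * t) * \<tau>)"
proof -
  let ?N = "prod_list m"
  let ?c = "1 / complex_of_real ((2 * pi) ^ q)"
  let ?G = "\<lambda>\<alpha> \<beta>. \<integral>\<theta>. cmod (?c * f \<theta> $$ (\<alpha>, \<beta>)) \<partial>pi_measure q"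
  define X where "X \<alpha> \<beta> i j = (\<integral>\<theta>. (?c * f \<theta> $$ (\<alpha>, \<beta>)) * wave q (multi_range m ! j) \<theta> * cnj (wave q (multi_range m ! i) \<theta>) \<partial>pi_measure q)"
    for \<alpha> \<beta> i j
  have X: "splits {..<?N} {..<?N} (X \<alpha> \<beta>) (2 * ?N * ?G \<alpha> \<beta> / \<tau>) \<tau>" if "\<alpha> < s" "\<beta> < t" for \<alpha> \<beta>
  proof -
    interpret integral_form "pi_measure q" "\<lambda>\<theta>. ?c * f \<theta> $$ (\<alpha>, \<beta>)" "\<lambda>i. wave q (multi_range m ! i)" "{..<?N}"
      by standard (use f[OF that] in \<open>auto simp: wave_measurable\<close>)
    show ?thesis using splits_integral[of "X \<alpha> \<beta>" \<tau>] assms(4) by (simp add: X_def)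
  qed
  \<comment> \<open>A matrix unit has norm at most 1, so its low rank part can be zero.\<close>
  have E: "splits {..<s} {..<t} (\<lambda>i j. of_bool (i = \<alpha> \<and> j = \<beta>)) 0 1" if "\<alpha> < s" "\<beta> < t" for \<alpha> \<beta>
  proof (rule splitsI[of _ _ _ "\<lambda>_ _. 0" "\<lambda>i j. of_bool (i = \<alpha> \<and> j = \<beta>)" 0])
    show "op_bounded {..<s} {..<t} (\<lambda>i j. of_bool (i = \<alpha> \<and> j = \<beta>)) 1"
      unfolding op_bounded_sq[OF zero_le_one]
    proof
      fix y :: "nat \<Rightarrow> complex"
      have 1: "(\<Sum>j<t. of_bool (i = \<alpha> \<and> j = \<beta>) * y j) = (if i = \<alpha> then y \<beta> else 0)" for i
      proof -
        have "(\<Sum>j<t. of_bool (i = \<alpha> \<and> j = \<beta>) * y j) = (\<Sum>j<t. if j = \<beta> then (if i = \<alpha> then y \<beta> else 0) else 0)"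
          by (intro sum.cong) auto
        then show ?thesis using that by simp
      qed
      have "(\<Sum>i<s. (cmod (if i = \<alpha> then y \<beta> else 0))\<^sup>2) = (\<Sum>i<s. if i = \<alpha> then (cmod (y \<beta>))\<^sup>2 else 0)"
        by (intro sum.cong) auto
      also have "\<dots> = (cmod (y \<beta>))\<^sup>2" using that by simp
      also have "\<dots> \<le> (\<Sum>j<t. (cmod (y j))\<^sup>2)"
        using that by (intro member_le_sum) auto
      finally show "(\<Sum>i<s. (cmod (\<Sum>j<t. of_bool (i = \<alpha> \<and> j = \<beta>) * y j))\<^sup>2) \<le> 1\<^sup>2 * (\<Sum>j<t. (cmod (y j))\<^sup>2)"
        unfolding 1 by simp
    qed
  qed (simp_all add: outer_rank_le_def)
  have XE: "splits {..<?N * s} {..<?N * t} (\<lambda>i j. X \<alpha> \<beta> (i div s) (j div t) * of_bool (i mod s = \<alpha> \<and> j mod t = \<beta>))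
      (2 * ?N * ?G \<alpha> \<beta> / \<tau> * min s t) \<tau>" if "\<alpha> < s" "\<beta> < t" for \<alpha> \<beta>
    using splits_reindex[OF bij_betw_div_mod[OF assms(2)] bij_betw_div_mod[OF assms(3)] splits_tensor[OF X[OF that] E[OF that]]]
    by simp
  have "splits {..<?N * s} {..<?N * t}
     (\<lambda>i j. \<Sum>p\<in>{..<s} \<times> {..<t}. X (fst p) (snd p) (i div s) (j div t) * of_bool (i mod s = fst p \<and> j mod t = snd p))
     (\<Sum>p\<in>{..<s} \<times> {..<t}. 2 * ?N * ?G (fst p) (snd p) / \<tau> * min s t) (\<Sum>p\<in>{..<s} \<times> {..<t}. \<tau>)"
    by (rule splits_sum) (use XE in auto)
  moreover have "(\<Sum>p\<in>{..<s} \<times> {..<t}. X (fst p) (snd p) (i div s) (j div t) * of_bool (i mod s = fst p \<and> j mod t = snd p))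
     = toeplitz_mat m s t f $$ (i, j)" if "i < ?N * s" "j < ?N * t" for i j
  proof -
    have "(\<Sum>p\<in>{..<s} \<times> {..<t}. X (fst p) (snd p) (i div s) (j div t) * of_bool (i mod s = fst p \<and> j mod t = snd p))
       = (\<Sum>p\<in>{..<s} \<times> {..<t}. if p = (i mod s, j mod t) then X (i mod s) (j mod t) (i div s) (j div t) else 0)"
      by (intro sum.cong) auto
    also have "\<dots> = X (i mod s) (j mod t) (i div s) (j div t)" using assms(2,3) by simp
    finally show ?thesis unfolding X_def using toeplitz_index[OF that m, of f] by simp
  qed
  moreover have "(\<Sum>p\<in>{..<s} \<times> {..<t}. 2 * ?N * ?G (fst p) (snd p) / \<tau> * min s t) = 2 * F / \<tau> * min (?N * s) (?N * t)"
  proof -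
    have "real (min (?N * s) (?N * t)) = ?N * min s t"
      by (metis nat_mult_min_right of_nat_mult)
    then show ?thesis
      unfolding F_def by (simp add: sum_distrib_left sum_distrib_right sum_divide_distrib split_def mult_ac)
  qed
  ultimately show ?thesis
    by (subst splits_cong[of _ _ _ "\<lambda>i j. \<Sum>p\<in>{..<s} \<times> {..<t}. X (fst p) (snd p) (i div s) (j div t) * of_bool (i mod s = fst p \<and> j mod t = snd p)"]) auto
qed


section \<open>Large samples of a function that is continuous almost everywhere\<close>

text \<open>The union of the cells of side \<open>1 / j\<close> that touch a cell on which \<open>\<bar>a\<bar>\<close> exceeds \<open>j\<close>. A point of
  continuity of \<open>a\<close> leaves these sets, so their measure tends to 0; for a grid finer than \<open>1 / j\<close> they
  contain the grid cell of every sample with \<open>\<bar>a\<bar> > j\<close>.\<close>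

definition rough_set :: "nat \<Rightarrow> (point \<Rightarrow> complex) \<Rightarrow> nat \<Rightarrow> point set" where
  "rough_set q a j = {x \<in> unit_cube q. \<exists>y\<in>unit_cube q. real j < cmod (a y) \<and>
     (\<forall>r<q. \<bar>\<lfloor>real j * x r\<rfloor> - \<lfloor>real j * y r\<rfloor>\<bar> \<le> 1)}"

text \<open>Membership depends on x only through the integer parts of the numbers j x_r. The set is
  therefore the cube intersected with a countable union of cells, whatever the set where |a| exceeds
  j looks like.\<close>

lemma rough_set_measurable: "rough_set q a j \<in> sets (borel_lebesgue q)"
proof -
  define C where "C = {c \<in> {..<q} \<rightarrow>\<^sub>E (UNIV :: int set). \<exists>y\<in>unit_cube q. real j < cmod (a y) \<and> (\<forall>r<q. \<bar>c r - \<lfloor>real j * y r\<rfloor>\<bar> \<le> 1)}"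
  have "countable ({..<q} \<rightarrow>\<^sub>E (UNIV :: int set))" by (rule countable_PiE) auto
  then have C: "countable C" by (rule countable_subset[rotated]) (auto simp: C_def)
  have "rough_set q a j = unit_cube q \<inter> (\<Union>c\<in>C. {x \<in> space (borel_lebesgue q). \<forall>r\<in>{..<q}. \<lfloor>real j * x r\<rfloor> = c r})"
  proof (intro subset_antisym subsetI)
    fix x assume x: "x \<in> rough_set q a j"
    then have xc: "x \<in> unit_cube q" by (simp add: rough_set_def)
    then have xs: "x \<in> space (borel_lebesgue q)" by (auto simp: space_borel_lebesgue unit_cube_def PiE_def)
    have "(\<lambda>r\<in>{..<q}. \<lfloor>real j * x r\<rfloor>) \<in> C" using x by (auto simp: C_def rough_set_def)
    then show "x \<in> unit_cube q \<inter> (\<Union>c\<in>C. {x \<in> space (borel_lebesgue q). \<forall>r\<in>{..<q}. \<lfloor>real j * x r\<rfloor> = c r})"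
      using xc xs by (intro IntI UN_I[of "\<lambda>r\<in>{..<q}. \<lfloor>real j * x r\<rfloor>"]) auto
  next
    fix x assume "x \<in> unit_cube q \<inter> (\<Union>c\<in>C. {x \<in> space (borel_lebesgue q). \<forall>r\<in>{..<q}. \<lfloor>real j * x r\<rfloor> = c r})"
    then obtain c where c: "c \<in> C" "\<forall>r\<in>{..<q}. \<lfloor>real j * x r\<rfloor> = c r" "x \<in> unit_cube q" by blast
    then show "x \<in> rough_set q a j" by (simp add: C_def rough_set_def)
  qed
  also have "\<dots> \<in> sets (borel_lebesgue q)"
  proof (intro sets.Int sets_cubes sets.countable_UN'' C)
    fix c
    have "(\<lambda>x. \<lfloor>real j * x r\<rfloor>) \<in> measurable (borel_lebesgue q) (count_space UNIV)" if "r < q" for r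
      using that by measurable
    then show "{x \<in> space (borel_lebesgue q). \<forall>r\<in>{..<q}. \<lfloor>real j * x r\<rfloor> = c r} \<in> sets (borel_lebesgue q)"
      by (intro sets.sets_Collect_finite_All measurable_equality_set) auto
  qed
  finally show ?thesis .
qed

lemma floor_diff_le_one: "\<bar>\<lfloor>u\<rfloor> - \<lfloor>v\<rfloor>\<bar> \<le> 1 \<Longrightarrow> \<bar>u - v\<bar> \<le> (2::real)"
  by linarith

lemma point_tendstoI:
  fixes y :: "nat \<Rightarrow> point"
  assumes "\<And>r. (\<lambda>j. y j r) \<longlonglongrightarrow> x r"
  shows "y \<longlonglongrightarrow> x"
proof -
  have "limitin (product_topology (\<lambda>i. euclidean) UNIV) y x sequentially"
    using assms by (subst limitin_componentwise) auto
  then show ?thesis by (simp add: euclidean_product_topology)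
qed

text \<open>If x is rough at level j, some point within 2/j of x in every coordinate has |a| above
  j. For arbitrarily large j this contradicts the boundedness of a near a point of
  continuity.\<close>

lemma eventually_not_rough:
  assumes x: "x \<in> unit_cube q" and a: "continuous (at x within unit_cube q) a"
  shows "eventually (\<lambda>j. x \<notin> rough_set q a j) sequentially"
proof -
  \<comment> \<open>At levels where x is not rough, x itself is the default, so that the chosen
    points converge to x in any case.\<close>
  have "\<exists>y. y \<in> unit_cube q \<and> (\<forall>r<q. \<bar>real j * x r - real j * y r\<bar> \<le> 2) \<and> (x \<in> rough_set q a j \<longrightarrow> real j < cmod (a y))" for j
  proof (cases "x \<in> rough_set q a j")
    case True
    then obtain y where "y \<in> unit_cube q" "real j < cmod (a y)" "\<forall>r<q. \<bar>\<lfloor>real j * x r\<rfloor> - \<lfloor>real j * y r\<rfloor>\<bar> \<le> 1"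
      by (auto simp: rough_set_def)
    then show ?thesis using floor_diff_le_one by (intro exI[of _ y]) auto
  qed (use x in \<open>auto intro!: exI[of _ x]\<close>)
  then obtain y where y: "\<And>j. y j \<in> unit_cube q" "\<And>j r. r < q \<Longrightarrow> \<bar>real j * x r - real j * y j r\<bar> \<le> 2"
    "\<And>j. x \<in> rough_set q a j \<Longrightarrow> real j < cmod (a (y j))" by metis
  have "y \<longlonglongrightarrow> x"
  proof (rule point_tendstoI)
    fix r
    show "(\<lambda>j. y j r) \<longlonglongrightarrow> x r"
    proof (cases "r < q")
      case True
      have "(\<lambda>j. y j r - x r) \<longlonglongrightarrow> 0"
      proof (rule Lim_null_comparison)
        have "norm (y j r - x r) \<le> 2 / real j" if "0 < j" for j
        proof -
          have "real j * \<bar>y j r - x r\<bar> = \<bar>real j * x r - real j * y j r\<bar>"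
            by (metis abs_minus_commute abs_mult abs_of_nat right_diff_distrib)
          then show ?thesis using y(2)[OF True, of j] that by (simp add: field_simps)
        qed
        then show "eventually (\<lambda>j. norm (y j r - x r) \<le> 2 / real j) sequentially"
          by (rule eventually_mono[OF eventually_gt_at_top[of 0]])
        show "(\<lambda>j. 2 / real j) \<longlonglongrightarrow> 0" by (rule lim_const_over_n)
      qed
      then show ?thesis by (simp add: LIM_zero_iff)
    next
      case False
      then have "y j r = x r" for j using x y(1)[of j] by (auto simp: unit_cube_def PiE_def extensional_def)
      then show ?thesis by simp
    qed
  qed
  then have "(\<lambda>j. a (y j)) \<longlonglongrightarrow> a x"
    by (rule continuous_within_tendsto_compose'[OF a y(1)])
  then have "(\<lambda>j. cmod (a (y j))) \<longlonglongrightarrow> cmod (a x)" by (rule tendsto_norm)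
  then have "eventually (\<lambda>j. cmod (a (y j)) < cmod (a x) + 1) sequentially"
    by (rule order_tendstoD) simp
  moreover have "eventually (\<lambda>j. cmod (a x) + 1 < real j) sequentially"
    using filterlim_real_sequentially by (simp add: filterlim_at_top_dense)
  ultimately show ?thesis
    by eventually_elim (use y(3) in fastforce)
qed

lemma emeasure_box:
  assumes "\<And>r. r < q \<Longrightarrow> l r \<le> u r"
  shows "emeasure (borel_lebesgue q) (Pi\<^sub>E {..<q} (\<lambda>r. {l r<..u r})) = ennreal (\<Prod>r<q. u r - l r)"
proof -
  interpret L: product_sigma_finite "\<lambda>_::nat. lborel :: real measure" by standard
  have "emeasure (borel_lebesgue q) (Pi\<^sub>E {..<q} (\<lambda>r. {l r<..u r})) = (\<Prod>r<q. emeasure lborel {l r<..u r})"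
    unfolding borel_lebesgue_def by (rule L.emeasure_PiM) auto
  also have "\<dots> = (\<Prod>r<q. ennreal (u r - l r))" using assms by (intro prod.cong) auto
  also have "\<dots> = ennreal (\<Prod>r<q. u r - l r)" using assms by (intro prod_ennreal) auto
  finally show ?thesis .
qed

lemma emeasure_unit_cube: "emeasure (borel_lebesgue q) (unit_cube q) = 1"
proof -
  interpret L: product_sigma_finite "\<lambda>_::nat. lborel :: real measure" by standard
  have "emeasure (borel_lebesgue q) (unit_cube q) = (\<Prod>r<q. emeasure lborel {0..1::real})"
    unfolding borel_lebesgue_def unit_cube_def by (rule L.emeasure_PiM) auto
  then show ?thesis by simp
qed

text \<open>The rough sets need not decrease with j, since the cells of different levels are not
  nested. Dominated convergence under the indicator of the cube is used instead of continuity of the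
  measure from above.\<close>

lemma rough_set_tendsto:
  assumes "AE x in unit_measure q. continuous (at x within unit_cube q) a"
  shows "(\<lambda>j. emeasure (borel_lebesgue q) (rough_set q a j)) \<longlonglongrightarrow> 0"
proof -
  have "(\<lambda>j. \<integral>\<^sup>+x. indicator (rough_set q a j) x \<partial>borel_lebesgue q) \<longlonglongrightarrow> (\<integral>\<^sup>+x. 0 \<partial>borel_lebesgue q)"
  proof (rule nn_integral_dominated_convergence[where w = "indicator (unit_cube q)"])
    show "AE x in borel_lebesgue q. (\<lambda>j. indicator (rough_set q a j) x) \<longlonglongrightarrow> (0::ennreal)"
      using assms unfolding AE_unit_measure
    proof eventually_elim
      case (elim x)
      have "eventually (\<lambda>j. x \<notin> rough_set q a j) sequentially"
      proof (cases "x \<in> unit_cube q")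
        case True
        then show ?thesis using elim by (intro eventually_not_rough) auto
      qed (simp add: rough_set_def)
      then have "eventually (\<lambda>j. indicator (rough_set q a j) x = (0::ennreal)) sequentially"
        by eventually_elim simp
      then show ?case by (rule tendsto_eventually)
    qed
    show "AE x in borel_lebesgue q. indicator (rough_set q a j) x \<le> (indicator (unit_cube q) x :: ennreal)" for j
      by (intro AE_I2) (auto simp: indicator_def rough_set_def)
  qed (use rough_set_measurable emeasure_unit_cube in auto)
  then show ?thesis using rough_set_measurable by simp
qed

text \<open>Counting by volume: the large samples own disjoint grid cells of volume 1/N inside a
  rough set of measure below \<epsilon>. The level j is chosen before the grid, so the threshold
  depends on \<epsilon> and a alone.\<close>

lemma card_large_samples:
  fixes \<epsilon> :: real
  assumes a: "AE x in unit_measure q. continuous (at x within unit_cube q) a" and "0 < \<epsilon>"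
  shows "\<exists>K\<ge>0. \<exists>b. \<forall>m. length m = q \<and> (\<forall>k\<in>set m. b \<le> k) \<longrightarrow>
    real (card {i. i < prod_list m \<and> K < cmod (a (grid_point m (multi_range m ! i)))}) \<le> \<epsilon> * real (prod_list m)"
proof -
  have "eventually (\<lambda>j. emeasure (borel_lebesgue q) (rough_set q a j) < ennreal \<epsilon>) sequentially"
    using rough_set_tendsto[OF a] assms(2) by (intro order_tendstoD) auto
  then obtain j where j: "emeasure (borel_lebesgue q) (rough_set q a j) < ennreal \<epsilon>"
    by (auto simp: eventually_sequentially)
  \<comment> \<open>Components of at least j + 1 make j times a grid step less than 1, so integer
    parts across one cell differ by at most 1.\<close>
  have "real (card {i. i < prod_list m \<and> real j < cmod (a (grid_point m (multi_range m ! i)))}) \<le> \<epsilon> * real (prod_list m)"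
    if m: "length m = q" "\<forall>k\<in>set m. Suc j \<le> k" for m
  proof -
    let ?N = "prod_list m"
    define S where "S = {i. i < ?N \<and> real j < cmod (a (grid_point m (multi_range m ! i)))}"
    have S: "finite S" "\<And>i. i \<in> S \<Longrightarrow> i < ?N" by (auto simp: S_def)
    have mr: "Suc j \<le> m ! r" if "r < q" for r using m that by (metis nth_mem)
    have N: "real ?N = (\<Prod>r<q. real (m ! r))"
      by (simp add: prod.list_conv_set_nth m(1)[symmetric] lessThan_atLeast0)
    have Npos: "0 < real ?N" unfolding N using mr by (intro prod_pos) fastforce
    \<comment> \<open>The cell has the grid point as its upper corner, and is half-open so that
      distinct cells are disjoint.\<close>
    define cell where "cell i = Pi\<^sub>E {..<q} (\<lambda>r. {(real (multi_range m ! i ! r) - 1) / real (m ! r)<..real (multi_range m ! i ! r) / real (m ! r)})" for i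
    have cell: "cell i \<in> sets (borel_lebesgue q)" "emeasure (borel_lebesgue q) (cell i) = ennreal (1 / ?N)" for i
    proof -
      show "cell i \<in> sets (borel_lebesgue q)"
        unfolding cell_def borel_lebesgue_def by (intro sets_PiM_I_finite) auto
      have "emeasure (borel_lebesgue q) (cell i) = ennreal (\<Prod>r<q. real (multi_range m ! i ! r) / real (m ! r) - (real (multi_range m ! i ! r) - 1) / real (m ! r))"
        unfolding cell_def by (rule emeasure_box) (simp add: divide_right_mono)
      also have "(\<Prod>r<q. real (multi_range m ! i ! r) / real (m ! r) - (real (multi_range m ! i ! r) - 1) / real (m ! r)) = (\<Prod>r<q. 1 / real (m ! r))"
        by (intro prod.cong) (auto simp: diff_divide_distrib)
      also have "\<dots> = 1 / ?N" unfolding N by (simp add: prod_dividef)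
      finally show "emeasure (borel_lebesgue q) (cell i) = ennreal (1 / ?N)" .
    qed
    have disj: "disjoint_family_on cell S"
      unfolding disjoint_family_on_def
    proof (intro ballI impI)
      fix i k assume ik: "i \<in> S" "k \<in> S" "i \<noteq> k"
      have "multi_range m ! i \<noteq> multi_range m ! k" using ik S(2) by (simp add: multi_range_eq_iff)
      then obtain r where r: "r < q" "multi_range m ! i ! r \<noteq> multi_range m ! k ! r"
        using multi_range_nth(1)[of i m] multi_range_nth(1)[of k m] S(2) ik m(1) by (metis nth_equalityI)
      have mp: "0 < real (m ! r)" using mr[OF r(1)] by simp
      show "cell i \<inter> cell k = {}"
      proof (rule ccontr)
        assume "cell i \<inter> cell k \<noteq> {}"
        then obtain x where "x \<in> cell i" "x \<in> cell k" by blast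
        then have x: "x r \<in> {(real (multi_range m ! i ! r) - 1) / real (m ! r)<..real (multi_range m ! i ! r) / real (m ! r)}"
          "x r \<in> {(real (multi_range m ! k ! r) - 1) / real (m ! r)<..real (multi_range m ! k ! r) / real (m ! r)}"
          unfolding cell_def using r(1) by (auto dest!: PiE_mem[of _ _ _ r])
        \<comment> \<open>Scaled by \<open>m ! r\<close>, the two sides become half-open unit
          intervals ending at distinct integers.\<close>
        define z where "z = x r * real (m ! r)"
        have "real (multi_range m ! i ! r) - 1 < z" "z \<le> real (multi_range m ! i ! r)"
          "real (multi_range m ! k ! r) - 1 < z" "z \<le> real (multi_range m ! k ! r)"
          unfolding z_def using x mp by (simp_all add: field_simps)
        then show False using r(2) by linarith
      qed
    qed
    have sub: "cell i \<subseteq> rough_set q a j" if i: "i \<in> S" for i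
    proof
      fix x assume x: "x \<in> cell i"
      let ?l = "multi_range m ! i"
      have l: "1 \<le> ?l ! r" "?l ! r \<le> m ! r" if "r < q" for r
        using multi_range_nth(2)[of i m r] S(2)[OF i] that m(1) by auto
      have xr: "(real (?l ! r) - 1) / real (m ! r) < x r" "x r \<le> real (?l ! r) / real (m ! r)" if "r < q" for r
        using PiE_mem[OF x[unfolded cell_def], of r] that by auto
      have mp: "0 < real (m ! r)" if "r < q" for r using mr[OF that] by simp
      have le1: "real (?l ! r) / real (m ! r) \<le> 1" if "r < q" for r using l(2)[OF that] mp[OF that] by simp
      have "0 \<le> x r \<and> x r \<le> 1" if "r < q" for r
        using xr[OF that] le1[OF that] l(1)[OF that] mp[OF that]
        by (smt (verit) divide_nonneg_pos of_nat_1 of_nat_mono)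
      moreover have "x \<in> extensional {..<q}" using x by (auto simp: cell_def PiE_def)
      ultimately have xc: "x \<in> unit_cube q" by (auto simp: unit_cube_def PiE_iff)
      have yc: "grid_point m ?l \<in> unit_cube q"
        using le1 m(1) by (auto simp: grid_point_def unit_cube_def)
      have "\<bar>\<lfloor>real j * x r\<rfloor> - \<lfloor>real j * grid_point m ?l r\<rfloor>\<bar> \<le> 1" if r: "r < q" for r
      proof -
        have g: "grid_point m ?l r = real (?l ! r) / real (m ! r)" using r m(1) by (simp add: grid_point_def)
        have "real j * (real (?l ! r) / real (m ! r) - x r) \<le> real j * (1 / real (m ! r))"
          using xr(1)[OF r] by (intro mult_left_mono) (simp_all add: diff_divide_distrib)
        also have "\<dots> < 1" using mr[OF r] by simp
        finally have 1: "real j * grid_point m ?l r - real j * x r < 1" unfolding g by (simp add: right_diff_distrib)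
        have 2: "real j * x r \<le> real j * grid_point m ?l r" unfolding g using xr(2)[OF r] by (intro mult_left_mono) auto
        show ?thesis using 1 2 by linarith
      qed
      then show "x \<in> rough_set q a j"
        using xc yc i unfolding rough_set_def S_def by blast
    qed
    have "ennreal (card S * (1 / ?N)) = (\<Sum>i\<in>S. emeasure (borel_lebesgue q) (cell i))"
      unfolding cell(2) by (simp add: ennreal_of_nat_eq_real_of_nat flip: ennreal_mult)
    also have "\<dots> = emeasure (borel_lebesgue q) (\<Union>i\<in>S. cell i)"
      using cell(1) disj S(1) by (intro sum_emeasure) auto
    also have "\<dots> \<le> emeasure (borel_lebesgue q) (rough_set q a j)"
      using sub by (intro emeasure_mono rough_set_measurable) auto
    also have "\<dots> \<le> ennreal \<epsilon>" using j by simp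
    finally have "card S * (1 / ?N) \<le> \<epsilon>" using assms(2) by (simp add: ennreal_le_iff)
    then show ?thesis using Npos unfolding S_def[symmetric] by (simp add: field_simps)
  qed
  then show ?thesis by (intro exI[of _ "real j"] conjI exI[of _ "Suc j"] allI impI) auto
qed

section \<open>Sparse unboundedness and approximating classes\<close>

lemma eventually_along: "eventually P (along I) \<longleftrightarrow> (\<exists>n0. \<forall>n\<in>I. n0 \<le> n \<longrightarrow> P n)"
  unfolding along_def eventually_inf_principal eventually_sequentially by blast

lemma multi_index_seq_iff:
  "multi_index_seq I q m \<longleftrightarrow> 0 < q \<and> (\<forall>n\<in>I. length (m n) = q \<and> (\<forall>k\<in>set (m n). 0 < k)) \<and>
     (\<forall>b. \<forall>\<^sub>F n in along I. \<forall>k\<in>set (m n). b \<le> k)"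
proof -
  have "(\<forall>\<^sub>F n in along I. b \<le> Min (set (m n))) \<longleftrightarrow> (\<forall>\<^sub>F n in along I. \<forall>k\<in>set (m n). b \<le> k)"
    if "0 < q" "\<forall>n\<in>I. length (m n) = q" for b
  proof -
    have "b \<le> Min (set (m n)) \<longleftrightarrow> (\<forall>k\<in>set (m n). b \<le> k)" if "n \<in> I" for n
      using \<open>0 < q\<close> \<open>\<forall>n\<in>I. length (m n) = q\<close> that by (subst Min_ge_iff) auto
    then show ?thesis unfolding eventually_along by auto
  qed
  then show ?thesis unfolding multi_index_seq_def filterlim_at_top by blast
qed

lemma eventually_along_in: "eventually (\<lambda>n. n \<in> I) (along I)"
  unfolding eventually_along by blast

text \<open>One number bounds both the proportion of rank and the norm, which turns convergence of
  approximating classes into closeness in the manner of a metric.\<close>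

definition acs_close :: "nat set \<Rightarrow> (nat \<Rightarrow> nat) \<Rightarrow> (nat \<Rightarrow> nat) \<Rightarrow> (nat \<Rightarrow> complex mat) \<Rightarrow> (nat \<Rightarrow> complex mat) \<Rightarrow> real \<Rightarrow> bool" where
  "acs_close I d e A B \<epsilon> \<longleftrightarrow> (\<forall>\<^sub>F n in along I.
     splits {..<d n} {..<e n} (\<lambda>i j. A n $$ (i, j) - B n $$ (i, j)) (\<epsilon> * real (min (d n) (e n))) \<epsilon>)"

text \<open>The whole difference is put into the low rank part.\<close>

lemma acs_close_one: "acs_close I d e A B 1"
  unfolding acs_close_def
proof (rule always_eventually, rule allI)
  fix n
  show "splits {..<d n} {..<e n} (\<lambda>i j. A n $$ (i, j) - B n $$ (i, j)) (1 * real (min (d n) (e n))) 1"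
    by (rule splitsI[OF _ outer_rank_le_min, where E = "\<lambda>_ _. 0"]) (auto intro: op_bounded_mono[OF op_bounded_zero])
qed

text \<open>The definition asks for null sequences c and \<omega> that serve all k at once. From
  closeness for every \<epsilon> a common one is built by taking at each k the best closeness
  1/(j+1) that holds there.\<close>

lemma acs_iff:
  "acs I d e B A \<longleftrightarrow> matrix_seq I d e A \<and> (\<forall>m\<ge>1. matrix_seq I d e (B m)) \<and>
     (\<forall>\<epsilon>>0. \<exists>K. \<forall>k\<ge>K. 1 \<le> k \<longrightarrow> acs_close I d e A (B k) \<epsilon>)"
proof (intro iffI conjI)
  assume acs: "acs I d e B A"
  then show seq: "matrix_seq I d e A" "\<forall>m\<ge>1. matrix_seq I d e (B m)" by (auto simp: acs_def)
  obtain n0 :: "nat \<Rightarrow> nat" and c \<omega> :: "nat \<Rightarrow> real" where c: "c \<longlonglongrightarrow> 0" and \<omega>: "\<omega> \<longlonglongrightarrow> 0" and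
    *: "\<And>m n. 1 \<le> m \<Longrightarrow> n \<in> I \<Longrightarrow> n0 m \<le> n \<Longrightarrow>
           (\<exists>R\<in>carrier_mat (d n) (e n). \<exists>E\<in>carrier_mat (d n) (e n). A n = B m n + R + E \<and>
              real (mat_rank R) \<le> c m * real (min (d n) (e n)) \<and> spectral_norm E \<le> \<omega> m)"
    using acs unfolding acs_def by blast
  show "\<forall>\<epsilon>>0. \<exists>K. \<forall>k\<ge>K. 1 \<le> k \<longrightarrow> acs_close I d e A (B k) \<epsilon>"
  proof (intro allI impI)
    fix \<epsilon> :: real assume \<epsilon>: "0 < \<epsilon>"
    have "eventually (\<lambda>k. c k < \<epsilon> \<and> \<omega> k < \<epsilon>) sequentially"
      using order_tendstoD(2)[OF c \<epsilon>] order_tendstoD(2)[OF \<omega> \<epsilon>] by eventually_elim simp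
    then obtain K where K: "\<And>k. K \<le> k \<Longrightarrow> c k < \<epsilon> \<and> \<omega> k < \<epsilon>" by (auto simp: eventually_sequentially)
    have "acs_close I d e A (B k) \<epsilon>" if k: "K \<le> k" "1 \<le> k" for k
      unfolding acs_close_def eventually_along
    proof (intro exI[of _ "n0 k"] ballI impI)
      fix n assume n: "n \<in> I" "n0 k \<le> n"
      obtain R E where RE: "R \<in> carrier_mat (d n) (e n)" "E \<in> carrier_mat (d n) (e n)" "A n = B k n + R + E"
        "real (mat_rank R) \<le> c k * real (min (d n) (e n))" "spectral_norm E \<le> \<omega> k"
        using *[OF k(2) n] by blast
      have "real (mat_rank R) \<le> \<epsilon> * real (min (d n) (e n))"
        using RE(4) K[OF k(1)] by (smt (verit) mult_right_mono of_nat_0_le_iff)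
      moreover have "spectral_norm E \<le> \<epsilon>" using RE(5) K[OF k(1)] by simp
      moreover have "A n \<in> carrier_mat (d n) (e n)" "B k n \<in> carrier_mat (d n) (e n)"
        using seq n k unfolding matrix_seq_def by auto
      ultimately show "splits {..<d n} {..<e n} (\<lambda>i j. A n $$ (i, j) - B k n $$ (i, j)) (\<epsilon> * real (min (d n) (e n))) \<epsilon>"
        using splits_mat_iff[of "A n" "d n" "e n" "B k n" \<epsilon> "\<epsilon> * real (min (d n) (e n))"] RE(1-3) \<epsilon> by (meson less_imp_le)
    qed
    then show "\<exists>K. \<forall>k\<ge>K. 1 \<le> k \<longrightarrow> acs_close I d e A (B k) \<epsilon>" by blast
  qed
next
  assume asm: "matrix_seq I d e A \<and> (\<forall>m\<ge>1. matrix_seq I d e (B m)) \<and>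
     (\<forall>\<epsilon>>0. \<exists>K. \<forall>k\<ge>K. 1 \<le> k \<longrightarrow> acs_close I d e A (B k) \<epsilon>)"
  \<comment> \<open>The constraint \<open>j \<le> k\<close> ensures that a greatest j exists, and j
    = 0 is always admissible by \<open>acs_close_one\<close>.\<close>
  define P where "P k j \<longleftrightarrow> j \<le> k \<and> acs_close I d e A (B k) (1 / real (Suc j))" for k j
  define g where "g k = (GREATEST j. P k j)" for k
  have P0: "P k 0" for k using acs_close_one by (simp add: P_def)
  have Pb: "P k j \<Longrightarrow> j \<le> k" for k j by (simp add: P_def)
  have g: "P k (g k)" for k unfolding g_def using P0 Pb by (rule GreatestI_nat)
  have g_max: "P k j \<Longrightarrow> j \<le> g k" for k j unfolding g_def using Pb by (intro Greatest_le_nat[of _ _ k]) auto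
  define \<delta> where "\<delta> k = 1 / real (Suc (g k))" for k
  have \<delta>0: "\<delta> \<longlonglongrightarrow> 0"
  proof (rule LIMSEQ_I)
    fix \<epsilon> :: real assume "0 < \<epsilon>"
    then obtain J where J: "1 / real (Suc J) < \<epsilon>" using nat_approx_posE by blast
    obtain K where K: "\<forall>k\<ge>K. 1 \<le> k \<longrightarrow> acs_close I d e A (B k) (1 / real (Suc J))"
      using asm[THEN conjunct2, THEN conjunct2, rule_format, of "1 / real (Suc J)"] by fastforce
    have "norm (\<delta> k - 0) < \<epsilon>" if "max (max K J) 1 \<le> k" for k
    proof -
      have "K \<le> k" "J \<le> k" "1 \<le> k" using that by simp_all
      then have "P k J" using K unfolding P_def by blast
      then have "J \<le> g k" by (rule g_max)
      then have "\<delta> k \<le> 1 / real (Suc J)" unfolding \<delta>_def by (simp add: frac_le)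
      then show ?thesis using J by (simp add: \<delta>_def)
    qed
    then show "\<exists>k0. \<forall>k\<ge>k0. norm (\<delta> k - 0) < \<epsilon>" by blast
  qed
  have "\<forall>k. \<exists>n0. \<forall>n\<in>I. n0 \<le> n \<longrightarrow>
      splits {..<d n} {..<e n} (\<lambda>i j. A n $$ (i, j) - B k n $$ (i, j)) (\<delta> k * real (min (d n) (e n))) (\<delta> k)"
    using g unfolding P_def \<delta>_def acs_close_def eventually_along by simp
  from choice[OF this] obtain n0 where n0: "\<And>k n. n \<in> I \<Longrightarrow> n0 k \<le> n \<Longrightarrow>
      splits {..<d n} {..<e n} (\<lambda>i j. A n $$ (i, j) - B k n $$ (i, j)) (\<delta> k * real (min (d n) (e n))) (\<delta> k)"
    by blast
  have "\<exists>R\<in>carrier_mat (d n) (e n). \<exists>E\<in>carrier_mat (d n) (e n). A n = B k n + R + E \<and>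
        real (mat_rank R) \<le> \<delta> k * real (min (d n) (e n)) \<and> spectral_norm E \<le> \<delta> k"
    if "1 \<le> k" "n \<in> I" "n0 k \<le> n" for k n
  proof -
    have "A n \<in> carrier_mat (d n) (e n)" "B k n \<in> carrier_mat (d n) (e n)"
      using asm that unfolding matrix_seq_def by auto
    moreover have "0 \<le> \<delta> k" by (simp add: \<delta>_def)
    ultimately show ?thesis using splits_mat_iff n0[OF that(2,3)] by blast
  qed
  note * = this
  show "acs I d e B A"
    unfolding acs_def
  proof (intro conjI exI[of _ n0] exI[of _ \<delta>] allI impI ballI)
    fix m :: nat assume "1 \<le> m"
    then show "matrix_seq I d e (B m)" using asm by blast
  qed (use asm \<delta>0 * in blast)+
qed

text \<open>Usually stated by counting singular values above M. A splitting with a low rank part and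
  a part of norm at most M expresses the same smallness of that count.\<close>

definition sparsely_unbounded :: "nat set \<Rightarrow> (nat \<Rightarrow> nat) \<Rightarrow> (nat \<Rightarrow> nat) \<Rightarrow> (nat \<Rightarrow> complex mat) \<Rightarrow> bool" where
  "sparsely_unbounded I d e A \<longleftrightarrow> (\<forall>\<epsilon>::real. 0 < \<epsilon> \<longrightarrow> (\<exists>M. \<forall>\<^sub>F n in along I.
     splits {..<d n} {..<e n} (\<lambda>i j. A n $$ (i, j)) (\<epsilon> * real (min (d n) (e n))) M))"

lemma sparsely_unbounded_mat_sum:
  assumes "finite K" and F: "\<And>l. l \<in> K \<Longrightarrow> sparsely_unbounded I d e (F l)"
  shows "sparsely_unbounded I d e (\<lambda>n. mat_sum (d n) (e n) (\<lambda>l. F l n) K)"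
  unfolding sparsely_unbounded_def
proof (intro allI impI)
  fix \<epsilon> :: real assume \<epsilon>: "0 < \<epsilon>"
  \<comment> \<open>The summand 1 keeps the quotient meaningful when there are no terms.\<close>
  define \<epsilon>' where "\<epsilon>' = \<epsilon> / (card K + 1)"
  have \<epsilon>': "0 < \<epsilon>'" using \<epsilon> by (simp add: \<epsilon>'_def)
  have "\<exists>M. \<forall>l\<in>K. \<forall>\<^sub>F n in along I. splits {..<d n} {..<e n} (\<lambda>i j. F l n $$ (i, j)) (\<epsilon>' * real (min (d n) (e n))) (M l)"
    using F \<epsilon>' unfolding sparsely_unbounded_def by (intro bchoice) blast
  then obtain M where M: "\<And>l. l \<in> K \<Longrightarrow> \<forall>\<^sub>F n in along I. splits {..<d n} {..<e n} (\<lambda>i j. F l n $$ (i, j)) (\<epsilon>' * real (min (d n) (e n))) (M l)"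
    by blast
  have "\<forall>\<^sub>F n in along I. \<forall>l\<in>K. splits {..<d n} {..<e n} (\<lambda>i j. F l n $$ (i, j)) (\<epsilon>' * real (min (d n) (e n))) (M l)"
    using assms(1) M by (simp add: eventually_ball_finite_distrib)
  then have "\<forall>\<^sub>F n in along I. splits {..<d n} {..<e n} (\<lambda>i j. mat_sum (d n) (e n) (\<lambda>l. F l n) K $$ (i, j)) (\<epsilon> * real (min (d n) (e n))) (\<Sum>l\<in>K. M l)"
  proof eventually_elim
    case (elim n)
    have "splits {..<d n} {..<e n} (\<lambda>i j. \<Sum>l\<in>K. F l n $$ (i, j)) (\<Sum>l\<in>K. \<epsilon>' * real (min (d n) (e n))) (\<Sum>l\<in>K. M l)"
      using assms(1) elim by (intro splits_sum) auto
    moreover have "(\<Sum>l\<in>K. \<epsilon>' * real (min (d n) (e n))) \<le> \<epsilon> * real (min (d n) (e n))"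
    proof -
      have "(\<Sum>l\<in>K. \<epsilon>' * real (min (d n) (e n))) = (card K * \<epsilon>') * real (min (d n) (e n))" by simp
      also have "card K * \<epsilon>' \<le> \<epsilon>" using \<epsilon> by (simp add: \<epsilon>'_def field_simps)
      finally show ?thesis by (simp add: mult_right_mono)
    qed
    ultimately have "splits {..<d n} {..<e n} (\<lambda>i j. \<Sum>l\<in>K. F l n $$ (i, j)) (\<epsilon> * real (min (d n) (e n))) (\<Sum>l\<in>K. M l)"
      by (rule splits_mono) simp
    then show ?case by (subst splits_cong[of _ _ _ "\<lambda>i j. \<Sum>l\<in>K. F l n $$ (i, j)"]) (auto simp: mat_sum_def)
  qed
  then show "\<exists>M. \<forall>\<^sub>F n in along I. splits {..<d n} {..<e n} (\<lambda>i j. mat_sum (d n) (e n) (\<lambda>l. F l n) K $$ (i, j)) (\<epsilon> * real (min (d n) (e n))) M"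
    by blast
qed

text \<open>A single member of the class that is close within \<epsilon>/2 suffices; it leaves
  \<epsilon>/2 for its own rank budget.\<close>

lemma sparsely_unbounded_acs:
  assumes "acs I d e B A" "\<And>k. 1 \<le> k \<Longrightarrow> sparsely_unbounded I d e (B k)"
  shows "sparsely_unbounded I d e A"
  unfolding sparsely_unbounded_def
proof (intro allI impI)
  fix \<epsilon> :: real assume \<epsilon>: "0 < \<epsilon>"
  then obtain K where K: "\<forall>k\<ge>K. 1 \<le> k \<longrightarrow> acs_close I d e A (B k) (\<epsilon> / 2)"
    using assms(1) unfolding acs_iff by (meson half_gt_zero)
  define k where "k = max K 1"
  have c: "acs_close I d e A (B k) (\<epsilon> / 2)" using K by (simp add: k_def)
  obtain M where M: "\<forall>\<^sub>F n in along I. splits {..<d n} {..<e n} (\<lambda>i j. B k n $$ (i, j)) (\<epsilon> / 2 * real (min (d n) (e n))) M"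
    using assms(2)[of k] \<epsilon> unfolding sparsely_unbounded_def k_def by (meson half_gt_zero max.cobounded2)
  have "\<forall>\<^sub>F n in along I. splits {..<d n} {..<e n} (\<lambda>i j. A n $$ (i, j)) (\<epsilon> * real (min (d n) (e n))) (\<epsilon> / 2 + M)"
    using c[unfolded acs_close_def] M
  proof eventually_elim
    case (elim n)
    show ?case using splits_add[OF elim] by (simp add: field_simps)
  qed
  then show "\<exists>M. \<forall>\<^sub>F n in along I. splits {..<d n} {..<e n} (\<lambda>i j. A n $$ (i, j)) (\<epsilon> * real (min (d n) (e n))) M" by blast
qed

lemma sparsely_unbounded_toeplitz:
  assumes "multi_index_seq I q m" "0 < s" "0 < t"
    and f: "\<And>\<alpha> \<beta>. \<alpha> < s \<Longrightarrow> \<beta> < t \<Longrightarrow> integrable (pi_measure q) (\<lambda>\<theta>. f \<theta> $$ (\<alpha>, \<beta>))"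
  shows "sparsely_unbounded I (\<lambda>n. prod_list (m n) * s) (\<lambda>n. prod_list (m n) * t) (\<lambda>n. toeplitz_mat (m n) s t f)"
  unfolding sparsely_unbounded_def
proof (intro allI impI)
  fix \<epsilon> :: real assume \<epsilon>: "0 < \<epsilon>"
  define F where "F = (\<Sum>(\<alpha>, \<beta>)\<in>{..<s} \<times> {..<t}. \<integral>\<theta>. cmod (1 / complex_of_real ((2 * pi) ^ q) * f \<theta> $$ (\<alpha>, \<beta>)) \<partial>pi_measure q)"
  have F: "0 \<le> F" unfolding F_def by (intro sum_nonneg) auto
  \<comment> \<open>Chosen to make 2F/\<tau> at most \<epsilon>; the added 1 keeps it positive when
    F vanishes.\<close>
  define \<tau> where "\<tau> = (2 * F + 1) / \<epsilon>"
  have \<tau>: "0 < \<tau>" using F \<epsilon> by (simp add: \<tau>_def)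
  have "2 * F / \<tau> \<le> \<epsilon>" using F \<epsilon> by (simp add: \<tau>_def field_simps)
  have "\<forall>\<^sub>F n in along I. splits {..<prod_list (m n) * s} {..<prod_list (m n) * t}
      (\<lambda>i j. toeplitz_mat (m n) s t f $$ (i, j)) (\<epsilon> * real (min (prod_list (m n) * s) (prod_list (m n) * t))) (real (s * t) * \<tau>)"
    using eventually_along_in
  proof eventually_elim
    case (elim n)
    have "length (m n) = q" using assms(1) elim unfolding multi_index_seq_def by blast
    have "splits {..<prod_list (m n) * s} {..<prod_list (m n) * t} (\<lambda>i j. toeplitz_mat (m n) s t f $$ (i, j))
        (2 * F / \<tau> * real (min (prod_list (m n) * s) (prod_list (m n) * t))) (real (s * t) * \<tau>)"
      unfolding F_def by (rule toeplitz_splits[OF \<open>length (m n) = q\<close> assms(2,3) \<tau> f])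
    then show ?case
      by (rule splits_mono[OF _ mult_right_mono[OF \<open>2 * F / \<tau> \<le> \<epsilon>\<close>]]) simp_all
  qed
  then show "\<exists>M. \<forall>\<^sub>F n in along I. splits {..<prod_list (m n) * s} {..<prod_list (m n) * t}
      (\<lambda>i j. toeplitz_mat (m n) s t f $$ (i, j)) (\<epsilon> * real (min (prod_list (m n) * s) (prod_list (m n) * t))) M" by blast
qed

text \<open>Each large sample of \<open>a\<close> affects the s rows of one block. Their total
  number is a small proportion of the dimension and is charged to the rank; all other rows are
  scaled by at most K.\<close>

lemma sparsely_unbounded_diag_mult:
  assumes m: "multi_index_seq I q m" and st: "0 < s" "0 < t"
    and a: "AE x in unit_measure q. continuous (at x within unit_cube q) a"
    and T: "sparsely_unbounded I (\<lambda>n. prod_list (m n) * s) (\<lambda>n. prod_list (m n) * t) T"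
    and car: "\<And>n. T n \<in> carrier_mat (prod_list (m n) * s) (prod_list (m n) * t)"
  shows "sparsely_unbounded I (\<lambda>n. prod_list (m n) * s) (\<lambda>n. prod_list (m n) * t)
    (\<lambda>n. diag_sampling_mat (m n) s s (\<lambda>x. a x \<cdot>\<^sub>m 1\<^sub>m s) * T n)"
  unfolding sparsely_unbounded_def
proof (intro allI impI)
  fix \<epsilon> :: real assume \<epsilon>: "0 < \<epsilon>"
  let ?d = "\<lambda>n. prod_list (m n) * s" and ?e = "\<lambda>n. prod_list (m n) * t"
  obtain M where M: "\<forall>\<^sub>F n in along I. splits {..<?d n} {..<?e n} (\<lambda>i j. T n $$ (i, j)) (\<epsilon> / 2 * real (min (?d n) (?e n))) M"
    using T \<epsilon> unfolding sparsely_unbounded_def by (meson half_gt_zero)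
  \<comment> \<open>The divisor s pays for the rows per block, and 2 leaves half of the budget to
    \<open>T\<close>. Since s and t are positive, N is at most the smaller dimension.\<close>
  have "0 < \<epsilon> / (2 * s)" using \<epsilon> st by simp
  from card_large_samples[OF a this] obtain K b where K: "0 \<le> K" and b: "\<And>m. length m = q \<Longrightarrow> (\<forall>k\<in>set m. b \<le> k) \<Longrightarrow>
    real (card {i. i < prod_list m \<and> K < cmod (a (grid_point m (multi_range m ! i)))}) \<le> \<epsilon> / (2 * s) * real (prod_list m)"
    by blast
  have "\<forall>\<^sub>F n in along I. \<forall>k\<in>set (m n). b \<le> k" using m unfolding multi_index_seq_iff by blast
  with M eventually_along_in
  have "\<forall>\<^sub>F n in along I. splits {..<?d n} {..<?e n}
     (\<lambda>i j. (diag_sampling_mat (m n) s s (\<lambda>x. a x \<cdot>\<^sub>m 1\<^sub>m s) * T n) $$ (i, j)) (\<epsilon> * real (min (?d n) (?e n))) (K * M)"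
  proof eventually_elim
    case (elim n)
    let ?N = "prod_list (m n)"
    define c where "c i = a (grid_point (m n) (multi_range (m n) ! (i div s)))" for i
    define S where "S = {i. i < ?N \<and> K < cmod (a (grid_point (m n) (multi_range (m n) ! i)))}"
    have len: "length (m n) = q" using m elim unfolding multi_index_seq_def by blast
    have S: "real (card S) \<le> \<epsilon> / (2 * s) * real ?N" unfolding S_def using b[OF len] elim by blast
    have fS: "finite S" by (simp add: S_def)
    have "card {i \<in> {..<?d n}. K < cmod (c i)} \<le> card (S \<times> {..<s})"
    proof (rule card_inj_on_le[where f = "\<lambda>i. (i div s, i mod s)"])
      show "inj_on (\<lambda>i. (i div s, i mod s)) {i \<in> {..<?d n}. K < cmod (c i)}"
        by (rule inj_on_subset[OF bij_betw_imp_inj_on[OF bij_betw_div_mod[OF st(1)]]]) blast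
      show "(\<lambda>i. (i div s, i mod s)) ` {i \<in> {..<?d n}. K < cmod (c i)} \<subseteq> S \<times> {..<s}"
        using st by (auto simp: S_def c_def less_mult_imp_div_less)
    qed (use fS in simp)
    then have "real (card {i \<in> {..<?d n}. K < cmod (c i)}) \<le> real (card S) * real s"
      by (simp add: card_cartesian_product flip: of_nat_mult)
    also have "\<dots> \<le> \<epsilon> / (2 * s) * real ?N * real s" using S by (intro mult_right_mono) auto
    also have "\<dots> = \<epsilon> / 2 * real ?N" using st by simp
    also have "\<dots> \<le> \<epsilon> / 2 * real (min (?d n) (?e n))"
      using \<epsilon> st by (intro mult_left_mono) auto
    finally have "splits {..<?d n} {..<?e n} (\<lambda>i j. c i * T n $$ (i, j)) (\<epsilon> / 2 * real (min (?d n) (?e n)) + \<epsilon> / 2 * real (min (?d n) (?e n))) (K * M)"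
      by (intro splits_diag elim K) simp
    then have "splits {..<?d n} {..<?e n} (\<lambda>i j. c i * T n $$ (i, j)) (\<epsilon> * real (min (?d n) (?e n))) (K * M)"
      by (simp add: field_simps)
    moreover have "(diag_sampling_mat (m n) s s (\<lambda>x. a x \<cdot>\<^sub>m 1\<^sub>m s) * T n) $$ (i, j) = c i * T n $$ (i, j)"
      if "i < ?d n" "j < ?e n" for i j
      unfolding c_def by (rule diag_sampling_mult_index[OF car that])
    ultimately show ?case by (subst splits_cong[of _ _ _ "\<lambda>i j. c i * T n $$ (i, j)"]) auto
  qed
  then show "\<exists>M. \<forall>\<^sub>F n in along I. splits {..<?d n} {..<?e n}
     (\<lambda>i j. (diag_sampling_mat (m n) s s (\<lambda>x. a x \<cdot>\<^sub>m 1\<^sub>m s) * T n) $$ (i, j)) (\<epsilon> * real (min (?d n) (?e n))) M" by blast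
qed

definition GLT_approx :: "nat \<Rightarrow> nat \<Rightarrow> nat \<Rightarrow> nat list \<Rightarrow> nat \<Rightarrow> (nat \<Rightarrow> point \<Rightarrow> complex) \<Rightarrow> (nat \<Rightarrow> point \<Rightarrow> complex mat) \<Rightarrow> complex mat" where
  "GLT_approx q s t m L a f = mat_sum (prod_list m * s) (prod_list m * t)
     (\<lambda>l. diag_sampling_mat m s s (\<lambda>x. a l x \<cdot>\<^sub>m 1\<^sub>m s) * toeplitz_mat m s t (f l)) {1..L}"

lemma block_kron_dims: "n1 * n2 * (s1 * s2) = (n1 * s1) * (n2 * s2 :: nat)"
  by (simp add: ac_simps)

text \<open>Proportions of rank add, because the product of the smaller dimensions of the factors is
  at most the smaller dimension of the product.\<close>

lemma splits_block_kron:
  assumes X: "splits {..<n1 * s1} {..<n1 * t1} X (r1 * real (min (n1 * s1) (n1 * t1))) M1"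
    and Y: "splits {..<n2 * s2} {..<n2 * t2} Y (r2 * real (min (n2 * s2) (n2 * t2))) M2"
    and "0 \<le> r1" "0 \<le> r2"
  shows "splits {..<n1 * n2 * (s1 * s2)} {..<n1 * n2 * (t1 * t2)}
    (\<lambda>a b. X (block_index1 n2 s1 s2 a) (block_index1 n2 t1 t2 b) * Y (block_index2 n2 s1 s2 a) (block_index2 n2 t1 t2 b))
    ((r1 + r2) * real (min (n1 * n2 * (s1 * s2)) (n1 * n2 * (t1 * t2)))) (M1 * M2)"
proof -
  have "splits ({..<n1 * s1} \<times> {..<n2 * s2}) ({..<n1 * t1} \<times> {..<n2 * t2}) (\<lambda>(i, i') (j, j'). X i j * Y i' j')
    (r1 * real (min (n1 * s1) (n1 * t1)) * real (min (n2 * s2) (n2 * t2)) + r2 * real (min (n2 * s2) (n2 * t2)) * real (min (n1 * s1) (n1 * t1))) (M1 * M2)"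
    using splits_tensor[OF X Y] by simp
  from splits_reindex[OF bij_betw_block_index[of n2 s1 s2 n1] bij_betw_block_index[of n2 t1 t2 n1] this]
  have "splits {..<n1 * n2 * (s1 * s2)} {..<n1 * n2 * (t1 * t2)}
    (\<lambda>a b. X (block_index1 n2 s1 s2 a) (block_index1 n2 t1 t2 b) * Y (block_index2 n2 s1 s2 a) (block_index2 n2 t1 t2 b))
    ((r1 + r2) * (real (min (n1 * s1) (n1 * t1)) * real (min (n2 * s2) (n2 * t2)))) (M1 * M2)"
    by (simp add: algebra_simps)
  moreover have "real (min (n1 * s1) (n1 * t1)) * real (min (n2 * s2) (n2 * t2)) \<le> real (min (n1 * n2 * (s1 * s2)) (n1 * n2 * (t1 * t2)))"
  proof -
    have "min (n1 * s1) (n1 * t1) * min (n2 * s2) (n2 * t2) \<le> min ((n1 * s1) * (n2 * s2)) ((n1 * t1) * (n2 * t2))"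
      by (intro min.boundedI mult_le_mono) auto
    then show ?thesis unfolding block_kron_dims[of n1 n2 s1 s2] block_kron_dims[of n1 n2 t1 t2]
      by (simp only: of_nat_mult[symmetric] of_nat_le_iff)
  qed
  ultimately show ?thesis
    using assms(3,4) by (elim splits_mono) (simp_all add: mult_left_mono)
qed

lemma splits_uminus: "splits I J X r M \<Longrightarrow> finite I \<Longrightarrow> splits I J (\<lambda>i j. - X i j) r M"
  using splits_diag[of I J X r M 1 "\<lambda>_. -1" 0] by simp

lemma block_kron_entry:
  "\<lbrakk>a < n1 * n2 * (s1 * s2); b < n1 * n2 * (t1 * t2)\<rbrakk> \<Longrightarrow> block_kron n1 n2 s1 s2 t1 t2 X Y $$ (a, b) =
    X $$ (block_index1 n2 s1 s2 a, block_index1 n2 t1 t2 b) * Y $$ (block_index2 n2 s1 s2 a, block_index2 n2 t1 t2 b)"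
  by (simp add: block_kron_def)

text \<open>The order of the choices matters: the bound M for X and Y comes from sparse
  unboundedness at the level \<rho>, and only then is the closeness \<delta> of the factors chosen
  against M.\<close>

lemma acs_block_kron:
  fixes B C :: "nat \<Rightarrow> nat \<Rightarrow> complex mat" and N1 N2 :: "nat \<Rightarrow> nat"
  assumes su: "sparsely_unbounded I (\<lambda>n. N1 n * s1) (\<lambda>n. N1 n * t1) X" "sparsely_unbounded I (\<lambda>n. N2 n * s2) (\<lambda>n. N2 n * t2) Y"
    and B: "\<forall>\<epsilon>>0. \<exists>K. \<forall>k\<ge>K. 1 \<le> k \<longrightarrow> acs_close I (\<lambda>n. N1 n * s1) (\<lambda>n. N1 n * t1) X (B k) \<epsilon>"
    and C: "\<forall>\<epsilon>>0. \<exists>K. \<forall>k\<ge>K. 1 \<le> k \<longrightarrow> acs_close I (\<lambda>n. N2 n * s2) (\<lambda>n. N2 n * t2) Y (C k) \<epsilon>"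
  shows "\<forall>\<epsilon>>0. \<exists>K. \<forall>k\<ge>K. 1 \<le> k \<longrightarrow> acs_close I (\<lambda>n. N1 n * N2 n * (s1 * s2)) (\<lambda>n. N1 n * N2 n * (t1 * t2))
    (\<lambda>n. block_kron (N1 n) (N2 n) s1 s2 t1 t2 (X n) (Y n)) (\<lambda>n. block_kron (N1 n) (N2 n) s1 s2 t1 t2 (B k n) (C k n)) \<epsilon>"
proof (intro allI impI)
  fix \<epsilon> :: real assume \<epsilon>: "0 < \<epsilon>"
  define \<rho> where "\<rho> = \<epsilon> / 4"
  have \<rho>: "0 < \<rho>" using \<epsilon> by (simp add: \<rho>_def)
  obtain M1 where M1: "\<forall>\<^sub>F n in along I. splits {..<N1 n * s1} {..<N1 n * t1} (\<lambda>i j. X n $$ (i, j)) (\<rho> * real (min (N1 n * s1) (N1 n * t1))) M1"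
    using su(1) \<rho> unfolding sparsely_unbounded_def by blast
  obtain M2 where M2: "\<forall>\<^sub>F n in along I. splits {..<N2 n * s2} {..<N2 n * t2} (\<lambda>i j. Y n $$ (i, j)) (\<rho> * real (min (N2 n * s2) (N2 n * t2))) M2"
    using su(2) \<rho> unfolding sparsely_unbounded_def by blast
  \<comment> \<open>Common to both factors, and at least 1 so that it may be divided by.\<close>
  define M where "M = max (max M1 M2) 0 + 1"
  have M: "M1 \<le> M" "M2 \<le> M" "1 \<le> M" by (auto simp: M_def)
  \<comment> \<open>The rank budgets total 4\<delta> + 2\<rho>, at most \<epsilon>. The norms total
    2\<delta>M + \<delta>\<delta>, where \<delta>M is at most \<epsilon>/4 and \<delta>\<delta> at
    most \<epsilon>/8, the latter because \<delta> is at most 1.\<close>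
  define \<delta> where "\<delta> = min 1 (min (\<epsilon> / 8) (\<epsilon> / (4 * M)))"
  have \<delta>: "0 < \<delta>" "\<delta> \<le> 1" "\<delta> \<le> \<epsilon> / 8" using \<epsilon> M(3) by (auto simp: \<delta>_def)
  have "\<delta> * M \<le> \<epsilon> / (4 * M) * M" using M(3) by (intro mult_right_mono) (auto simp: \<delta>_def)
  then have \<delta>M: "\<delta> * M \<le> \<epsilon> / 4" using M(3) by simp
  have \<delta>\<delta>: "\<delta> * \<delta> \<le> \<epsilon> / 8" using \<delta> mult_mono[of \<delta> 1 \<delta> "\<epsilon> / 8"] by simp
  obtain K1 where K1: "\<And>k. K1 \<le> k \<Longrightarrow> 1 \<le> k \<Longrightarrow> acs_close I (\<lambda>n. N1 n * s1) (\<lambda>n. N1 n * t1) X (B k) \<delta>"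
    using B[rule_format, OF \<delta>(1)] by blast
  obtain K2 where K2: "\<And>k. K2 \<le> k \<Longrightarrow> 1 \<le> k \<Longrightarrow> acs_close I (\<lambda>n. N2 n * s2) (\<lambda>n. N2 n * t2) Y (C k) \<delta>"
    using C[rule_format, OF \<delta>(1)] by blast
  have "acs_close I (\<lambda>n. N1 n * N2 n * (s1 * s2)) (\<lambda>n. N1 n * N2 n * (t1 * t2))
    (\<lambda>n. block_kron (N1 n) (N2 n) s1 s2 t1 t2 (X n) (Y n)) (\<lambda>n. block_kron (N1 n) (N2 n) s1 s2 t1 t2 (B k n) (C k n)) \<epsilon>"
    if k: "max K1 K2 \<le> k" "1 \<le> k" for k
    unfolding acs_close_def
    using M1 M2 K1[OF max.cobounded1[of K1 K2, THEN order_trans, OF k(1)] k(2), unfolded acs_close_def]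
      K2[OF max.cobounded2[of K2 K1, THEN order_trans, OF k(1)] k(2), unfolded acs_close_def]
  proof eventually_elim
    case (elim n)
    let ?d = "N1 n * N2 n * (s1 * s2)" and ?e = "N1 n * N2 n * (t1 * t2)"
    let ?D1 = "\<lambda>i j. X n $$ (i, j) - B k n $$ (i, j)" and ?D2 = "\<lambda>i j. Y n $$ (i, j) - C k n $$ (i, j)"
    let ?t = "\<lambda>P Q a b. P (block_index1 (N2 n) s1 s2 a) (block_index1 (N2 n) t1 t2 b) * Q (block_index2 (N2 n) s1 s2 a) (block_index2 (N2 n) t1 t2 b) :: complex"
    have X: "splits {..<N1 n * s1} {..<N1 n * t1} (\<lambda>i j. X n $$ (i, j)) (\<rho> * real (min (N1 n * s1) (N1 n * t1))) M"
      using elim(1) order_refl M(1) by (rule splits_mono)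
    have Y: "splits {..<N2 n * s2} {..<N2 n * t2} (\<lambda>i j. Y n $$ (i, j)) (\<rho> * real (min (N2 n * s2) (N2 n * t2))) M"
      using elim(2) order_refl M(2) by (rule splits_mono)
    have "splits {..<?d} {..<?e} (?t ?D1 (\<lambda>i j. Y n $$ (i, j))) ((\<delta> + \<rho>) * real (min ?d ?e)) (\<delta> * M)"
      using \<delta> \<rho> by (intro splits_block_kron[OF elim(3) Y]) auto
    moreover have "splits {..<?d} {..<?e} (?t (\<lambda>i j. X n $$ (i, j)) ?D2) ((\<rho> + \<delta>) * real (min ?d ?e)) (M * \<delta>)"
      using \<delta> \<rho> by (intro splits_block_kron[OF X elim(4)]) auto
    \<comment> \<open>The minus sign of the mixed term is carried by its first factor.\<close>
    moreover have "splits {..<?d} {..<?e} (?t (\<lambda>i j. - ?D1 i j) ?D2) ((\<delta> + \<delta>) * real (min ?d ?e)) (\<delta> * \<delta>)"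
      using \<delta> by (intro splits_block_kron[OF splits_uminus[OF elim(3)] elim(4)]) auto
    ultimately have "splits {..<?d} {..<?e} (\<lambda>a b. ?t ?D1 (\<lambda>i j. Y n $$ (i, j)) a b + ?t (\<lambda>i j. X n $$ (i, j)) ?D2 a b + ?t (\<lambda>i j. - ?D1 i j) ?D2 a b)
       ((\<delta> + \<rho>) * real (min ?d ?e) + (\<rho> + \<delta>) * real (min ?d ?e) + (\<delta> + \<delta>) * real (min ?d ?e)) (\<delta> * M + M * \<delta> + \<delta> * \<delta>)"
      by (intro splits_add)
    moreover have "(\<delta> + \<rho>) * real (min ?d ?e) + (\<rho> + \<delta>) * real (min ?d ?e) + (\<delta> + \<delta>) * real (min ?d ?e) \<le> \<epsilon> * real (min ?d ?e)"
    proof -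
      have "(\<delta> + \<rho>) * real (min ?d ?e) + (\<rho> + \<delta>) * real (min ?d ?e) + (\<delta> + \<delta>) * real (min ?d ?e) = (4 * \<delta> + 2 * \<rho>) * real (min ?d ?e)"
        by (simp add: algebra_simps)
      also have "\<dots> \<le> \<epsilon> * real (min ?d ?e)" using \<delta>(3) by (intro mult_right_mono) (auto simp: \<rho>_def)
      finally show ?thesis .
    qed
    moreover have "\<delta> * M + M * \<delta> + \<delta> * \<delta> \<le> \<epsilon>" using \<delta>M \<delta>\<delta> \<epsilon> by (simp add: mult.commute)
    ultimately have "splits {..<?d} {..<?e} (\<lambda>a b. ?t ?D1 (\<lambda>i j. Y n $$ (i, j)) a b + ?t (\<lambda>i j. X n $$ (i, j)) ?D2 a b + ?t (\<lambda>i j. - ?D1 i j) ?D2 a b)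
       (\<epsilon> * real (min ?d ?e)) \<epsilon>" by (rule splits_mono)
    then show ?case
      by (rule iffD1[OF splits_cong, rotated]) (simp add: block_kron_entry algebra_simps)
  qed
  then show "\<exists>K. \<forall>k\<ge>K. 1 \<le> k \<longrightarrow> acs_close I (\<lambda>n. N1 n * N2 n * (s1 * s2)) (\<lambda>n. N1 n * N2 n * (t1 * t2))
    (\<lambda>n. block_kron (N1 n) (N2 n) s1 s2 t1 t2 (X n) (Y n)) (\<lambda>n. block_kron (N1 n) (N2 n) s1 s2 t1 t2 (B k n) (C k n)) \<epsilon>"
    by blast
qed

section \<open>Kronecker products of GLT sequences\<close>

lemma GLT_approx_carrier: "GLT_approx q s t m L a f \<in> carrier_mat (prod_list m * s) (prod_list m * t)"
  by (simp add: GLT_approx_def mat_sum_def)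

lemma sparsely_unbounded_GLT_approx:
  assumes m: "multi_index_seq I q m" and st: "0 < s" "0 < t"
    and "\<And>l. l \<in> {1..L} \<Longrightarrow> AE x in unit_measure q. continuous (at x within unit_cube q) (a l)"
    and "\<And>l \<alpha> \<beta>. l \<in> {1..L} \<Longrightarrow> \<alpha> < s \<Longrightarrow> \<beta> < t \<Longrightarrow> integrable (pi_measure q) (\<lambda>\<theta>. f l \<theta> $$ (\<alpha>, \<beta>))"
  shows "sparsely_unbounded I (\<lambda>n. prod_list (m n) * s) (\<lambda>n. prod_list (m n) * t) (\<lambda>n. GLT_approx q s t (m n) L a f)"
  unfolding GLT_approx_def
  by (intro sparsely_unbounded_mat_sum sparsely_unbounded_diag_mult[OF m st] sparsely_unbounded_toeplitz[OF m st]
      toeplitz_carrier finite_atLeastAtMost assms)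

lemma grid_point_parts:
  assumes "length m1 = q1" "length m2 = q2" "length l1 = q1"
  shows "fst_part q1 (grid_point (m1 @ m2) (l1 @ l2)) = grid_point m1 l1"
    and "snd_part q1 q2 (grid_point (m1 @ m2) (l1 @ l2)) = grid_point m2 l2"
  using assms by (auto simp: fst_part_def snd_part_def grid_point_def nth_append fun_eq_iff)

lemma wave_parts:
  assumes "length l1 = q1"
  shows "wave (q1 + q2) (l1 @ l2) \<theta> = wave q1 l1 (fst_part q1 \<theta>) * wave q2 l2 (snd_part q1 q2 \<theta>)"
proof -
  have "(\<Sum>r<q1 + q2. real ((l1 @ l2) ! r) * \<theta> r) =
    (\<Sum>r<q1. real (l1 ! r) * fst_part q1 \<theta> r) + (\<Sum>r<q2. real (l2 ! r) * snd_part q1 q2 \<theta> r)"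
    unfolding sum_lessThan_add
    by (intro arg_cong2[of _ _ _ _ "(+)"] sum.cong) (use assms in \<open>auto simp: nth_append fst_part_def snd_part_def\<close>)
  then show ?thesis
    unfolding wave_def exp_add[symmetric] by (simp only: of_real_add distrib_left)
qed

lemma integrable_wave:
  assumes "integrable (pi_measure q) f"
  shows "integrable (pi_measure q) (\<lambda>\<theta>. c * f \<theta> * wave q k \<theta> * cnj (wave q l \<theta>))"
proof (rule Bochner_Integration.integrable_bound)
  show "integrable (pi_measure q) (\<lambda>\<theta>. c * f \<theta>)" using assms by simp
  have [measurable]: "f \<in> borel_measurable (pi_measure q)" using assms by simp
  note [measurable] = wave_measurable
  show "(\<lambda>\<theta>. c * f \<theta> * wave q k \<theta> * cnj (wave q l \<theta>)) \<in> borel_measurable (pi_measure q)"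
    by (intro borel_measurable_times borel_measurable_continuous_on[OF _ wave_measurable] continuous_intros) auto
qed (simp add: norm_mult)

text \<open>Waves, Kronecker entries and the power of 2 pi all factor over the two parts of
  \<theta>, so the integral over the joint cube is a product of two integrals.\<close>

lemma toeplitz_kron:
  fixes m1 m2 :: "nat list"
  defines "N1 \<equiv> prod_list m1" and "N2 \<equiv> prod_list m2" and "q1 \<equiv> length m1" and "q2 \<equiv> length m2"
  assumes f1: "\<And>\<theta>. \<theta> \<in> pi_cube q1 \<Longrightarrow> f1 \<theta> \<in> carrier_mat s1 t1"
    "\<And>\<alpha> \<beta>. \<alpha> < s1 \<Longrightarrow> \<beta> < t1 \<Longrightarrow> integrable (pi_measure q1) (\<lambda>\<theta>. f1 \<theta> $$ (\<alpha>, \<beta>))"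
    and f2: "\<And>\<theta>. \<theta> \<in> pi_cube q2 \<Longrightarrow> f2 \<theta> \<in> carrier_mat s2 t2"
    "\<And>\<alpha> \<beta>. \<alpha> < s2 \<Longrightarrow> \<beta> < t2 \<Longrightarrow> integrable (pi_measure q2) (\<lambda>\<theta>. f2 \<theta> $$ (\<alpha>, \<beta>))"
  defines "f \<equiv> \<lambda>\<theta>. kron (f1 (fst_part q1 \<theta>)) (f2 (snd_part q1 q2 \<theta>))"
  assumes i: "i1 < N1" "i2 < N2" "\<alpha>1 < s1" "\<alpha>2 < s2" and j: "j1 < N1" "j2 < N2" "\<beta>1 < t1" "\<beta>2 < t2"
  shows "toeplitz_mat (m1 @ m2) (s1 * s2) (t1 * t2) f $$
      ((i1 * N2 + i2) * (s1 * s2) + (\<alpha>1 * s2 + \<alpha>2), (j1 * N2 + j2) * (t1 * t2) + (\<beta>1 * t2 + \<beta>2)) =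
    toeplitz_mat m1 s1 t1 f1 $$ (i1 * s1 + \<alpha>1, j1 * t1 + \<beta>1) *
    toeplitz_mat m2 s2 t2 f2 $$ (i2 * s2 + \<alpha>2, j2 * t2 + \<beta>2)"
proof -
  let ?i = "(i1 * N2 + i2) * (s1 * s2) + (\<alpha>1 * s2 + \<alpha>2)" and ?j = "(j1 * N2 + j2) * (t1 * t2) + (\<beta>1 * t2 + \<beta>2)"
  let ?c = "\<lambda>q. 1 / complex_of_real ((2 * pi) ^ q)"
  have P: "prod_list (m1 @ m2) = N1 * N2" "length (m1 @ m2) = q1 + q2"
    by (simp_all add: N1_def N2_def q1_def q2_def)
  have \<alpha>: "\<alpha>1 * s2 + \<alpha>2 < s1 * s2" "\<beta>1 * t2 + \<beta>2 < t1 * t2" using i j by (auto intro: digit_less)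
  have ij: "?i < prod_list (m1 @ m2) * (s1 * s2)" "?j < prod_list (m1 @ m2) * (t1 * t2)"
    unfolding P using i j by (auto intro!: digit_less)
  have ij1: "i1 * s1 + \<alpha>1 < prod_list m1 * s1" "j1 * t1 + \<beta>1 < prod_list m1 * t1"
    using i j unfolding N1_def by (auto intro: digit_less)
  have ij2: "i2 * s2 + \<alpha>2 < prod_list m2 * s2" "j2 * t2 + \<beta>2 < prod_list m2 * t2"
    using i j unfolding N2_def by (auto intro: digit_less)
  note dm = digit_divmod[OF \<alpha>(1)] digit_divmod[OF \<alpha>(2)] digit_divmod[OF i(3)] digit_divmod[OF i(4)]
    digit_divmod[OF j(3)] digit_divmod[OF j(4)]
  have mr: "multi_range (m1 @ m2) ! (i1 * N2 + i2) = multi_range m1 ! i1 @ multi_range m2 ! i2"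
    "multi_range (m1 @ m2) ! (j1 * N2 + j2) = multi_range m1 ! j1 @ multi_range m2 ! j2"
    unfolding N2_def using i j by (auto simp: N1_def N2_def intro!: multi_range_append)
  have len: "length (multi_range m1 ! i1) = q1" "length (multi_range m1 ! j1) = q1"
    using multi_range_nth(1) i j by (auto simp: q1_def N1_def)
  define g1 where "g1 \<theta> = ?c q1 * f1 \<theta> $$ (\<alpha>1, \<beta>1) * wave q1 (multi_range m1 ! j1) \<theta> * cnj (wave q1 (multi_range m1 ! i1) \<theta>)" for \<theta>
  define g2 where "g2 \<theta> = ?c q2 * f2 \<theta> $$ (\<alpha>2, \<beta>2) * wave q2 (multi_range m2 ! j2) \<theta> * cnj (wave q2 (multi_range m2 ! i2) \<theta>)" for \<theta>
  have "toeplitz_mat (m1 @ m2) (s1 * s2) (t1 * t2) f $$ (?i, ?j) =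
    (\<integral>\<theta>. g1 (fst_part q1 \<theta>) * g2 (snd_part q1 q2 \<theta>) \<partial>pi_measure (q1 + q2))"
    unfolding toeplitz_index[OF ij P(2)] dm mr
  proof (rule Bochner_Integration.integral_cong[OF refl])
    fix \<theta> assume "\<theta> \<in> space (pi_measure (q1 + q2))"
    then have \<theta>: "\<theta> \<in> pi_cube (q1 + q2)" by (simp add: space_pi_measure)
    have c: "f1 (fst_part q1 \<theta>) \<in> carrier_mat s1 t1" "f2 (snd_part q1 q2 \<theta>) \<in> carrier_mat s2 t2"
      using f1(1) f2(1) pi_cube_parts[OF \<theta>] by auto
    have "f \<theta> $$ (\<alpha>1 * s2 + \<alpha>2, \<beta>1 * t2 + \<beta>2) = f1 (fst_part q1 \<theta>) $$ (\<alpha>1, \<beta>1) * f2 (snd_part q1 q2 \<theta>) $$ (\<alpha>2, \<beta>2)"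
      using kron_index[of \<alpha>1 "f1 (fst_part q1 \<theta>)" \<alpha>2 "f2 (snd_part q1 q2 \<theta>)" \<beta>1 \<beta>2] c i j unfolding f_def by simp
    then show "1 / complex_of_real ((2 * pi) ^ (q1 + q2)) * f \<theta> $$ (\<alpha>1 * s2 + \<alpha>2, \<beta>1 * t2 + \<beta>2) *
          wave (q1 + q2) (multi_range m1 ! j1 @ multi_range m2 ! j2) \<theta> *
          cnj (wave (q1 + q2) (multi_range m1 ! i1 @ multi_range m2 ! i2) \<theta>) =
        g1 (fst_part q1 \<theta>) * g2 (snd_part q1 q2 \<theta>)"
      unfolding g1_def g2_def wave_parts[OF len(1)] wave_parts[OF len(2)] by (simp add: power_add)
  qed
  also have "\<dots> = integral\<^sup>L (pi_measure q1) g1 * integral\<^sup>L (pi_measure q2) g2"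
    unfolding g1_def g2_def using f1(2)[OF i(3) j(3)] f2(2)[OF i(4) j(4)] by (intro pi_measure_parts integrable_wave)
  finally show ?thesis
    unfolding toeplitz_index[OF ij1 q1_def[symmetric, THEN meta_eq_to_obj_eq]] toeplitz_index[OF ij2 q2_def[symmetric, THEN meta_eq_to_obj_eq]] dm g1_def g2_def .
qed

text \<open>Pairs are numbered lexicographically from 1, hence the shifts around quotient and
  remainder. If L2 is 0, both sides are empty sums.\<close>

lemma sum_pairs_reindex:
  fixes g :: "nat \<Rightarrow> nat \<Rightarrow> 'a::comm_monoid_add"
  shows "(\<Sum>l=1..L1 * L2. g ((l - 1) div L2 + 1) ((l - 1) mod L2 + 1)) = (\<Sum>l1=1..L1. \<Sum>l2=1..L2. g l1 l2)"
proof (cases "L2 = 0")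
  case False
  have shift: "(\<Sum>l=1..n. h l) = (\<Sum>l<n. h (l + 1))" for h :: "nat \<Rightarrow> 'a" and n
    by (simp add: sum.shift_bounds_cl_Suc_ivl[symmetric] sum.atLeast1_atMost_eq)
  have "(\<Sum>l=1..L1 * L2. g ((l - 1) div L2 + 1) ((l - 1) mod L2 + 1)) = (\<Sum>l<L1 * L2. (\<lambda>(i, j). g (i + 1) (j + 1)) (l div L2, l mod L2))"
    unfolding shift by simp
  also have "\<dots> = (\<Sum>(i, j)\<in>{..<L1} \<times> {..<L2}. g (i + 1) (j + 1))"
    using False by (intro sum.reindex_bij_betw bij_betw_div_mod) simp
  finally show ?thesis unfolding shift by (simp add: sum.cartesian_product)
qed simp

text \<open>An entry of D(a) T(f) is a sample of a times a Toeplitz entry, and both factor over the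
  two parts. Summation over the pairs of terms is then distributivity.\<close>

lemma GLT_approx_block_kron:
  fixes m1 m2 :: "nat list"
  defines "q1 \<equiv> length m1" and "q2 \<equiv> length m2"
  assumes f1: "\<And>l \<theta>. l \<in> {1..L1} \<Longrightarrow> \<theta> \<in> pi_cube q1 \<Longrightarrow> f1 l \<theta> \<in> carrier_mat s1 t1"
    "\<And>l \<alpha> \<beta>. l \<in> {1..L1} \<Longrightarrow> \<alpha> < s1 \<Longrightarrow> \<beta> < t1 \<Longrightarrow> integrable (pi_measure q1) (\<lambda>\<theta>. f1 l \<theta> $$ (\<alpha>, \<beta>))"
    and f2: "\<And>l \<theta>. l \<in> {1..L2} \<Longrightarrow> \<theta> \<in> pi_cube q2 \<Longrightarrow> f2 l \<theta> \<in> carrier_mat s2 t2"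
    "\<And>l \<alpha> \<beta>. l \<in> {1..L2} \<Longrightarrow> \<alpha> < s2 \<Longrightarrow> \<beta> < t2 \<Longrightarrow> integrable (pi_measure q2) (\<lambda>\<theta>. f2 l \<theta> $$ (\<alpha>, \<beta>))"
  shows "GLT_approx (q1 + q2) (s1 * s2) (t1 * t2) (m1 @ m2) (L1 * L2)
      (\<lambda>l x. a1 ((l - 1) div L2 + 1) (fst_part q1 x) * a2 ((l - 1) mod L2 + 1) (snd_part q1 q2 x))
      (\<lambda>l \<theta>. kron (f1 ((l - 1) div L2 + 1) (fst_part q1 \<theta>)) (f2 ((l - 1) mod L2 + 1) (snd_part q1 q2 \<theta>))) =
    block_kron (prod_list m1) (prod_list m2) s1 s2 t1 t2 (GLT_approx q1 s1 t1 m1 L1 a1 f1) (GLT_approx q2 s2 t2 m2 L2 a2 f2)"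
    (is "GLT_approx _ _ _ _ _ ?a ?f = _")
proof (rule eq_block_kronI)
  let ?N1 = "prod_list m1" and ?N2 = "prod_list m2"
  have P: "prod_list (m1 @ m2) = ?N1 * ?N2" by simp
  show "GLT_approx (q1 + q2) (s1 * s2) (t1 * t2) (m1 @ m2) (L1 * L2) ?a ?f \<in>
     carrier_mat (?N1 * ?N2 * (s1 * s2)) (?N1 * ?N2 * (t1 * t2))"
    using GLT_approx_carrier[of "q1 + q2" "s1 * s2" "t1 * t2" "m1 @ m2" "L1 * L2" ?a ?f] unfolding P .
  fix i1 i2 \<alpha>1 \<alpha>2 j1 j2 \<beta>1 \<beta>2
  assume i: "i1 < ?N1" "i2 < ?N2" "\<alpha>1 < s1" "\<alpha>2 < s2" and j: "j1 < ?N1" "j2 < ?N2" "\<beta>1 < t1" "\<beta>2 < t2"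
  let ?i = "(i1 * ?N2 + i2) * (s1 * s2) + (\<alpha>1 * s2 + \<alpha>2)" and ?j = "(j1 * ?N2 + j2) * (t1 * t2) + (\<beta>1 * t2 + \<beta>2)"
  have ij: "?i < prod_list (m1 @ m2) * (s1 * s2)" "?j < prod_list (m1 @ m2) * (t1 * t2)"
    unfolding P using i j by (auto intro!: digit_less)
  have ij1: "i1 * s1 + \<alpha>1 < ?N1 * s1" "j1 * t1 + \<beta>1 < ?N1 * t1" using i j by (auto intro: digit_less)
  have ij2: "i2 * s2 + \<alpha>2 < ?N2 * s2" "j2 * t2 + \<beta>2 < ?N2 * t2" using i j by (auto intro: digit_less)
  have \<alpha>: "\<alpha>1 * s2 + \<alpha>2 < s1 * s2" using i by (auto intro: digit_less)
  let ?x1 = "grid_point m1 (multi_range m1 ! i1)" and ?x2 = "grid_point m2 (multi_range m2 ! i2)"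
  have g: "grid_point (m1 @ m2) (multi_range (m1 @ m2) ! (i1 * ?N2 + i2)) =
     grid_point (m1 @ m2) (multi_range m1 ! i1 @ multi_range m2 ! i2)"
    using i by (simp add: multi_range_append)
  have gp: "fst_part q1 (grid_point (m1 @ m2) (multi_range m1 ! i1 @ multi_range m2 ! i2)) = ?x1"
    "snd_part q1 q2 (grid_point (m1 @ m2) (multi_range m1 ! i1 @ multi_range m2 ! i2)) = ?x2"
    using multi_range_nth(1)[OF i(1)] by (simp_all add: grid_point_parts q1_def q2_def)
  define T1 where "T1 l = a1 l ?x1 * toeplitz_mat m1 s1 t1 (f1 l) $$ (i1 * s1 + \<alpha>1, j1 * t1 + \<beta>1)" for l
  define T2 where "T2 l = a2 l ?x2 * toeplitz_mat m2 s2 t2 (f2 l) $$ (i2 * s2 + \<alpha>2, j2 * t2 + \<beta>2)" for l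
  have "GLT_approx (q1 + q2) (s1 * s2) (t1 * t2) (m1 @ m2) (L1 * L2) ?a ?f $$ (?i, ?j) =
     (\<Sum>l=1..L1 * L2. ?a l (grid_point (m1 @ m2) (multi_range m1 ! i1 @ multi_range m2 ! i2)) *
        toeplitz_mat (m1 @ m2) (s1 * s2) (t1 * t2) (?f l) $$ (?i, ?j))"
    unfolding GLT_approx_def mat_sum_def
    using ij diag_sampling_mult_index[OF toeplitz_carrier ij] by (simp add: digit_divmod[OF \<alpha>] g)
  also have "\<dots> = (\<Sum>l=1..L1 * L2. T1 ((l - 1) div L2 + 1) * T2 ((l - 1) mod L2 + 1))"
  proof (rule sum.cong[OF refl])
    fix l assume l: "l \<in> {1..L1 * L2}"
    then have "l - 1 < L1 * L2" "0 < L2" by (auto intro!: Nat.gr0I)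
    then have l12: "(l - 1) div L2 + 1 \<in> {1..L1}" "(l - 1) mod L2 + 1 \<in> {1..L2}"
      by (auto simp: Suc_le_eq less_mult_imp_div_less)
    show "?a l (grid_point (m1 @ m2) (multi_range m1 ! i1 @ multi_range m2 ! i2)) *
        toeplitz_mat (m1 @ m2) (s1 * s2) (t1 * t2) (?f l) $$ (?i, ?j) = T1 ((l - 1) div L2 + 1) * T2 ((l - 1) mod L2 + 1)"
      unfolding gp T1_def T2_def unfolding q1_def q2_def
      by (subst toeplitz_kron[OF f1(1)[OF l12(1), unfolded q1_def] f1(2)[OF l12(1), unfolded q1_def] f2(1)[OF l12(2), unfolded q2_def] f2(2)[OF l12(2), unfolded q2_def] i j])
         simp_all
  qed
  also have "\<dots> = (\<Sum>l=1..L1. T1 l) * (\<Sum>l=1..L2. T2 l)"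
    unfolding sum_pairs_reindex[of "\<lambda>l l'. T1 l * T2 l'" L2 L1] sum_product ..
  also have "(\<Sum>l=1..L1. T1 l) = GLT_approx q1 s1 t1 m1 L1 a1 f1 $$ (i1 * s1 + \<alpha>1, j1 * t1 + \<beta>1)"
    unfolding GLT_approx_def mat_sum_def T1_def
    using ij1 diag_sampling_mult_index[OF toeplitz_carrier ij1] by (simp add: digit_divmod[OF i(3)])
  also have "(\<Sum>l=1..L2. T2 l) = GLT_approx q2 s2 t2 m2 L2 a2 f2 $$ (i2 * s2 + \<alpha>2, j2 * t2 + \<beta>2)"
    unfolding GLT_approx_def mat_sum_def T2_def
    using ij2 diag_sampling_mult_index[OF toeplitz_carrier ij2] by (simp add: digit_divmod[OF i(4)])
  finally show "GLT_approx (q1 + q2) (s1 * s2) (t1 * t2) (m1 @ m2) (L1 * L2) ?a ?f $$ (?i, ?j) =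
    GLT_approx q1 s1 t1 m1 L1 a1 f1 $$ (i1 * s1 + \<alpha>1, j1 * t1 + \<beta>1) *
    GLT_approx q2 s2 t2 m2 L2 a2 f2 $$ (i2 * s2 + \<alpha>2, j2 * t2 + \<beta>2)" .
qed

lemma multi_index_seq_append:
  assumes "multi_index_seq I q1 m1" "multi_index_seq I q2 m2"
  shows "multi_index_seq I (q1 + q2) (\<lambda>n. m1 n @ m2 n)"
proof -
  have "\<forall>\<^sub>F n in along I. \<forall>k\<in>set (m1 n @ m2 n). b \<le> k" for b
  proof -
    have "\<forall>\<^sub>F n in along I. \<forall>k\<in>set (m1 n). b \<le> k" "\<forall>\<^sub>F n in along I. \<forall>k\<in>set (m2 n). b \<le> k"
      using assms unfolding multi_index_seq_iff by blast+
    then show ?thesis by eventually_elim auto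
  qed
  then show ?thesis using assms unfolding multi_index_seq_iff by auto
qed

lemma prod_list_pos: "(\<And>k. k \<in> set m \<Longrightarrow> 0 < k) \<Longrightarrow> 0 < prod_list (m :: nat list)"
  by (induction m) auto

text \<open>The sizes tend to infinity since those of the first factor do and the second factor has
  positive sizes.\<close>

lemma matrix_seq_block_kron:
  assumes m: "multi_index_seq I q2 m2" and "0 < s2" "0 < t2"
    and X: "matrix_seq I (\<lambda>n. prod_list (m1 n) * s1) (\<lambda>n. prod_list (m1 n) * t1) X"
    and car: "\<And>n. n \<in> I \<Longrightarrow> Z n \<in> carrier_mat (prod_list (m1 n @ m2 n) * (s1 * s2)) (prod_list (m1 n @ m2 n) * (t1 * t2))"
  shows "matrix_seq I (\<lambda>n. prod_list (m1 n @ m2 n) * (s1 * s2)) (\<lambda>n. prod_list (m1 n @ m2 n) * (t1 * t2)) Z"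
proof -
  have N2: "0 < prod_list (m2 n)" if "n \<in> I" for n
    using m that unfolding multi_index_seq_def by (intro prod_list_pos) auto
  have "filterlim (\<lambda>n. prod_list (m1 n @ m2 n) * (a * b)) at_top (along I)"
    if "filterlim (\<lambda>n. prod_list (m1 n) * a) at_top (along I)" "0 < b" for a b
    using that(1)
  proof (rule filterlim_at_top_mono)
    show "\<forall>\<^sub>F n in along I. prod_list (m1 n) * a \<le> prod_list (m1 n @ m2 n) * (a * b)"
      using eventually_along_in
    proof eventually_elim
      case (elim n)
      have "(prod_list (m1 n) * a) * 1 \<le> (prod_list (m1 n) * a) * (prod_list (m2 n) * b)"
        using N2[OF elim] that(2) by (intro mult_le_mono2) (simp add: Suc_le_eq)
      then show ?case by (simp add: ac_simps)
    qed
  qed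
  then show ?thesis using X assms(2,3) car unfolding matrix_seq_def by auto
qed

text \<open>The existential part of \<open>GLT\<close> with its witnesses exposed, so that those of
  a product can be built from those of the factors.\<close>

definition GLT_data :: "nat set \<Rightarrow> nat \<Rightarrow> (nat \<Rightarrow> nat list) \<Rightarrow> nat \<Rightarrow> nat \<Rightarrow>
    (nat \<Rightarrow> complex mat) \<Rightarrow> (point \<Rightarrow> point \<Rightarrow> complex mat) \<Rightarrow>
    (nat \<Rightarrow> nat) \<Rightarrow> (nat \<Rightarrow> nat \<Rightarrow> point \<Rightarrow> complex) \<Rightarrow> (nat \<Rightarrow> nat \<Rightarrow> point \<Rightarrow> complex mat) \<Rightarrow> bool" where
  "GLT_data I q m s t X \<kappa> L a f \<longleftrightarrow>
     (\<forall>k\<ge>1. \<forall>l\<in>{1..L k}.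
           (AE x in unit_measure q. continuous (at x within unit_cube q) (a l k)) \<and>
           (\<forall>\<theta>\<in>pi_cube q. f l k \<theta> \<in> carrier_mat s t) \<and>
           (\<forall>i<s. \<forall>j<t. integrable (pi_measure q) (\<lambda>\<theta>. f l k \<theta> $$ (i, j)))) \<and>
     (AE (x, \<theta>) in symbol_measure q. \<forall>i<s. \<forall>j<t.
           (\<lambda>k. \<Sum>l=1..L k. a l k x * f l k \<theta> $$ (i, j)) \<longlonglongrightarrow> \<kappa> x \<theta> $$ (i, j)) \<and>
     acs I (\<lambda>n. prod_list (m n) * s) (\<lambda>n. prod_list (m n) * t)
          (\<lambda>k n. GLT_approx q s t (m n) (L k) (\<lambda>l. a l k) (\<lambda>l. f l k)) X"

lemma GLT_iff:
  "GLT I q m s t X \<kappa> \<longleftrightarrow>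
     multi_index_seq I q m \<and> 0 < s \<and> 0 < t \<and>
     (\<forall>x\<in>unit_cube q. \<forall>\<theta>\<in>pi_cube q. \<kappa> x \<theta> \<in> carrier_mat s t) \<and>
     (\<forall>i<s. \<forall>j<t. (\<lambda>(x, \<theta>). \<kappa> x \<theta> $$ (i, j)) \<in> borel_measurable (symbol_measure q)) \<and>
     (\<exists>L a f. GLT_data I q m s t X \<kappa> L a f)"
  unfolding GLT_def GLT_data_def GLT_approx_def ..

theorem GLT_block_kron:
  assumes G1: "GLT I q1 m1 s1 t1 X1 \<kappa>1" and G2: "GLT I q2 m2 s2 t2 X2 \<kappa>2"
  shows "GLT I (q1 + q2) (\<lambda>n. m1 n @ m2 n) (s1 * s2) (t1 * t2)
    (\<lambda>n. block_kron (prod_list (m1 n)) (prod_list (m2 n)) s1 s2 t1 t2 (X1 n) (X2 n))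
    (\<lambda>x \<theta>. kron (\<kappa>1 (fst_part q1 x) (fst_part q1 \<theta>)) (\<kappa>2 (snd_part q1 q2 x) (snd_part q1 q2 \<theta>)))"
proof -
  have m1: "multi_index_seq I q1 m1" and m2: "multi_index_seq I q2 m2" and st: "0 < s1" "0 < t1" "0 < s2" "0 < t2"
    and \<kappa>1: "\<And>x \<theta>. x \<in> unit_cube q1 \<Longrightarrow> \<theta> \<in> pi_cube q1 \<Longrightarrow> \<kappa>1 x \<theta> \<in> carrier_mat s1 t1"
    and \<kappa>2: "\<And>x \<theta>. x \<in> unit_cube q2 \<Longrightarrow> \<theta> \<in> pi_cube q2 \<Longrightarrow> \<kappa>2 x \<theta> \<in> carrier_mat s2 t2"
    and meas1: "\<And>i j. i < s1 \<Longrightarrow> j < t1 \<Longrightarrow> (\<lambda>(x, \<theta>). \<kappa>1 x \<theta> $$ (i, j)) \<in> borel_measurable (symbol_measure q1)"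
    and meas2: "\<And>i j. i < s2 \<Longrightarrow> j < t2 \<Longrightarrow> (\<lambda>(x, \<theta>). \<kappa>2 x \<theta> $$ (i, j)) \<in> borel_measurable (symbol_measure q2)"
    using G1 G2 unfolding GLT_iff by blast+
  obtain L1 a1 f1 where D1: "GLT_data I q1 m1 s1 t1 X1 \<kappa>1 L1 a1 f1" using G1 unfolding GLT_iff by blast
  obtain L2 a2 f2 where D2: "GLT_data I q2 m2 s2 t2 X2 \<kappa>2 L2 a2 f2" using G2 unfolding GLT_iff by blast
  have a1: "\<And>k l. 1 \<le> k \<Longrightarrow> l \<in> {1..L1 k} \<Longrightarrow> AE x in unit_measure q1. continuous (at x within unit_cube q1) (a1 l k)"
    and f1: "\<And>k l \<theta>. 1 \<le> k \<Longrightarrow> l \<in> {1..L1 k} \<Longrightarrow> \<theta> \<in> pi_cube q1 \<Longrightarrow> f1 l k \<theta> \<in> carrier_mat s1 t1"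
    "\<And>k l i j. 1 \<le> k \<Longrightarrow> l \<in> {1..L1 k} \<Longrightarrow> i < s1 \<Longrightarrow> j < t1 \<Longrightarrow> integrable (pi_measure q1) (\<lambda>\<theta>. f1 l k \<theta> $$ (i, j))"
    and lim1: "AE (x, \<theta>) in symbol_measure q1. \<forall>i<s1. \<forall>j<t1.
           (\<lambda>k. \<Sum>l=1..L1 k. a1 l k x * f1 l k \<theta> $$ (i, j)) \<longlonglongrightarrow> \<kappa>1 x \<theta> $$ (i, j)"
    and acs1: "acs I (\<lambda>n. prod_list (m1 n) * s1) (\<lambda>n. prod_list (m1 n) * t1)
          (\<lambda>k n. GLT_approx q1 s1 t1 (m1 n) (L1 k) (\<lambda>l. a1 l k) (\<lambda>l. f1 l k)) X1"
    using D1 unfolding GLT_data_def by blast+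
  have a2: "\<And>k l. 1 \<le> k \<Longrightarrow> l \<in> {1..L2 k} \<Longrightarrow> AE x in unit_measure q2. continuous (at x within unit_cube q2) (a2 l k)"
    and f2: "\<And>k l \<theta>. 1 \<le> k \<Longrightarrow> l \<in> {1..L2 k} \<Longrightarrow> \<theta> \<in> pi_cube q2 \<Longrightarrow> f2 l k \<theta> \<in> carrier_mat s2 t2"
    "\<And>k l i j. 1 \<le> k \<Longrightarrow> l \<in> {1..L2 k} \<Longrightarrow> i < s2 \<Longrightarrow> j < t2 \<Longrightarrow> integrable (pi_measure q2) (\<lambda>\<theta>. f2 l k \<theta> $$ (i, j))"
    and lim2: "AE (x, \<theta>) in symbol_measure q2. \<forall>i<s2. \<forall>j<t2.
           (\<lambda>k. \<Sum>l=1..L2 k. a2 l k x * f2 l k \<theta> $$ (i, j)) \<longlonglongrightarrow> \<kappa>2 x \<theta> $$ (i, j)"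
    and acs2: "acs I (\<lambda>n. prod_list (m2 n) * s2) (\<lambda>n. prod_list (m2 n) * t2)
          (\<lambda>k n. GLT_approx q2 s2 t2 (m2 n) (L2 k) (\<lambda>l. a2 l k) (\<lambda>l. f2 l k)) X2"
    using D2 unfolding GLT_data_def by blast+
  define L where "L k = L1 k * L2 k" for k
  \<comment> \<open>The positions, counted from 1, of the two factors in the lth pair.\<close>
  define p1 p2 where "p1 k l = (l - 1) div L2 k + 1" and "p2 k l = (l - 1) mod L2 k + 1" for k l :: nat
  define a where "a l k x = a1 (p1 k l) k (fst_part q1 x) * a2 (p2 k l) k (snd_part q1 q2 x)" for l k x
  define f where "f l k \<theta> = kron (f1 (p1 k l) k (fst_part q1 \<theta>)) (f2 (p2 k l) k (snd_part q1 q2 \<theta>))" for l k \<theta>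
  define \<kappa> where "\<kappa> x \<theta> = kron (\<kappa>1 (fst_part q1 x) (fst_part q1 \<theta>)) (\<kappa>2 (snd_part q1 q2 x) (snd_part q1 q2 \<theta>))" for x \<theta>
  have p: "p1 k l \<in> {1..L1 k}" "p2 k l \<in> {1..L2 k}" if "l \<in> {1..L k}" for k l
  proof -
    have "l - 1 < L1 k * L2 k" "0 < L2 k" using that by (auto simp: L_def intro!: Nat.gr0I)
    then show "p1 k l \<in> {1..L1 k}" "p2 k l \<in> {1..L2 k}"
      by (auto simp: p1_def p2_def Suc_le_eq less_mult_imp_div_less)
  qed
  have f_entry: "f l k \<theta> $$ (i, j) = f1 (p1 k l) k (fst_part q1 \<theta>) $$ (i div s2, j div t2) *
       f2 (p2 k l) k (snd_part q1 q2 \<theta>) $$ (i mod s2, j mod t2)"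
    if "1 \<le> k" "l \<in> {1..L k}" "\<theta> \<in> pi_cube (q1 + q2)" "i < s1 * s2" "j < t1 * t2" for k l \<theta> i j
    using f1(1)[OF that(1) p(1)[OF that(2)] pi_cube_parts(1)[OF that(3)]] f2(1)[OF that(1) p(2)[OF that(2)] pi_cube_parts(2)[OF that(3)]] that(4,5)
    unfolding f_def by (subst kron_index_divmod) auto
  have \<kappa>_entry: "\<kappa> x \<theta> $$ (i, j) = \<kappa>1 (fst_part q1 x) (fst_part q1 \<theta>) $$ (i div s2, j div t2) *
       \<kappa>2 (snd_part q1 q2 x) (snd_part q1 q2 \<theta>) $$ (i mod s2, j mod t2)"
    if "x \<in> unit_cube (q1 + q2)" "\<theta> \<in> pi_cube (q1 + q2)" "i < s1 * s2" "j < t1 * t2" for x \<theta> i j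
    using \<kappa>1[OF unit_cube_parts(1)[OF that(1)] pi_cube_parts(1)[OF that(2)]] \<kappa>2[OF unit_cube_parts(2)[OF that(1)] pi_cube_parts(2)[OF that(2)]] that(3,4)
    unfolding \<kappa>_def by (subst kron_index_divmod) auto
  have dm: "i div s2 < s1" "i mod s2 < s2" if "i < s1 * s2" for i
    using that st by (auto simp: less_mult_imp_div_less)
  have dm': "j div t2 < t1" "j mod t2 < t2" if "j < t1 * t2" for j
    using that st by (auto simp: less_mult_imp_div_less)
  have sp: "space (symbol_measure (q1 + q2)) \<subseteq> unit_cube (q1 + q2) \<times> pi_cube (q1 + q2)"
    by (auto simp: symbol_measure_def space_restrict_space)
  have meas: "(\<lambda>(x, \<theta>). \<kappa> x \<theta> $$ (i, j)) \<in> borel_measurable (symbol_measure (q1 + q2))"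
    if ij: "i < s1 * s2" "j < t1 * t2" for i j
  proof -
    have "(\<lambda>z. (\<lambda>(x, \<theta>). \<kappa>1 x \<theta> $$ (i div s2, j div t2)) (map_prod (fst_part q1) (fst_part q1) z) *
       (\<lambda>(x, \<theta>). \<kappa>2 x \<theta> $$ (i mod s2, j mod t2)) (map_prod (snd_part q1 q2) (snd_part q1 q2) z))
       \<in> borel_measurable (symbol_measure (q1 + q2))"
      using dm[OF ij(1)] dm'[OF ij(2)] by (intro measurable_symbol_parts meas1 meas2)
    then show ?thesis
      by (rule measurable_cong[THEN iffD1, rotated]) (use sp \<kappa>_entry ij in \<open>auto simp: subset_iff\<close>)
  qed
  \<comment> \<open>Both exceptional null sets are pulled back along the parts; where neither
    contains the point, limits of the entries multiply.\<close>
  have lim: "AE (x, \<theta>) in symbol_measure (q1 + q2). \<forall>i<s1 * s2. \<forall>j<t1 * t2.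
       (\<lambda>k. \<Sum>l=1..L k. a l k x * f l k \<theta> $$ (i, j)) \<longlonglongrightarrow> \<kappa> x \<theta> $$ (i, j)"
    unfolding AE_symbol_measure
    using nonsingular_map_AE[OF nonsingular_fst_part2[of q1 q2] lim1[unfolded AE_symbol_measure]]
      nonsingular_map_AE[OF nonsingular_snd_part2[of q1 q2] lim2[unfolded AE_symbol_measure]]
  proof eventually_elim
    case (elim z)
    obtain x \<theta> where z: "z = (x, \<theta>)" by (cases z)
    {
      fix i j assume x: "x \<in> unit_cube (q1 + q2)" "\<theta> \<in> pi_cube (q1 + q2)" and ij: "i < s1 * s2" "j < t1 * t2"
      have 1: "(\<lambda>k. \<Sum>l=1..L1 k. a1 l k (fst_part q1 x) * f1 l k (fst_part q1 \<theta>) $$ (i div s2, j div t2))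
         \<longlonglongrightarrow> \<kappa>1 (fst_part q1 x) (fst_part q1 \<theta>) $$ (i div s2, j div t2)"
        using elim(1) dm[OF ij(1)] dm'[OF ij(2)] unit_cube_parts(1)[OF x(1)] pi_cube_parts(1)[OF x(2)] by (simp add: z)
      have 2: "(\<lambda>k. \<Sum>l=1..L2 k. a2 l k (snd_part q1 q2 x) * f2 l k (snd_part q1 q2 \<theta>) $$ (i mod s2, j mod t2))
         \<longlonglongrightarrow> \<kappa>2 (snd_part q1 q2 x) (snd_part q1 q2 \<theta>) $$ (i mod s2, j mod t2)"
        using elim(2) dm[OF ij(1)] dm'[OF ij(2)] unit_cube_parts(2)[OF x(1)] pi_cube_parts(2)[OF x(2)] by (simp add: z)
      have eq: "(\<Sum>l=1..L k. a l k x * f l k \<theta> $$ (i, j)) =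
        (\<Sum>l=1..L1 k. a1 l k (fst_part q1 x) * f1 l k (fst_part q1 \<theta>) $$ (i div s2, j div t2)) *
        (\<Sum>l=1..L2 k. a2 l k (snd_part q1 q2 x) * f2 l k (snd_part q1 q2 \<theta>) $$ (i mod s2, j mod t2))" if "1 \<le> k" for k
      proof -
        have "(\<Sum>l=1..L k. a l k x * f l k \<theta> $$ (i, j)) = (\<Sum>l=1..L k.
           (a1 (p1 k l) k (fst_part q1 x) * f1 (p1 k l) k (fst_part q1 \<theta>) $$ (i div s2, j div t2)) *
           (a2 (p2 k l) k (snd_part q1 q2 x) * f2 (p2 k l) k (snd_part q1 q2 \<theta>) $$ (i mod s2, j mod t2)))"
          by (intro sum.cong refl) (simp add: f_entry[OF that _ x(2) ij] a_def)
        then show ?thesis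
          unfolding L_def p1_def p2_def sum_product
            sum_pairs_reindex[of "\<lambda>l1 l2. (a1 l1 k (fst_part q1 x) * f1 l1 k (fst_part q1 \<theta>) $$ (i div s2, j div t2)) *
              (a2 l2 k (snd_part q1 q2 x) * f2 l2 k (snd_part q1 q2 \<theta>) $$ (i mod s2, j mod t2))"] .
      qed
      have "(\<lambda>k. \<Sum>l=1..L k. a l k x * f l k \<theta> $$ (i, j)) \<longlonglongrightarrow> \<kappa> x \<theta> $$ (i, j)"
        unfolding \<kappa>_entry[OF x ij]
        \<comment> \<open>The factorisation of the sums is available from k = 1 on, as the data at k
          = 0 are unconstrained.\<close>
        by (rule Lim_transform_eventually[OF tendsto_mult[OF 1 2] eventually_mono[OF eventually_ge_at_top[of 1] eq[symmetric]]])
    }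
    then show ?case by (simp add: z)
  qed
  have su1: "sparsely_unbounded I (\<lambda>n. prod_list (m1 n) * s1) (\<lambda>n. prod_list (m1 n) * t1) X1"
    by (rule sparsely_unbounded_acs[OF acs1 sparsely_unbounded_GLT_approx[OF m1 st(1,2)]]) (use a1 f1 in blast)+
  have su2: "sparsely_unbounded I (\<lambda>n. prod_list (m2 n) * s2) (\<lambda>n. prod_list (m2 n) * t2) X2"
    by (rule sparsely_unbounded_acs[OF acs2 sparsely_unbounded_GLT_approx[OF m2 st(3,4)]]) (use a2 f2 in blast)+
  have approx: "GLT_approx (q1 + q2) (s1 * s2) (t1 * t2) (m1 n @ m2 n) (L k) (\<lambda>l. a l k) (\<lambda>l. f l k) =
     block_kron (prod_list (m1 n)) (prod_list (m2 n)) s1 s2 t1 t2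
       (GLT_approx q1 s1 t1 (m1 n) (L1 k) (\<lambda>l. a1 l k) (\<lambda>l. f1 l k)) (GLT_approx q2 s2 t2 (m2 n) (L2 k) (\<lambda>l. a2 l k) (\<lambda>l. f2 l k))"
    if "1 \<le> k" "n \<in> I" for k n
  proof -
    have len: "length (m1 n) = q1" "length (m2 n) = q2" using m1 m2 that(2) unfolding multi_index_seq_def by auto
    show ?thesis
      using GLT_approx_block_kron[of "L1 k" "m1 n" "\<lambda>l. f1 l k" s1 t1 "L2 k" "m2 n" "\<lambda>l. f2 l k" s2 t2 "\<lambda>l. a1 l k" "\<lambda>l. a2 l k",
          unfolded len, OF f1[OF that(1)] f2[OF that(1)]]
      unfolding L_def a_def f_def p1_def p2_def .
  qed
  have seq: "matrix_seq I (\<lambda>n. prod_list (m1 n @ m2 n) * (s1 * s2)) (\<lambda>n. prod_list (m1 n @ m2 n) * (t1 * t2)) Z"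
    if "\<And>n. n \<in> I \<Longrightarrow> Z n \<in> carrier_mat (prod_list (m1 n @ m2 n) * (s1 * s2)) (prod_list (m1 n @ m2 n) * (t1 * t2))" for Z
    using acs1 that unfolding acs_def by (intro matrix_seq_block_kron[OF m2 st(3,4)]) auto
  have acs: "acs I (\<lambda>n. prod_list (m1 n @ m2 n) * (s1 * s2)) (\<lambda>n. prod_list (m1 n @ m2 n) * (t1 * t2))
      (\<lambda>k n. GLT_approx (q1 + q2) (s1 * s2) (t1 * t2) (m1 n @ m2 n) (L k) (\<lambda>l. a l k) (\<lambda>l. f l k))
      (\<lambda>n. block_kron (prod_list (m1 n)) (prod_list (m2 n)) s1 s2 t1 t2 (X1 n) (X2 n))"
    unfolding acs_iff
  proof (intro conjI allI impI)
    show "matrix_seq I (\<lambda>n. prod_list (m1 n @ m2 n) * (s1 * s2)) (\<lambda>n. prod_list (m1 n @ m2 n) * (t1 * t2))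
      (\<lambda>n. block_kron (prod_list (m1 n)) (prod_list (m2 n)) s1 s2 t1 t2 (X1 n) (X2 n))"
      by (rule seq) (simp add: block_kron_carrier)
    show "matrix_seq I (\<lambda>n. prod_list (m1 n @ m2 n) * (s1 * s2)) (\<lambda>n. prod_list (m1 n @ m2 n) * (t1 * t2))
      (\<lambda>n. GLT_approx (q1 + q2) (s1 * s2) (t1 * t2) (m1 n @ m2 n) (L k) (\<lambda>l. a l k) (\<lambda>l. f l k))" for k
      by (rule seq) (rule GLT_approx_carrier)
    fix \<epsilon> :: real assume \<epsilon>: "0 < \<epsilon>"
    obtain K where K: "\<forall>k\<ge>K. 1 \<le> k \<longrightarrow> acs_close I (\<lambda>n. prod_list (m1 n) * prod_list (m2 n) * (s1 * s2)) (\<lambda>n. prod_list (m1 n) * prod_list (m2 n) * (t1 * t2))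
        (\<lambda>n. block_kron (prod_list (m1 n)) (prod_list (m2 n)) s1 s2 t1 t2 (X1 n) (X2 n))
        (\<lambda>n. block_kron (prod_list (m1 n)) (prod_list (m2 n)) s1 s2 t1 t2 (GLT_approx q1 s1 t1 (m1 n) (L1 k) (\<lambda>l. a1 l k) (\<lambda>l. f1 l k)) (GLT_approx q2 s2 t2 (m2 n) (L2 k) (\<lambda>l. a2 l k) (\<lambda>l. f2 l k))) \<epsilon>"
      using acs_block_kron[OF su1 su2 acs1[unfolded acs_iff, THEN conjunct2, THEN conjunct2] acs2[unfolded acs_iff, THEN conjunct2, THEN conjunct2], rule_format, OF \<epsilon>]
      by blast
    have "acs_close I (\<lambda>n. prod_list (m1 n @ m2 n) * (s1 * s2)) (\<lambda>n. prod_list (m1 n @ m2 n) * (t1 * t2))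
        (\<lambda>n. block_kron (prod_list (m1 n)) (prod_list (m2 n)) s1 s2 t1 t2 (X1 n) (X2 n))
        (\<lambda>n. GLT_approx (q1 + q2) (s1 * s2) (t1 * t2) (m1 n @ m2 n) (L k) (\<lambda>l. a l k) (\<lambda>l. f l k)) \<epsilon>"
      if k: "K \<le> k" "1 \<le> k" for k
      unfolding acs_close_def using K[rule_format, OF k, unfolded acs_close_def] eventually_along_in
    proof eventually_elim
      case (elim n)
      then show ?case unfolding approx[OF k(2) elim(2)] by simp
    qed
    then show "\<exists>K. \<forall>k\<ge>K. 1 \<le> k \<longrightarrow> acs_close I (\<lambda>n. prod_list (m1 n @ m2 n) * (s1 * s2)) (\<lambda>n. prod_list (m1 n @ m2 n) * (t1 * t2))
        (\<lambda>n. block_kron (prod_list (m1 n)) (prod_list (m2 n)) s1 s2 t1 t2 (X1 n) (X2 n))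
        (\<lambda>n. GLT_approx (q1 + q2) (s1 * s2) (t1 * t2) (m1 n @ m2 n) (L k) (\<lambda>l. a l k) (\<lambda>l. f l k)) \<epsilon>"
      by blast
  qed
  have data: "GLT_data I (q1 + q2) (\<lambda>n. m1 n @ m2 n) (s1 * s2) (t1 * t2)
    (\<lambda>n. block_kron (prod_list (m1 n)) (prod_list (m2 n)) s1 s2 t1 t2 (X1 n) (X2 n)) \<kappa> L a f"
    unfolding GLT_data_def
  proof (intro conjI allI impI ballI lim acs)
    fix k l assume k: "1 \<le> k" and l: "l \<in> {1..L k}"
    show "AE x in unit_measure (q1 + q2). continuous (at x within unit_cube (q1 + q2)) (a l k)"
      unfolding a_def using a1[OF k p(1)[OF l]] a2[OF k p(2)[OF l]] by (rule AE_continuous_parts)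
    show "f l k \<theta> \<in> carrier_mat (s1 * s2) (t1 * t2)" if "\<theta> \<in> pi_cube (q1 + q2)" for \<theta>
      using f1(1)[OF k p(1)[OF l] pi_cube_parts(1)[OF that]] f2(1)[OF k p(2)[OF l] pi_cube_parts(2)[OF that]]
      unfolding f_def by (intro carrier_matI) auto
    show "integrable (pi_measure (q1 + q2)) (\<lambda>\<theta>. f l k \<theta> $$ (i, j))" if ij: "i < s1 * s2" "j < t1 * t2" for i j
    proof -
      have "integrable (pi_measure (q1 + q2)) (\<lambda>\<theta>. f1 (p1 k l) k (fst_part q1 \<theta>) $$ (i div s2, j div t2) *
         f2 (p2 k l) k (snd_part q1 q2 \<theta>) $$ (i mod s2, j mod t2))"
        using dm[OF ij(1)] dm'[OF ij(2)] f1(2)[OF k p(1)[OF l]] f2(2)[OF k p(2)[OF l]] by (intro pi_measure_parts) auto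
      then show ?thesis
        by (rule Bochner_Integration.integrable_cong[OF refl, THEN iffD1, rotated])
           (simp add: space_pi_measure f_entry[OF k l _ ij])
    qed
  qed
  have car: "\<kappa> x \<theta> \<in> carrier_mat (s1 * s2) (t1 * t2)" if "x \<in> unit_cube (q1 + q2)" "\<theta> \<in> pi_cube (q1 + q2)" for x \<theta>
    using \<kappa>1[OF unit_cube_parts(1)[OF that(1)] pi_cube_parts(1)[OF that(2)]] \<kappa>2[OF unit_cube_parts(2)[OF that(1)] pi_cube_parts(2)[OF that(2)]]
    unfolding \<kappa>_def by (intro carrier_matI) auto
  show ?thesis
    unfolding GLT_iff \<kappa>_def[symmetric]
    using multi_index_seq_append[OF m1 m2] st car meas data by (intro conjI exI[of _ L] exI[of _ a] exI[of _ f]) auto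
qed

text \<open>Values of the sequence outside \<open>I\<close> and of the symbol outside the cubes are
  irrelevant. The index identities for \<open>reordered_kron\<close> are available on
  \<open>I\<close> only.\<close>

lemma GLT_cong:
  assumes G: "GLT I q m s t X \<kappa>" and X: "\<And>n. n \<in> I \<Longrightarrow> X' n = X n"
    and \<kappa>: "\<And>x \<theta>. x \<in> unit_cube q \<Longrightarrow> \<theta> \<in> pi_cube q \<Longrightarrow> \<kappa>' x \<theta> = \<kappa> x \<theta>"
  shows "GLT I q m s t X' \<kappa>'"
proof -
  obtain L a f where D: "GLT_data I q m s t X \<kappa> L a f" using G unfolding GLT_iff by blast
  have "acs I d e B X \<Longrightarrow> acs I d e B X'" for d e B
    unfolding acs_def matrix_seq_def by (simp add: X)
  then have "GLT_data I q m s t X' \<kappa>' L a f"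
    using D unfolding GLT_data_def AE_symbol_measure by (elim conjE, intro conjI) (assumption, auto simp: \<kappa> elim: eventually_mono)
  moreover have "(\<lambda>(x, \<theta>). \<kappa>' x \<theta> $$ (i, j)) \<in> borel_measurable (symbol_measure q)" if "i < s" "j < t" for i j
  proof -
    have "(\<lambda>(x, \<theta>). \<kappa> x \<theta> $$ (i, j)) \<in> borel_measurable (symbol_measure q)" using G that unfolding GLT_iff by blast
    moreover have "space (symbol_measure q) \<subseteq> unit_cube q \<times> pi_cube q"
      by (auto simp: symbol_measure_def space_restrict_space)
    ultimately show ?thesis
      by (elim measurable_cong[THEN iffD1, rotated]) (auto simp: \<kappa> subset_iff)
  qed
  ultimately show ?thesis using G unfolding GLT_iff by (auto simp: \<kappa>)
qed

lemma prod_list_concat: "prod_list (concat xss) = (\<Prod>xs\<leftarrow>xss. prod_list xs :: nat)"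
  by (induction xss) auto

lemma prod_list_upt: "(\<Prod>k\<leftarrow>[1..<Suc d]. f k) = (\<Prod>k=1..d. f k :: nat)"
  by (simp add: prod.distinct_set_conv_list[symmetric] atLeastLessThanSuc_atLeastAtMost del: upt_Suc)

text \<open>Induction on d with the last factor split off on the right, which matches both the
  digits of \<open>reordered_kron\<close> and the decomposition of points.\<close>

theorem GLT_reordered_kron:
  fixes q s t :: "nat \<Rightarrow> nat"
  assumes "0 < d"
    and "\<And>i n. i \<in> {1..d} \<Longrightarrow> n \<in> I \<Longrightarrow> A i n \<in> carrier_mat (prod_list (m i n) * s i) (prod_list (m i n) * t i)"
    and "\<And>i. i \<in> {1..d} \<Longrightarrow> GLT I (q i) (m i) (s i) (t i) (A i) (\<kappa> i)"
  shows "GLT I (\<Sum>i=1..d. q i) (\<lambda>n. concat (map (\<lambda>i. m i n) [1..<Suc d])) (\<Prod>i=1..d. s i) (\<Prod>i=1..d. t i)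
    (\<lambda>n. reordered_kron d (\<lambda>i. prod_list (m i n)) s t (\<lambda>i. A i n))
    (\<lambda>x \<theta>. kron_list (map (\<lambda>i. \<kappa> i (point_part q i x) (point_part q i \<theta>)) [1..<Suc d]))"
  using assms
proof (induction d rule: nat_induct_non_zero)
  case 1
  have u: "[1..<Suc 1] = [1]" by simp
  \<comment> \<open>With a single part, \<open>point_part\<close> restricts to all coordinates. It
    is the identity on functions undefined elsewhere, in particular on the cubes.\<close>
  have pp: "point_part q 1 x = x" if "x \<in> extensional {..<q 1}" for x
    using that by (auto simp: point_part_def extensional_def fun_eq_iff)
  have "GLT I (q 1) (m 1) (s 1) (t 1) (A 1) (\<kappa> 1)" using 1 by simp
  then have "GLT I (q 1) (m 1) (s 1) (t 1) (\<lambda>n. reordered_kron 1 (\<lambda>i. prod_list (m i n)) s t (\<lambda>i. A i n))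
    (\<lambda>x \<theta>. \<kappa> 1 (point_part q 1 x) (point_part q 1 \<theta>))"
  proof (rule GLT_cong)
    show "reordered_kron 1 (\<lambda>i. prod_list (m i n)) s t (\<lambda>i. A i n) = A 1 n" if "n \<in> I" for n
      using 1(1)[OF _ that, of 1] by (intro reordered_kron_1) simp
    show "\<kappa> 1 (point_part q 1 x) (point_part q 1 \<theta>) = \<kappa> 1 x \<theta>" if "x \<in> unit_cube (q 1)" "\<theta> \<in> pi_cube (q 1)" for x \<theta>
    proof -
      have "x \<in> extensional {..<q 1}" "\<theta> \<in> extensional {..<q 1}"
        using that by (simp_all add: unit_cube_def pi_cube_def PiE_def)
      then show ?thesis by (simp only: pp)
    qed
  qed
  then show ?case unfolding u by (simp add: kron_list_Cons del: One_nat_def)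
next
  case (Suc d)
  let ?Q = "\<Sum>i=1..d. q i"
  have u: "[1..<Suc (Suc d)] = [1..<Suc d] @ [Suc d]" by simp
  have IH: "GLT I ?Q (\<lambda>n. concat (map (\<lambda>i. m i n) [1..<Suc d])) (\<Prod>i=1..d. s i) (\<Prod>i=1..d. t i)
    (\<lambda>n. reordered_kron d (\<lambda>i. prod_list (m i n)) s t (\<lambda>i. A i n))
    (\<lambda>x \<theta>. kron_list (map (\<lambda>i. \<kappa> i (point_part q i x) (point_part q i \<theta>)) [1..<Suc d]))"
    using Suc.prems by (intro Suc.IH) auto
  have G: "GLT I (q (Suc d)) (m (Suc d)) (s (Suc d)) (t (Suc d)) (A (Suc d)) (\<kappa> (Suc d))"
    using Suc.prems by simp
  \<comment> \<open>The coordinates of the ith part, for i at most d, all lie among the first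
    \<open>?Q\<close>, so cutting a point off there leaves them unchanged.\<close>
  have 1: "point_part q i (fst_part ?Q x) = point_part q i x" if "i \<in> {1..d}" for i x
  proof -
    have "(\<Sum>j=1..<i. q j) + q i = (\<Sum>j=1..i. q j)"
      using that by (simp add: atLeastLessThanSuc_atLeastAtMost[symmetric])
    also have "\<dots> \<le> ?Q" using that by (intro sum_mono2) auto
    finally show ?thesis by (auto simp: point_part_def fst_part_def fun_eq_iff)
  qed
  have 2: "snd_part ?Q (q (Suc d)) x = point_part q (Suc d) x" for x
    by (simp add: point_part_def snd_part_def atLeastLessThanSuc_atLeastAtMost)
  have sym: "kron (kron_list (map (\<lambda>i. \<kappa> i (point_part q i (fst_part ?Q x)) (point_part q i (fst_part ?Q \<theta>))) [1..<Suc d]))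
     (\<kappa> (Suc d) (snd_part ?Q (q (Suc d)) x) (snd_part ?Q (q (Suc d)) \<theta>)) =
     kron_list (map (\<lambda>i. \<kappa> i (point_part q i x) (point_part q i \<theta>)) [1..<Suc (Suc d)])" for x \<theta>
  proof -
    have "map (\<lambda>i. \<kappa> i (point_part q i (fst_part ?Q x)) (point_part q i (fst_part ?Q \<theta>))) [1..<Suc d] =
      map (\<lambda>i. \<kappa> i (point_part q i x) (point_part q i \<theta>)) [1..<Suc d]"
    proof (intro map_cong refl)
      fix i assume "i \<in> set [1..<Suc d]"
      then have "i \<in> {1..d}" by auto
      then show "\<kappa> i (point_part q i (fst_part ?Q x)) (point_part q i (fst_part ?Q \<theta>)) =
          \<kappa> i (point_part q i x) (point_part q i \<theta>)" by (simp only: 1)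
    qed
    then show ?thesis unfolding 2 u map_append kron_list_snoc list.map by (rule arg_cong)
  qed
  have N: "prod_list (concat (map (\<lambda>i. m i n) [1..<Suc d])) = (\<Prod>i\<leftarrow>[1..<Suc d]. prod_list (m i n))" for n
    by (simp add: prod_list_concat comp_def del: upt_Suc)
  have mat: "reordered_kron (Suc d) (\<lambda>i. prod_list (m i n)) s t (\<lambda>i. A i n) =
    block_kron (prod_list (concat (map (\<lambda>i. m i n) [1..<Suc d]))) (prod_list (m (Suc d) n)) (\<Prod>i=1..d. s i) (s (Suc d)) (\<Prod>i=1..d. t i) (t (Suc d))
      (reordered_kron d (\<lambda>i. prod_list (m i n)) s t (\<lambda>i. A i n)) (A (Suc d) n)" if "n \<in> I" for n
    unfolding N prod_list_upt[symmetric] using Suc.hyps Suc.prems(1)[OF _ that] by (intro reordered_kron_Suc)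
  have dims: "(\<Sum>i=1..Suc d. q i) = ?Q + q (Suc d)" "(\<Prod>i=1..Suc d. s i) = (\<Prod>i=1..d. s i) * s (Suc d)"
    "(\<Prod>i=1..Suc d. t i) = (\<Prod>i=1..d. t i) * t (Suc d)" by simp_all
  have c: "concat (map (\<lambda>i. m i n) [1..<Suc (Suc d)]) = concat (map (\<lambda>i. m i n) [1..<Suc d]) @ m (Suc d) n" for n
    unfolding u by simp
  show ?case
    unfolding dims c by (rule GLT_cong[OF GLT_block_kron[OF IH G]]) (simp_all only: mat sym)
qed

theorem theorem8p1:
  fixes d :: nat and s t q :: "nat \<Rightarrow> nat" and I :: "nat set"
    and m :: "nat \<Rightarrow> nat \<Rightarrow> nat list"
    and A :: "nat \<Rightarrow> nat \<Rightarrow> complex mat"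
    and \<kappa> :: "nat \<Rightarrow> point \<Rightarrow> point \<Rightarrow> complex mat"
  defines "m' \<equiv> \<lambda>n. concat (map (\<lambda>i. m i n) [1..<Suc d])"
    and "\<kappa>' \<equiv> \<lambda>x \<theta>. kron_list (map (\<lambda>i. \<kappa> i (point_part q i x) (point_part q i \<theta>)) [1..<Suc d])"
  assumes "0 < d" and "\<And>i. i \<in> {1..d} \<Longrightarrow> 0 < s i" and "\<And>i. i \<in> {1..d} \<Longrightarrow> 0 < t i"
    and "infinite I" and "I \<subseteq> {1..}"
    and "\<And>i. i \<in> {1..d} \<Longrightarrow> multi_index_seq I (q i) (m i)"
    and "\<And>i n. i \<in> {1..d} \<Longrightarrow> n \<in> I \<Longrightarrow>
           A i n \<in> carrier_mat (prod_list (m i n) * s i) (prod_list (m i n) * t i)"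
    and "\<And>i. i \<in> {1..d} \<Longrightarrow> GLT I (q i) (m i) (s i) (t i) (A i) (\<kappa> i)"
  shows "GLT I (\<Sum>i=1..d. q i) m' (\<Prod>i=1..d. s i) (\<Prod>i=1..d. t i)
           (\<lambda>n. transpose_mat (perm_Pi (map (\<lambda>i. prod_list (m i n)) [1..<Suc d]) (map s [1..<Suc d]))
                * kron_list (map (\<lambda>i. A i n) [1..<Suc d])
                * perm_Pi (map (\<lambda>i. prod_list (m i n)) [1..<Suc d]) (map t [1..<Suc d]))
           \<kappa>'
         \<and> ((\<forall>i\<in>{1..d}. s i = 1 \<and> t i = 1) \<longrightarrow>
            GLT I (\<Sum>i=1..d. q i) m' 1 1 (\<lambda>n. kron_list (map (\<lambda>i. A i n) [1..<Suc d])) \<kappa>')"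
proof (intro conjI impI)
  show *: "GLT I (\<Sum>i=1..d. q i) m' (\<Prod>i=1..d. s i) (\<Prod>i=1..d. t i)
           (\<lambda>n. transpose_mat (perm_Pi (map (\<lambda>i. prod_list (m i n)) [1..<Suc d]) (map s [1..<Suc d]))
                * kron_list (map (\<lambda>i. A i n) [1..<Suc d])
                * perm_Pi (map (\<lambda>i. prod_list (m i n)) [1..<Suc d]) (map t [1..<Suc d]))
           \<kappa>'"
    unfolding m'_def \<kappa>'_def reordered_kron_def[symmetric] using assms(3,9,10) by (rule GLT_reordered_kron)
  assume st: "\<forall>i\<in>{1..d}. s i = 1 \<and> t i = 1"
  then have p: "(\<Prod>i=1..d. s i) = 1" "(\<Prod>i=1..d. t i) = 1" by simp_all
  show "GLT I (\<Sum>i=1..d. q i) m' 1 1 (\<lambda>n. kron_list (map (\<lambda>i. A i n) [1..<Suc d])) \<kappa>'"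
    \<comment> \<open>For trivial blocks, conjugation by \<Pi> leaves the Kronecker product
      unchanged, so the scalar case is the general one rewritten.\<close>
    by (rule GLT_cong[OF *[unfolded p reordered_kron_def[symmetric]]])
       (use reordered_kron_ones[OF assms(3)] st assms(9) in \<open>auto simp del: upt_Suc\<close>)
qed

end
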